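(* Let $r,s,t\in\mathbb{C}\setminus\{0,1\}$ be pairwise distinct, $F(x)=x(x-1)(x-r)(x-s)(x-t)$, and let $X: y^2=F(x)$ be the corresponding genus $2$ curve. Let $\mathcal{M}_{NR}\simeq\mathbb{P}^3$ be the Narasimhan-Ramanan moduli space of semistable rank $2$ bundles with trivial determinant on $X$, with the homogeneous coordinates $(u_0:u_1:u_2:u_3)$ described in the context. Let $E$ be the bundle associated with a generic $(R,S,T)\in\mathbb{C}^3$ (so that $E$ is stable, the map $\phi:(R,S,T)\mapsto E\in\mathcal{M}_{NR}$ is locally biholomorphic there, and $u_3\neq 0$ at $E$), and let $$\eta_0\,\mathrm{d}\!\left(\tfrac{u_0}{u_3}\right)+\eta_1\,\mathrm{d}\!\left(\tfrac{u_1}{u_3}\right)+\eta_2\,\mathrm{d}\!\left(\tfrac{u_2}{u_3}\right)\in \mathrm{T}^\vee_E\mathcal{M}_{NR}.$$ Let $\theta_E\in \mathrm{H}^0(X,\mathfrak{sl}(E)\otimes\Omega^1_X)$ be the trace free Higgs field corresponding to this covector under the identification described in the context. Then the Hitchin map is given by $$\det(\theta_E)=(h_2x^2+h_1x+h_0)\,\frac{(\mathrm{d}x)^{\otimes 2}}{x(x-1)(x-r)(x-s)(x-t)},$$ where $$\begin{aligned}4u_3^4\,h_0=\;& rst\,\big[\eta_0(u_0^2-u_3^2)+\eta_1(u_0u_1+u_2u_3)+\eta_2(u_0u_2+u_1u_3)\big]^2\\ &-st\,\big[\eta_0(u_0u_1-u_2u_3)+\eta_1(u_1^2+u_3^2)+\eta_2(u_0u_3+u_1u_2)\big]^2\\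 &+4rs\,(\eta_0u_0+\eta_1u_1)^2u_3^2\\ &-rt\,\big[\eta_0(u_0^2+u_3^2)+\eta_1(u_0u_1+u_2u_3)+\eta_2(u_0u_2-u_1u_3)\big]^2,\end{aligned}$$ $$\begin{aligned}4u_3^4\,h_1=\;& t\,(u_0^2+u_1^2+u_2^2+u_3^2)\big[(\eta_0^2+\eta_1^2+\eta_2^2)u_3^2+(\eta_0u_0+\eta_1u_1+\eta_2u_2)^2\big]\\ &+st\,(u_0^2-u_1^2+u_2^2-u_3^2)\big[(\eta_0^2-\eta_1^2+\eta_2^2)u_3^2-(\eta_0u_0+\eta_1u_1+\eta_2u_2)^2\big]\\ &+4r\,(u_0u_2-u_1u_3)u_3\big[\eta_0\eta_2u_3+(\eta_0u_0+\eta_1u_1+\eta_2u_2)\eta_1\big]\\ &+4rs\,(u_0u_2+u_1u_3)u_3\big[\eta_0\eta_2u_3-(\eta_0u_0+\eta_1u_1+\eta_2u_2)\eta_1\big]\\ &+4s\,(u_0u_3+u_1u_2)u_3\big[\eta_1\eta_2u_3-(\eta_0u_0+\eta_1u_1+\eta_2u_2)\eta_0\big]\\ &+4rt\,(u_0u_1+u_2u_3)u_3\big[\eta_0\eta_1u_3-(\eta_0u_0+\eta_1u_1+\eta_2u_2)\eta_2\big],\end{aligned}$$ $$\begin{aligned}4u_3^4\,h_2=\;& s\,\big[\eta_0(u_0u_2+u_1u_3)+\eta_1(u_0u_3+u_1u_2)+\eta_2(u_2^2-u_3^2)\big]^2\\ &-\big[\eta_0(u_0u_2-u_1u_3)+\eta_1(u_0u_3+u_1u_2)+\eta_2(u_2^2+u_3^2)\big]^2\\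 &-t\,\big[\eta_0(u_0u_1+u_2u_3)+\eta_1(u_1^2+u_3^2)-\eta_2(u_0u_3-u_1u_2)\big]^2\\ &+4r\,(\eta_1u_1+\eta_2u_2)^2u_3^2.\end{aligned}$$
   Context: **Curve.** $\pi:X\to\mathbb{P}^1$, $(x,y)\mapsto x$; the Weierstrass points are $W=\{w_0,w_1,w_r,w_s,w_t,w_\infty\}$, lying over $\underline W=\{0,1,r,s,t,\infty\}$. **Bundles.** Let $\underline E=\mathcal{O}_{\mathbb{P}^1}(-1)\oplus\mathcal{O}_{\mathbb{P}^1}(-2)$. Let $\sigma_{-1}$ be a meromorphic section of the summand $\mathcal{O}(-1)$ with divisor $-[\infty]$, and $\sigma_1$ a meromorphic section of the summand $\mathcal{O}(-2)$ with divisor $-2[\infty]$; over $\mathbb{P}^1\setminus\{\infty\}$ write vectors as $\binom{z_1}{z_2}=z_1\sigma_{-1}+z_2\sigma_1$. To $(R,S,T)\in\mathbb{C}^3$ associate the quasi-parabolic structure $\underline{p}$ (one line in each fibre over $\underline W$) generated by $\binom01,\binom11,\binom R1,\binom S1,\binom T1$ over $x=0,1,r,s,t$, and over $\infty$ by the fibre of the summand $\mathcal{O}(-2)$ generated by $\sigma_1$. The associated bundle $E$ on $X$ is $\mathrm{elm}^+_W(\pi^*(\underline E,\underline p))$: the sheaf of sections of $\pi^*\underline E$ allowed to have at most simple poles at the points of $W$ whose polar part at $w_i$ lies in the line $\underline p_{\pi(w_i)}$. It has rank $2$ and trivial determinant. **Classifying map.** The point $(v_0:v_1:v_2:v_3)$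 of $\mathcal{M}_{NR}\simeq\mathbb{P}^3$ defined by $E$ is $\phi(R,S,T)$ with $v_0=s^2t^2(r^2-1)(s-t)R-r^2t^2(s^2-1)(r-t)S+s^2r^2(t^2-1)(r-s)T+t^2(t-1)(r^2-s^2)RS-s^2(s-1)(r^2-t^2)RT+r^2(r-1)(s^2-t^2)ST$, $v_1=rst[(r-1)(s-t)R-(s-1)(r-t)S+(t-1)(r-s)T+(t-1)(r-s)RS-(s-1)(r-t)RT+(r-1)(s-t)ST]$, $v_2=-st(r^2-1)(s-t)R+rt(s^2-1)(r-t)S-rs(t^2-1)(r-s)T-t(t-1)(r^2-s^2)RS+s(s-1)(r^2-t^2)RT-r(r-1)(s^2-t^2)ST$, $v_3=st(r-1)(s-t)R-rt(s-1)(r-t)S+sr(t-1)(r-s)T+t(t-1)(r-s)RS-s(s-1)(r-t)RT+r(r-1)(s-t)ST$. **Coordinates $u$.** Choose square roots $\omega_0^2=F'(0)$, $\omega_1^2=-F'(1)$, $\omega_r^2=F'(r)$, $\omega_s^2=F'(s)$ and put $a=rst(r-s)\omega_1+t\omega_r\omega_s-rt(r-1)\omega_s-st\,\omega_1\omega_r$, $b=-st(s-1)\omega_r+rt\,\omega_1\omega_s$, $c=t(r-s)\omega_0\omega_1-t(r-1)\omega_0\omega_s$, $d=-t(r-1)(s-1)(r-s)\omega_0+t(s-1)\omega_0\omega_r$, $$M=\begin{pmatrix}a&b&c&d\\-b&a&d&-c\\c&d&a&b\\d&-c&-b&a\end{pmatrix}\begin{pmatrix}1&1&0&-(rs+st+rt)\\0&\omega_1&0&0\\0&\omega_0&\omega_0&\omega_0\\0&0&0&\omega_0\omega_1\end{pmatrix},$$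 where the square roots are such that $M$ is invertible. Then $(u_0,u_1,u_2,u_3)^{\top}=M\,(v_0,v_1,v_2,v_3)^{\top}$. **Identification of covectors with Higgs fields.** The pull-back by $\phi$ of a covector at $E$ is written $c_r\mathrm{d}R+c_s\mathrm{d}S+c_t\mathrm{d}T$. Put $\underline\theta=c_r\underline\theta_r+c_s\underline\theta_s+c_t\underline\theta_t$, where for $(i,Z)\in\{(r,R),(s,S),(t,T)\}$, in the frame $(\sigma_{-1},\sigma_1)$, $$\underline\theta_i=\begin{pmatrix}0&0\\1-Z&0\end{pmatrix}\frac{\mathrm{d}x}{x}+\begin{pmatrix}Z&-Z\\Z&-Z\end{pmatrix}\frac{\mathrm{d}x}{x-1}+\begin{pmatrix}-Z&Z^2\\-1&Z\end{pmatrix}\frac{\mathrm{d}x}{x-i}.$$ This is a logarithmic Higgs field on $\underline E$ whose residues at $\underline W$ are nilpotent and annihilate $\underline p$; hence $\pi^*\underline\theta$ extends to a holomorphic trace free Higgs field $\theta_E: E\to E\otimes\Omega^1_X$. The covector corresponds to this $\theta_E$. A quadratic differential in $x$ on $\mathbb{P}^1$ is regarded on $X$ via $\pi^*$. *)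

theory Defs
  imports "HOL-Analysis.Analysis" "HOL-Computational_Algebra.Polynomial"
begin

text \<open>
  Throughout, \<open>p :: complex^3\<close> is the triple \<open>(R, S, T)\<close>. Vectors and matrices are indexed
  from 1, so the homogeneous coordinates \<open>(v\<^sub>0 : v\<^sub>1 : v\<^sub>2 : v\<^sub>3)\<close> and \<open>(u\<^sub>0 : u\<^sub>1 : u\<^sub>2 : u\<^sub>3)\<close> are
  the components 1, 2, 3, 4 of vectors in \<open>complex^4\<close>.
\<close>

section \<open>The curve\<close>

definition quintic :: "complex \<Rightarrow> complex \<Rightarrow> complex \<Rightarrow> complex \<Rightarrow> complex" where
  "quintic r s t x = x * (x - 1) * (x - r) * (x - s) * (x - t)"

definition affine_curve :: "complex \<Rightarrow> complex \<Rightarrow> complex \<Rightarrow> (complex \<times> complex) set" where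
  "affine_curve r s t = {(x, y). y\<^sup>2 = quintic r s t x}"

text \<open>The compact curve \<open>X\<close>; \<open>None\<close> is the point \<open>w\<^sub>\<infinity>\<close> at infinity.\<close>

definition curve :: "complex \<Rightarrow> complex \<Rightarrow> complex \<Rightarrow> (complex \<times> complex) option set" where
  "curve r s t = insert None (Some ` affine_curve r s t)"

fun weierstrass :: "(complex \<times> complex) option \<Rightarrow> bool" where
  "weierstrass None = True"
| "weierstrass (Some (x, y)) = (y = 0)"

text \<open>The punctured neighbourhoods of a point of \<open>X\<close>, as a filter on the affine curve.\<close>

definition punctured_nhds ::
    "complex \<Rightarrow> complex \<Rightarrow> complex \<Rightarrow> (complex \<times> complex) option \<Rightarrow> (complex \<times> complex) filter" where
  "punctured_nhds r s t P =
     (case P of None \<Rightarrow> inf at_infinity (principal (affine_curve r s t))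
      | Some q \<Rightarrow> at q within affine_curve r s t)"

text \<open>Holomorphy at a point \<open>q = (x, y)\<close> with \<open>y \<noteq> 0\<close>, where \<open>x\<close> is a local coordinate.\<close>

definition holomorphic_at ::
    "complex \<Rightarrow> complex \<Rightarrow> complex \<Rightarrow> (complex \<times> complex \<Rightarrow> complex) \<Rightarrow> complex \<times> complex \<Rightarrow> bool" where
  "holomorphic_at r s t f q \<longleftrightarrow>
     (\<exists>g. g analytic_on {fst q} \<and>
          (\<forall>\<^sub>F q' in inf (nhds q) (principal (affine_curve r s t)). f q' = g (fst q')))"

text \<open>A local coordinate at a Weierstrass point: \<open>y\<close>, respectively \<open>x\<^sup>2/y\<close> at \<open>w\<^sub>\<infinity>\<close>.\<close>

fun local_coord :: "(complex \<times> complex) option \<Rightarrow> complex \<times> complex \<Rightarrow> complex" where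
  "local_coord None (x, y) = x\<^sup>2 / y"
| "local_coord (Some _) (x, y) = y"

text \<open>
  \<open>dx = dx_coeff P \<cdot> \<omega>\<close> for a generator \<open>\<omega>\<close> of the stalk of \<open>\<Omega>\<^sup>1\<close> at \<open>P\<close>. At a finite Weierstrass
  point \<open>\<omega> = dx/y\<close>. At \<open>w\<^sub>\<infinity>\<close>, with \<open>\<tau> = x\<^sup>2/y\<close>, both \<open>x \<tau>\<^sup>2\<close> and \<open>y \<tau>\<^sup>5\<close> are units, so that \<open>dx\<close> is
  a unit times \<open>\<tau>\<^sup>-\<^sup>3 d\<tau>\<close>, and \<open>x\<^sup>4/y\<close> is a unit times \<open>\<tau>\<^sup>-\<^sup>3\<close>.
\<close>

fun dx_coeff :: "(complex \<times> complex) option \<Rightarrow> complex \<times> complex \<Rightarrow> complex" where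
  "dx_coeff None (x, y) = x ^ 4 / y"
| "dx_coeff (Some w) (x, y) = (if snd w = 0 then y else 1)"


section \<open>The bundle \<open>E\<close>\<close>

text \<open>
  A vector \<open>z\<close> stands for \<open>z\<^sub>1 \<sigma>\<^sub>-\<^sub>1 + z\<^sub>2 \<sigma>\<^sub>1\<close>. Over \<open>\<infinity>\<close> the sections \<open>\<sigma>\<^sub>-\<^sub>1/x\<close>, \<open>\<sigma>\<^sub>1/x\<^sup>2\<close> form a frame
  of the underlying bundle, as the divisors of \<open>\<sigma>\<^sub>-\<^sub>1\<close>, \<open>\<sigma>\<^sub>1\<close> are \<open>-[\<infinity>]\<close>, \<open>-2[\<infinity>]\<close>.
\<close>

fun frame_coords :: "(complex \<times> complex) option \<Rightarrow> complex \<times> complex \<Rightarrow> complex^2 \<Rightarrow> complex^2" where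
  "frame_coords None (x, y) z = vector [x * z $ 1, x\<^sup>2 * z $ 2]"
| "frame_coords (Some _) (x, y) z = z"

text \<open>A generator of the parabolic line over a point of \<open>{0, 1, r, s, t, \<infinity>}\<close>, in that frame.\<close>

definition parabolic :: "complex \<Rightarrow> complex \<Rightarrow> complex \<Rightarrow> complex^3 \<Rightarrow> complex option \<Rightarrow> complex^2" where
  "parabolic r s t p i =
     (if i = Some 0 then vector [0, 1]
      else if i = Some 1 then vector [1, 1]
      else if i = Some r then vector [p $ 1, 1]
      else if i = Some s then vector [p $ 2, 1]
      else if i = Some t then vector [p $ 3, 1]
      else vector [0, 1])"

text \<open>
  \<open>E_germ r s t p P z\<close>: near \<open>P\<close>, the vector valued function \<open>z\<close> is a section of
  \<open>E = elm\<^sup>+\<^sub>W (\<pi>\<^sup>*(E\<^sub>0, p))\<close>, where \<open>E\<^sub>0 = O(-1) \<oplus> O(-2)\<close>. At a Weierstrass point, the existence of the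
  limit says that the pole is at most simple, and the limit is the polar part.
\<close>

definition E_germ ::
    "complex \<Rightarrow> complex \<Rightarrow> complex \<Rightarrow> complex^3 \<Rightarrow> (complex \<times> complex) option
      \<Rightarrow> (complex \<times> complex \<Rightarrow> complex^2) \<Rightarrow> bool" where
  "E_germ r s t p P z \<longleftrightarrow>
     (if weierstrass P
      then (\<forall>\<^sub>F q in punctured_nhds r s t P. \<forall>i. holomorphic_at r s t (\<lambda>q. z q $ i) q) \<and>
           (\<exists>c. ((\<lambda>q. local_coord P q *s frame_coords P q (z q))
                   \<longlongrightarrow> c *s parabolic r s t p (map_option fst P)) (punctured_nhds r s t P))
      else (\<forall>i. holomorphic_at r s t (\<lambda>q. z q $ i) (the P)))"

text \<open>The same for sections \<open>z dx\<close> of \<open>E \<otimes> \<Omega>\<^sup>1\<close>.\<close>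

definition E_Omega_germ ::
    "complex \<Rightarrow> complex \<Rightarrow> complex \<Rightarrow> complex^3 \<Rightarrow> (complex \<times> complex) option
      \<Rightarrow> (complex \<times> complex \<Rightarrow> complex^2) \<Rightarrow> bool" where
  "E_Omega_germ r s t p P z \<longleftrightarrow> E_germ r s t p P (\<lambda>q. dx_coeff P q *s z q)"

text \<open>
  Over \<open>X - W\<close> the bundle \<open>E\<close> has the frame \<open>(\<sigma>\<^sub>-\<^sub>1, \<sigma>\<^sub>1)\<close>, and a homomorphism \<open>E \<rightarrow> E \<otimes> \<Omega>\<^sup>1\<close> is
  determined by its matrix \<open>A dx\<close> there. It is a trace free holomorphic Higgs field if \<open>A\<close> has trace
  zero and maps germs of sections of \<open>E\<close> to germs of sections of \<open>E \<otimes> \<Omega>\<^sup>1\<close> at all points of \<open>X\<close>.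
\<close>

definition higgs_field ::
    "complex \<Rightarrow> complex \<Rightarrow> complex \<Rightarrow> complex^3 \<Rightarrow> (complex \<times> complex \<Rightarrow> complex^2^2) \<Rightarrow> bool" where
  "higgs_field r s t p A \<longleftrightarrow>
     (\<forall>(x, y) \<in> affine_curve r s t. y \<noteq> 0 \<longrightarrow> trace (A (x, y)) = 0) \<and>
     (\<forall>P \<in> curve r s t. \<forall>z. E_germ r s t p P z \<longrightarrow> E_Omega_germ r s t p P (\<lambda>q. A q *v z q))"


section \<open>The classifying map and the coordinates \<open>u\<close>\<close>

definition v_coords :: "complex \<Rightarrow> complex \<Rightarrow> complex \<Rightarrow> complex^3 \<Rightarrow> complex^4" where
  "v_coords r s t p =
     (let R = p $ 1; S = p $ 2; T = p $ 3 in
      vector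
       [s^2*t^2*(r^2-1)*(s-t)*R - r^2*t^2*(s^2-1)*(r-t)*S + s^2*r^2*(t^2-1)*(r-s)*T
          + t^2*(t-1)*(r^2-s^2)*R*S - s^2*(s-1)*(r^2-t^2)*R*T + r^2*(r-1)*(s^2-t^2)*S*T,
        r * s * t*((r-1)*(s-t)*R - (s-1)*(r-t)*S + (t-1)*(r-s)*T
          + (t-1)*(r-s)*R*S - (s-1)*(r-t)*R*T + (r-1)*(s-t)*S*T),
        -s*t*(r^2-1)*(s-t)*R + r*t*(s^2-1)*(r-t)*S - r * s*(t^2-1)*(r-s)*T
          - t*(t-1)*(r^2-s^2)*R*S + s*(s-1)*(r^2-t^2)*R*T - r*(r-1)*(s^2-t^2)*S*T,
        s*t*(r-1)*(s-t)*R - r*t*(s-1)*(r-t)*S + s*r*(t-1)*(r-s)*T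
          + t*(t-1)*(r-s)*R*S - s*(s-1)*(r-t)*R*T + r*(r-1)*(s-t)*S*T])"

definition u_matrix ::
    "complex \<Rightarrow> complex \<Rightarrow> complex \<Rightarrow> complex \<Rightarrow> complex \<Rightarrow> complex \<Rightarrow> complex \<Rightarrow> complex^4^4" where
  "u_matrix r s t \<omega>0 \<omega>1 \<omega>r \<omega>s =
     (let a = r * s * t*(r-s)*\<omega>1 + t*\<omega>r*\<omega>s - r*t*(r-1)*\<omega>s - s*t*\<omega>1*\<omega>r;
          b = -s*t*(s-1)*\<omega>r + r*t*\<omega>1*\<omega>s;
          c = t*(r-s)*\<omega>0*\<omega>1 - t*(r-1)*\<omega>0*\<omega>s;
          d = -t*(r-1)*(s-1)*(r-s)*\<omega>0 + t*(s-1)*\<omega>0*\<omega>r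
      in (vector [vector [ a,  b,  c,  d],
                 vector [-b,  a,  d, -c],
                 vector [ c,  d,  a,  b],
                 vector [ d, -c, -b,  a]] :: complex^4^4)
         ** vector [vector [1,  1,  0, -(r * s + s*t + r*t)],
                    vector [0, \<omega>1,  0,  0],
                    vector [0, \<omega>0, \<omega>0, \<omega>0],
                    vector [0,  0,  0, \<omega>0*\<omega>1]])"

definition u_coords ::
    "complex \<Rightarrow> complex \<Rightarrow> complex \<Rightarrow> complex \<Rightarrow> complex \<Rightarrow> complex \<Rightarrow> complex \<Rightarrow> complex^3 \<Rightarrow> complex^4" where
  "u_coords r s t \<omega>0 \<omega>1 \<omega>r \<omega>s p = u_matrix r s t \<omega>0 \<omega>1 \<omega>r \<omega>s *v v_coords r s t p"

text \<open>The classifying map \<open>\<phi>\<close> in the affine chart \<open>(u\<^sub>0/u\<^sub>3, u\<^sub>1/u\<^sub>3, u\<^sub>2/u\<^sub>3)\<close>, meaningful where \<open>u\<^sub>3 \<noteq> 0\<close>.\<close>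

definition phi_chart ::
    "complex \<Rightarrow> complex \<Rightarrow> complex \<Rightarrow> complex \<Rightarrow> complex \<Rightarrow> complex \<Rightarrow> complex \<Rightarrow> complex^3 \<Rightarrow> complex^3" where
  "phi_chart r s t \<omega>0 \<omega>1 \<omega>r \<omega>s p =
     (let u = u_coords r s t \<omega>0 \<omega>1 \<omega>r \<omega>s p in vector [u $ 1 / u $ 4, u $ 2 / u $ 4, u $ 3 / u $ 4])"

text \<open>Holomorphy: the (real) Frechet derivative exists and is complex linear.\<close>

definition locally_biholomorphic_at :: "(complex^3 \<Rightarrow> complex^3) \<Rightarrow> complex^3 \<Rightarrow> bool" where
  "locally_biholomorphic_at f p \<longleftrightarrow>
     (\<exists>U V g. open U \<and> p \<in> U \<and> open V \<and> homeomorphism U V f g \<and>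
        (\<forall>x\<in>U. \<exists>J :: complex^3^3. (f has_derivative (\<lambda>h. J *v h)) (at x)) \<and>
        (\<forall>y\<in>V. \<exists>J :: complex^3^3. (g has_derivative (\<lambda>h. J *v h)) (at y)))"

text \<open>\<open>Q\<close> holds on a nonempty Zariski open subset of \<open>\<complex>\<^sup>3\<close>, namely where some \<open>G \<noteq> 0\<close> does not vanish.\<close>

definition zariski_generic :: "(complex^3 \<Rightarrow> bool) \<Rightarrow> bool" where
  "zariski_generic Q \<longleftrightarrow>
     (\<exists>G :: complex poly poly poly. G \<noteq> 0 \<and>
        (\<forall>p. poly (poly (poly G [:[:p $ 1:]:]) [:p $ 2:]) (p $ 3) \<noteq> 0 \<longrightarrow> Q p))"


section \<open>Higgs fields of covectors\<close>

text \<open>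
  The coefficients \<open>(c\<^sub>r, c\<^sub>s, c\<^sub>t)\<close> of \<open>c\<^sub>r dR + c\<^sub>s dS + c\<^sub>t dT = f\<^sup>*(\<eta>\<^sub>0 df\<^sub>0 + \<eta>\<^sub>1 df\<^sub>1 + \<eta>\<^sub>2 df\<^sub>2)\<close> at \<open>p\<close>.
\<close>

definition pullback_covector :: "(complex^3 \<Rightarrow> complex^3) \<Rightarrow> complex^3 \<Rightarrow> complex^3 \<Rightarrow> complex^3" where
  "pullback_covector f p \<eta> = (\<chi> j. \<Sum>i\<in>UNIV. \<eta> $ i * deriv (\<lambda>z. f (p + axis j z) $ i) 0)"

definition mat2 :: "complex \<Rightarrow> complex \<Rightarrow> complex \<Rightarrow> complex \<Rightarrow> complex^2^2" where
  "mat2 a b c d = vector [vector [a, b], vector [c, d]]"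

definition scale_mat :: "complex \<Rightarrow> complex^2^2 \<Rightarrow> complex^2^2" where
  "scale_mat k A = (\<chi> i j. k * A $ i $ j)"

text \<open>The coefficient of \<open>dx\<close> in \<open>\<theta>\<^sub>i\<close>, in the frame \<open>(\<sigma>\<^sub>-\<^sub>1, \<sigma>\<^sub>1)\<close>.\<close>

definition theta_basis :: "complex \<Rightarrow> complex \<Rightarrow> complex \<Rightarrow> complex^2^2" where
  "theta_basis i Z x =
     scale_mat (1 / x) (mat2 0 0 (1 - Z) 0)
     + scale_mat (1 / (x - 1)) (mat2 Z (-Z) Z (-Z))
     + scale_mat (1 / (x - i)) (mat2 (-Z) (Z^2) (-1) Z)"

text \<open>The pull-back along \<open>\<pi>\<close> of \<open>c\<^sub>r \<theta>\<^sub>r + c\<^sub>s \<theta>\<^sub>s + c\<^sub>t \<theta>\<^sub>t\<close>.\<close>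

definition theta :: "complex \<Rightarrow> complex \<Rightarrow> complex \<Rightarrow> complex^3 \<Rightarrow> complex^3 \<Rightarrow> complex \<times> complex \<Rightarrow> complex^2^2" where
  "theta r s t p c q =
     scale_mat (c $ 1) (theta_basis r (p $ 1) (fst q))
     + scale_mat (c $ 2) (theta_basis s (p $ 2) (fst q))
     + scale_mat (c $ 3) (theta_basis t (p $ 3) (fst q))"

end

theory Submission
  imports Defs "HOL-Complex_Analysis.Conformal_Mappings"
begin

text \<open>
  The residues of \<open>\<theta>\<close> are \<open>k\<^sub>i N\<^sub>i\<close> with \<open>N\<^sub>i\<close> nilpotent of image and kernel \<open>p\<^sub>i\<close>, so that
  \<open>det \<theta> = \<Sum>\<^sub>i\<^sub><\<^sub>j k\<^sub>i k\<^sub>j (p\<^sub>i - p\<^sub>j)\<^sup>2 / ((x - x\<^sub>i) (x - x\<^sub>j))\<close>, and the quadratic numerator of \<open>det \<theta>\<close> is known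
  from its values at \<open>0\<close> and \<open>1\<close> and its leading coefficient. On the other side the Hamiltonians are
  \<open>\<Sum>\<^sub>i\<^sub><\<^sub>j \<rho>\<^sub>i\<^sub>j\<^sup>2 / ((x - x\<^sub>i) (x - x\<^sub>j))\<close> for the generators \<open>\<rho>\<^sub>i\<^sub>j\<close> of \<open>so(6) = sl(4)\<close>, indexed by pairs of Weierstrass
  points and acting on the homogeneous coordinates \<open>u\<close>. The matrix \<open>(a, b, c, d)\<close> is a (split) quaternion, and
  conjugation by it is a rotation of the three indices \<open>r, s, t\<close>. In the rotated coordinates the Hamiltonians are free
  of square roots, and they agree with the numerator of \<open>det \<theta>\<close> by polynomial identities modulo the Euler relation.
\<close>

text \<open>The value at \<open>0\<close>, the value at \<open>1\<close> and the leading coefficient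
  are convenient data because each of the corresponding Hamiltonians is a combination of only four
  squares: one whose matrix commutes with all quaternion matrices, so that the change of coordinates
  leaves it alone, and three that are rotated among themselves. Up to constants these three carry
  the weights \<open>1/e\<close>, \<open>1/(e-1)\<close> or \<open>e\<close> at
  \<open>e = r, s, t\<close>, and they are residues of rational functions built from
  \<open>q^2/F\<close> with \<open>q\<close> quadratic. The residue theorem trades the sum over
  \<open>r, s, t\<close> for contributions of \<open>0\<close>, \<open>1\<close> and infinity, where
  only \<open>\<omega>0\<close> and \<open>\<omega>1\<close> occur. This is how
  \<open>\<omega>r\<close> and \<open>\<omega>s\<close> disappear, and why no root of
  \<open>F'(t)\<close> has to be chosen. The remaining roots are absorbed by a diagonal rescaling of
  the coordinates. The staging also keeps the main polynomial identities small: those about the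
  roots do not see \<open>R, S, T\<close>, and those about \<open>R, S, T\<close> do not see the
  roots.\<close>

section \<open>Quadratic forms in the covector\<close>

text \<open>
  \<open>(p, q1, q2, q3)\<close> are the coordinates \<open>v\<close> after a triangular change of coordinates that makes the common factors
  \<open>r s t\<close> and \<open>(r-1) (s-1) (t-1)\<close> visible, \<open>\<nu>\<close> is a covector in these coordinates, and \<open>(cr, cs, ct)\<close> its pull-back.
\<close>

locale parabolic_chart =
  fixes r s t R S T :: complex
    and \<nu>0 \<nu>1 \<nu>2 \<nu>3 p q1 q2 q3 cr cs ct :: complex
  assumes p: "p = (s-t)*R + (t-r)*S + (r-s)*T"
    and q1: "q1 = (s-t)*(r-1)*(R+S*T) + (t-r)*(s-1)*(S+R*T) + (r-s)*(t-1)*(T+R*S)"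
    and q2: "q2 = r*(s-t)*S*T + s*(t-r)*R*T + t*(r-s)*R*S"
    and q3: "q3 = (s-t)*(r-1)*(s*t*R+r*S*T) + (t-r)*(s-1)*(r*t*S+s*R*T) + (r-s)*(t-1)*(r * s*T+t*R*S)"
    and cr: "cr = \<nu>0*(s-t) + \<nu>1*((s-t)*(r-1) + (t-r)*(s-1)*T + (r-s)*(t-1)*S)
                  + \<nu>2*(s*(t-r)*T + t*(r-s)*S)
                  + \<nu>3*((s-t)*(r-1) * s*t + (t-r)*(s-1) * s*T + (r-s)*(t-1)*t*S)"
    and cs: "cs = \<nu>0*(t-r) + \<nu>1*((s-t)*(r-1)*T + (t-r)*(s-1) + (r-s)*(t-1)*R)
                  + \<nu>2*(r*(s-t)*T + t*(r-s)*R)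
                  + \<nu>3*((s-t)*(r-1)*r*T + (t-r)*(s-1)*r*t + (r-s)*(t-1)*t*R)"
    and ct: "ct = \<nu>0*(r-s) + \<nu>1*((s-t)*(r-1)*S + (t-r)*(s-1)*R + (r-s)*(t-1))
                  + \<nu>2*(r*(s-t)*S + s*(t-r)*R)
                  + \<nu>3*((s-t)*(r-1)*r*S + (t-r)*(s-1) * s*R + (r-s)*(t-1)*r * s)"
    and tangent: "\<nu>0*p + \<nu>1*q1 + \<nu>2*q2 + \<nu>3*q3 = 0"
begin

text \<open>The left side is the numerator of \<open>det \<theta>\<close> at \<open>x = 0\<close>:
  only pairs of poles that contain \<open>0\<close> survive there, hence the common factor, which is
  the weight of the pole at \<open>0\<close>. The right side is shaped for
  \<open>quadric_value_at_0\<close>: its first product will arise as a difference of two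
  squares.\<close>

lemma value_at_0:
  defines "m \<equiv> r * s*t" and "n \<equiv> (r-1)*(s-1)*(t-1)"
  shows "(cr*(1-R) + cs*(1-S) + ct*(1-T))
      * (s*t*cr*R^2 + r*t*cs*S^2 + r * s*ct*T^2 - m*(cr*R + cs*S + ct*T))
    = (m*\<nu>3*p - \<nu>1*q2)*(\<nu>0*q3 - m*\<nu>2*q1)
      - (\<nu>2*q2 + \<nu>3*q3)*((r * s+s*t+r*t - m)*(\<nu>0*p + \<nu>1*q1)
          + (\<nu>0*q2 - \<nu>1*q3 - m*(\<nu>2*p - \<nu>3*q1)) + (\<nu>0*q3 + n*\<nu>1*q2 - m*\<nu>2*q1 - m*n*\<nu>3*p))"
  using tangent unfolding m_def n_def p q1 q2 q3 cr cs ct by algebra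

text \<open>The left side factors because, at infinity, the leading coefficient of
  \<open>det \<theta>\<close> is minus the product of the leading terms of the two off-diagonal
  entries; the square of the diagonal entry decays faster.\<close>

lemma leading_value:
  defines "m \<equiv> r * s*t" and "n \<equiv> (r-1)*(s-1)*(t-1)"
  shows "(cr*(R-r) + cs*(S-s) + ct*(T-t))*(cr*R*(1-R) + cs*S*(1-S) + ct*T*(1-T))
    = (\<nu>0*q1 - \<nu>2*q3)*(\<nu>1*p - \<nu>3*q2)
      - (\<nu>1*q1 + \<nu>2*q2)*((r+s+t-1)*(\<nu>0*p + \<nu>3*q3)
          - (\<nu>0*q1 + n*\<nu>1*p - \<nu>2*q3 - n*\<nu>3*q2) + (\<nu>0*q2 + \<nu>1*q3 - m*\<nu>2*p - m*\<nu>3*q1))"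
  using tangent unfolding m_def n_def p q1 q2 q3 cr cs ct by algebra

text \<open>Only pairs of poles that contain \<open>1\<close> survive at \<open>x = 1\<close>, so
  the weight \<open>cr*R + cs*S + ct*T\<close> of that pole splits off.\<close>

lemma value_at_1:
  defines "m \<equiv> r * s*t" and "n \<equiv> (r-1)*(s-1)*(t-1)"
  shows "- (cr*R + cs*S + ct*T) * (n*(cr*(1-R) + cs*(1-S) + ct*(1-T))
        + cr*(1-R)^2*(s-1)*(t-1) + cs*(1-S)^2*(r-1)*(t-1) + ct*(1-T)^2*(r-1)*(s-1))
    = (\<nu>2*q1 - n*\<nu>3*p)*(n*\<nu>1*q2 - \<nu>0*q3)
      + (\<nu>1*q1 + \<nu>3*q3)*((m+2-r-s-t)*(\<nu>0*p + \<nu>2*q2)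
          + (\<nu>0*q1 + n*\<nu>1*p + \<nu>2*q3 + n*\<nu>3*q2) - (\<nu>0*q3 - n*\<nu>1*q2 + m*\<nu>2*q1 - m*n*\<nu>3*p))"
  using tangent unfolding m_def n_def p q1 q2 q3 cr cs ct by algebra

end

section \<open>Square roots and the rotation of the indices \<open>r\<close>, \<open>s\<close>,
  \<open>t\<close>\<close>

locale root_choice =
  fixes r s t \<omega>0 \<omega>1 \<omega>r \<omega>s a b c d :: complex
  assumes distinct: "r \<noteq> 0" "r \<noteq> 1" "s \<noteq> 0" "s \<noteq> 1" "t \<noteq> 0" "t \<noteq> 1" "r \<noteq> s" "r \<noteq> t" "s \<noteq> t"
    and roots: "\<omega>0^2 = r * s*t" "\<omega>1^2 = (r-1)*(s-1)*(t-1)"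
      "\<omega>r^2 = r*(r-1)*(r-s)*(r-t)" "\<omega>s^2 = s*(s-1)*(s-r)*(s-t)"
    and a: "a = r * s*t*(r-s)*\<omega>1 + t*\<omega>r*\<omega>s - r*t*(r-1)*\<omega>s - s*t*\<omega>1*\<omega>r"
    and b: "b = - s*t*(s-1)*\<omega>r + r*t*\<omega>1*\<omega>s"
    and c: "c = t*(r-s)*\<omega>0*\<omega>1 - t*(r-1)*\<omega>0*\<omega>s"
    and d: "d = - t*(r-1)*(s-1)*(r-s)*\<omega>0 + t*(s-1)*\<omega>0*\<omega>r"
begin

text \<open>
  Componentwise, these say that \<open>\<omega>r X\<^sub>r K = - K (r (r-1) E\<^sub>1 - \<omega>1 r E\<^sub>2 + \<omega>0 (r-1) E\<^sub>3)\<close>, and similarly for \<open>s\<close>, where \<open>K\<close> is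
  the matrix of the quaternion and \<open>X\<^sub>r\<close>, \<open>E\<^sub>i\<close> are the matrices of the bilinear forms in lemma \<open>rotate\<close>. The coefficients
  are the values at \<open>r\<close>, \<open>s\<close> of a basis of the quadratic polynomials that is orthogonal for the residue pairing.
\<close>

lemma intertwining_r:
  "(\<omega>r + r*(r-1))*a = \<omega>1*r*b + \<omega>0*(r-1)*c" "(\<omega>r - r*(r-1))*b = \<omega>1*r*a + \<omega>0*(r-1)*d"
  "(\<omega>r - r*(r-1))*c = - \<omega>1*r*d - \<omega>0*(r-1)*a" "(\<omega>r + r*(r-1))*d = - \<omega>1*r*c - \<omega>0*(r-1)*b"
proof -
  show "(\<omega>r + r*(r-1))*a = \<omega>1*r*b + \<omega>0*(r-1)*c" "(\<omega>r - r*(r-1))*b = \<omega>1*r*a + \<omega>0*(r-1)*d"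
    using roots unfolding a b c d by algebra+
  show "(\<omega>r - r*(r-1))*c = - \<omega>1*r*d - \<omega>0*(r-1)*a"
    unfolding a b c d by algebra
  show "(\<omega>r + r*(r-1))*d = - \<omega>1*r*c - \<omega>0*(r-1)*b"
    using roots(2,3) unfolding a b c d by algebra
qed

lemma intertwining_s:
  "\<omega>s*a = - s*(s-1)*b - \<omega>1 * s*a - \<omega>0*(s-1)*d" "\<omega>s*b = - s*(s-1)*a + \<omega>1 * s*b + \<omega>0*(s-1)*c"
  "\<omega>s*c = - s*(s-1)*d - \<omega>1 * s*c - \<omega>0*(s-1)*b" "\<omega>s*d = - s*(s-1)*c + \<omega>1 * s*d + \<omega>0*(s-1)*a"
proof -
  show "\<omega>s*a = - s*(s-1)*b - \<omega>1 * s*a - \<omega>0*(s-1)*d" "\<omega>s*b = - s*(s-1)*a + \<omega>1 * s*b + \<omega>0*(s-1)*c"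
    "\<omega>s*c = - s*(s-1)*d - \<omega>1 * s*c - \<omega>0*(s-1)*b"
    using roots unfolding a b c d by algebra+
  show "\<omega>s*d = - s*(s-1)*c + \<omega>1 * s*d + \<omega>0*(s-1)*a"
    unfolding a b c d by algebra
qed

text \<open>If \<open>K\<close> is the matrix taking \<open>w\<close> to \<open>u\<close>, then
  \<open>y\<close> is the transpose of \<open>K\<close> applied to \<open>\<xi>\<close>. The
  matrices \<open>P\<close> of \<open>Xr\<close>, \<open>Xs\<close>, \<open>Xt\<close> are
  anticommuting units with squares \<open>1\<close>, \<open>1\<close>, \<open>-1\<close>, and
  \<open>K\<close> is a quaternion in them. Passing from \<open>P K\<close> to \<open>K P\<close>
  conjugates the units, a rotation that preserves the form with signs \<open>+ + -\<close>. This
  invariance stands in for a third relation at \<open>t\<close>.\<close>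

lemma rotate:
  fixes \<xi>0 \<xi>1 \<xi>2 \<xi>3 u0 u1 u2 u3 y0 y1 y2 y3 w0 w1 w2 w3 :: complex
  assumes u: "u0 = a*w0 + b*w1 + c*w2 + d*w3" "u1 = a*w1 - b*w0 + d*w2 - c*w3"
      "u2 = c*w0 + d*w1 + a*w2 + b*w3" "u3 = d*w0 - c*w1 - b*w2 + a*w3"
    and y: "y0 = a*\<xi>0 - b*\<xi>1 + c*\<xi>2 + d*\<xi>3" "y1 = b*\<xi>0 + a*\<xi>1 + d*\<xi>2 - c*\<xi>3"
      "y2 = c*\<xi>0 + d*\<xi>1 + a*\<xi>2 - b*\<xi>3" "y3 = d*\<xi>0 - c*\<xi>1 + b*\<xi>2 + a*\<xi>3"
  defines "Xr \<equiv> \<xi>0*u3 + \<xi>1*u2 + \<xi>2*u1 + \<xi>3*u0"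
    and "Xs \<equiv> - (\<xi>0*u2 - \<xi>1*u3 + \<xi>2*u0 - \<xi>3*u1)"
    and "Xt \<equiv> - (\<xi>0*u1 - \<xi>1*u0 + \<xi>2*u3 - \<xi>3*u2)"
    and "E1 \<equiv> y0*w3 + y1*w2 + y2*w1 + y3*w0"
    and "E2 \<equiv> - (y0*w2 - y1*w3 + y2*w0 - y3*w1)"
    and "E3 \<equiv> - (y0*w1 - y1*w0 + y2*w3 - y3*w2)"
  shows "r*(r-1)*(r-s)*(r-t)*Xr^2 = (r*(r-1)*E1 - \<omega>1*r*E2 + \<omega>0*(r-1)*E3)^2"
    and "s*(s-1)*(s-r)*(s-t)*Xs^2 = (s*(s-1)*E1 - \<omega>1 * s*E2 + \<omega>0*(s-1)*E3)^2"
    and "Xr^2 + Xs^2 - Xt^2 = E1^2 + E2^2 - E3^2"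
proof -
  have "\<omega>r*Xr = - (r*(r-1)*E1 - \<omega>1*r*E2 + \<omega>0*(r-1)*E3)"
    using intertwining_r unfolding Xr_def E1_def E2_def E3_def u y by algebra
  then show "r*(r-1)*(r-s)*(r-t)*Xr^2 = (r*(r-1)*E1 - \<omega>1*r*E2 + \<omega>0*(r-1)*E3)^2"
    using roots(3) by algebra
  have "\<omega>s*Xs = s*(s-1)*E1 - \<omega>1 * s*E2 + \<omega>0*(s-1)*E3"
    using intertwining_s unfolding Xs_def E1_def E2_def E3_def u y by algebra
  then show "s*(s-1)*(s-r)*(s-t)*Xs^2 = (s*(s-1)*E1 - \<omega>1 * s*E2 + \<omega>0*(s-1)*E3)^2"
    using roots(4) by algebra
  show "Xr^2 + Xs^2 - Xt^2 = E1^2 + E2^2 - E3^2"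
    unfolding Xr_def Xs_def Xt_def E1_def E2_def E3_def u y by algebra
qed

text \<open>Put \<open>q(x) = x*(x-1)*E1 - \<omega>1*x*E2 + \<omega>0*(x-1)*E3\<close>. The
  assumptions say that \<open>Xr^2 = q(r)^2/F'(r)\<close>, \<open>Xs^2 = q(s)^2/F'(s)\<close> and,
  by the residue theorem for \<open>q^2/F\<close>, \<open>-Xt^2 = q(t)^2/F'(t)\<close>. The left
  sides are the sums over \<open>e = r, s, t\<close> of \<open>q(e)^2/F'(e)\<close> times
  \<open>-r*s*t/e\<close>, \<open>e\<close> and \<open>-(r-1)*(s-1)*(t-1)/(e-1)\<close>; the right
  sides collect the residues at \<open>0\<close>, \<open>1\<close> and infinity.\<close>

lemma weighted_squares:
  assumes "r*(r-1)*(r-s)*(r-t)*Xr^2 = (r*(r-1)*E1 - \<omega>1*r*E2 + \<omega>0*(r-1)*E3)^2"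
    and "s*(s-1)*(s-r)*(s-t)*Xs^2 = (s*(s-1)*E1 - \<omega>1 * s*E2 + \<omega>0*(s-1)*E3)^2"
    and "Xr^2 + Xs^2 - Xt^2 = E1^2 + E2^2 - E3^2"
  shows "r * s*Xt^2 - s*t*Xr^2 - r*t*Xs^2
      = (r * s+s*t+r*t - r * s*t)*E3^2 - r * s*t*E2^2 + 2*\<omega>0*E1*E3 + 2*\<omega>0*\<omega>1*E2*E3"
    and "r*Xr^2 + s*Xs^2 - t*Xt^2 = (r+s+t-1)*E1^2 + E2^2 - 2*\<omega>1*E1*E2 + 2*\<omega>0*E1*E3"
    and "(r-1)*(s-1)*Xt^2 - (s-1)*(t-1)*Xr^2 - (r-1)*(t-1)*Xs^2
      = (r+s+t-2-r * s*t)*E2^2 - (r-1)*(s-1)*(t-1)*E3^2 + 2*\<omega>1*E1*E2 + 2*\<omega>0*\<omega>1*E2*E3"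
proof -
  \<comment> \<open>A common multiple of \<open>F'(r)\<close> and \<open>F'(s)\<close>, so that the
    residue computation becomes a polynomial identity.\<close>
  define D where "D = r*(r-1)*(r-s)*(r-t) * s*(s-1)*(s-t)"
  have D: "D \<noteq> 0" using distinct by (auto simp: D_def)
  have t: "Xt^2 = Xr^2 + Xs^2 - E1^2 - E2^2 + E3^2" using assms(3) by algebra
  have Dr: "D*Xr^2 = s*(s-1)*(s-t)*(r*(r-1)*E1 - \<omega>1*r*E2 + \<omega>0*(r-1)*E3)^2"
    unfolding D_def assms(1)[symmetric] by algebra
  have Ds: "D*Xs^2 = - r*(r-1)*(r-t)*(s*(s-1)*E1 - \<omega>1 * s*E2 + \<omega>0*(s-1)*E3)^2"
    unfolding D_def assms(2)[symmetric] by algebra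
  have "D*(r * s*Xt^2 - s*t*Xr^2 - r*t*Xs^2) = (r * s-s*t)*(D*Xr^2) + (r * s-r*t)*(D*Xs^2) + D*r * s*(E3^2 - E1^2 - E2^2)"
    unfolding t by algebra
  also have "\<dots> = D*((r * s+s*t+r*t - r * s*t)*E3^2 - r * s*t*E2^2 + 2*\<omega>0*E1*E3 + 2*\<omega>0*\<omega>1*E2*E3)"
    unfolding Dr Ds unfolding D_def using roots(1,2) by algebra
  finally show "r * s*Xt^2 - s*t*Xr^2 - r*t*Xs^2 = (r * s+s*t+r*t - r * s*t)*E3^2 - r * s*t*E2^2 + 2*\<omega>0*E1*E3 + 2*\<omega>0*\<omega>1*E2*E3"
    using D by (simp only: mult_cancel_left) simp
  have "D*(r*Xr^2 + s*Xs^2 - t*Xt^2) = (r-t)*(D*Xr^2) + (s-t)*(D*Xs^2) + D*(-t)*(E3^2 - E1^2 - E2^2)"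
    unfolding t by algebra
  also have "\<dots> = D*((r+s+t-1)*E1^2 + E2^2 - 2*\<omega>1*E1*E2 + 2*\<omega>0*E1*E3)"
    unfolding Dr Ds unfolding D_def using roots(1,2) by algebra
  finally show "r*Xr^2 + s*Xs^2 - t*Xt^2 = (r+s+t-1)*E1^2 + E2^2 - 2*\<omega>1*E1*E2 + 2*\<omega>0*E1*E3"
    using D by (simp only: mult_cancel_left) simp
  have "D*((r-1)*(s-1)*Xt^2 - (s-1)*(t-1)*Xr^2 - (r-1)*(t-1)*Xs^2) = ((s-1)*(r-t))*(D*Xr^2) + ((r-1)*(s-t))*(D*Xs^2) + D*((r-1)*(s-1))*(E3^2 - E1^2 - E2^2)"
    unfolding t by algebra
  also have "\<dots> = D*((r+s+t-2-r * s*t)*E2^2 - (r-1)*(s-1)*(t-1)*E3^2 + 2*\<omega>1*E1*E2 + 2*\<omega>0*\<omega>1*E2*E3)"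
    unfolding Dr Ds unfolding D_def using roots(1,2) by algebra
  finally show "(r-1)*(s-1)*Xt^2 - (s-1)*(t-1)*Xr^2 - (r-1)*(t-1)*Xs^2 = (r+s+t-2-r * s*t)*E2^2 - (r-1)*(s-1)*(t-1)*E3^2 + 2*\<omega>1*E1*E2 + 2*\<omega>0*\<omega>1*E2*E3"
    using D by (simp only: mult_cancel_left) simp
qed

end

section \<open>Comparison of the Hamiltonians with the numerator of
  \<open>det \<theta>\<close>\<close>

locale cotangent_chart = root_choice +
  fixes R S T \<xi>0 \<xi>1 \<xi>2 \<xi>3 p q1 q2 q3 u0 u1 u2 u3 cr cs ct y0 y1 y2 y3 \<nu>0 \<nu>1 \<nu>2 \<nu>3 :: complex
  assumes p: "p = (s-t)*R + (t-r)*S + (r-s)*T"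
    and q1: "q1 = (s-t)*(r-1)*(R+S*T) + (t-r)*(s-1)*(S+R*T) + (r-s)*(t-1)*(T+R*S)"
    and q2: "q2 = r*(s-t)*S*T + s*(t-r)*R*T + t*(r-s)*R*S"
    and q3: "q3 = (s-t)*(r-1)*(s*t*R+r*S*T) + (t-r)*(s-1)*(r*t*S+s*R*T) + (r-s)*(t-1)*(r * s*T+t*R*S)"
    and u: "u0 = \<omega>0*\<omega>1*(a*(\<omega>0*\<omega>1*p) + b*(\<omega>0*q1) + c*(\<omega>1*q2) + d*q3)"
      "u1 = \<omega>0*\<omega>1*(a*(\<omega>0*q1) - b*(\<omega>0*\<omega>1*p) + d*(\<omega>1*q2) - c*q3)"
      "u2 = \<omega>0*\<omega>1*(c*(\<omega>0*\<omega>1*p) + d*(\<omega>0*q1) + a*(\<omega>1*q2) + b*q3)"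
      "u3 = \<omega>0*\<omega>1*(d*(\<omega>0*\<omega>1*p) - c*(\<omega>0*q1) - b*(\<omega>1*q2) + a*q3)"
    and tangent: "\<xi>0*u0 + \<xi>1*u1 + \<xi>2*u2 + \<xi>3*u3 = 0"
    and y: "y0 = a*\<xi>0 - b*\<xi>1 + c*\<xi>2 + d*\<xi>3" "y1 = b*\<xi>0 + a*\<xi>1 + d*\<xi>2 - c*\<xi>3"
      "y2 = c*\<xi>0 + d*\<xi>1 + a*\<xi>2 - b*\<xi>3" "y3 = d*\<xi>0 - c*\<xi>1 + b*\<xi>2 + a*\<xi>3"
    and \<nu>: "\<nu>0 = (\<omega>0*\<omega>1)^2*y0" "\<nu>1 = \<omega>0^2*\<omega>1*y1" "\<nu>2 = \<omega>0*\<omega>1^2*y2" "\<nu>3 = \<omega>0*\<omega>1*y3"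
    and cr: "cr = \<nu>0*(s-t) + \<nu>1*((s-t)*(r-1) + (t-r)*(s-1)*T + (r-s)*(t-1)*S)
                  + \<nu>2*(s*(t-r)*T + t*(r-s)*S)
                  + \<nu>3*((s-t)*(r-1) * s*t + (t-r)*(s-1) * s*T + (r-s)*(t-1)*t*S)"
    and cs: "cs = \<nu>0*(t-r) + \<nu>1*((s-t)*(r-1)*T + (t-r)*(s-1) + (r-s)*(t-1)*R)
                  + \<nu>2*(r*(s-t)*T + t*(r-s)*R)
                  + \<nu>3*((s-t)*(r-1)*r*T + (t-r)*(s-1)*r*t + (r-s)*(t-1)*t*R)"
    and ct: "ct = \<nu>0*(r-s) + \<nu>1*((s-t)*(r-1)*S + (t-r)*(s-1)*R + (r-s)*(t-1))
                  + \<nu>2*(r*(s-t)*S + s*(t-r)*R)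
                  + \<nu>3*((s-t)*(r-1)*r*S + (t-r)*(s-1) * s*R + (r-s)*(t-1)*r * s)"
begin

text \<open>The rescaled coordinates on which the quaternion matrix acts to give \<open>u\<close>.
  The factors are dual to those between \<open>y\<close> and \<open>\<nu>\<close>: the pairing of
  \<open>y\<close> with \<open>w\<close> equals that of \<open>\<nu>\<close> with
  \<open>(p, q1, q2, q3)\<close>, so one Euler relation serves both.\<close>

definition "w0 = \<omega>0^2*\<omega>1^2*p"
definition "w1 = \<omega>0^2*\<omega>1*q1"
definition "w2 = \<omega>0*\<omega>1^2*q2"
definition "w3 = \<omega>0*\<omega>1*q3"
lemmas w_defs = w0_def w1_def w2_def w3_def

lemma u_w: "u0 = a*w0 + b*w1 + c*w2 + d*w3" "u1 = a*w1 - b*w0 + d*w2 - c*w3"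
      "u2 = c*w0 + d*w1 + a*w2 + b*w3" "u3 = d*w0 - c*w1 - b*w2 + a*w3"
  unfolding w_defs u by algebra+

lemma tangent_w: "y0*w0 + y1*w1 + y2*w2 + y3*w3 = 0"
  using tangent unfolding u_w y by algebra

sublocale parabolic_chart r s t R S T \<nu>0 \<nu>1 \<nu>2 \<nu>3 p q1 q2 q3 cr cs ct
proof
  show "\<nu>0*p + \<nu>1*q1 + \<nu>2*q2 + \<nu>3*q3 = 0"
    using tangent_w unfolding \<nu> w_defs by algebra
qed (fact p q1 q2 q3 cr cs ct)+

text \<open>The matrix of this form commutes with all quaternion matrices; it is the square that the
  rotation fixes, shared by the values at \<open>0\<close> and at \<open>1\<close>.\<close>

lemma r01: "\<xi>1*u2 + \<xi>2*u1 - \<xi>0*u3 - \<xi>3*u0 = y1*w2 + y2*w1 - y0*w3 - y3*w0"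
  unfolding u_w y by algebra

text \<open>
  In the next three lemmas, lemma \<open>rotate\<close> is applied to the image of \<open>\<xi>\<close> under one of the three signed permutation
  matrices that commute with all quaternion matrices; \<open>y'\<close> is the same image of \<open>y\<close>.
\<close>

lemma quadric_value_at_0:
  "r * s*t*(\<xi>1*u2 + \<xi>2*u1 - \<xi>0*u3 - \<xi>3*u0)^2 - s*t*(\<xi>0*u2 - \<xi>1*u3 - \<xi>2*u0 + \<xi>3*u1)^2
    + r * s*(\<xi>0*u0 + \<xi>1*u1 - \<xi>2*u2 - \<xi>3*u3)^2 - r*t*(\<xi>0*u3 + \<xi>1*u2 - \<xi>2*u1 - \<xi>3*u0)^2
   = 4*((cr*(1-R) + cs*(1-S) + ct*(1-T))
      * (s*t*cr*R^2 + r*t*cs*S^2 + r * s*ct*T^2 - r * s*t*(cr*R + cs*S + ct*T)))"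
  (is "?Q = 4*?A")
proof -
  define m n where "m = r * s*t" and "n = (r-1)*(s-1)*(t-1)"
  have n: "n \<noteq> 0" using distinct by (auto simp: n_def)
  have sq: "\<omega>0^2 = m" "\<omega>1^2 = n" using roots by (simp_all add: m_def n_def)
  define E1 E2 E3 where "E1 = y0*w2 - y1*w3 - y2*w0 + y3*w1"
    and "E2 = y0*w3 + y1*w2 - y2*w1 - y3*w0" and "E3 = y0*w0 + y1*w1 - y2*w2 - y3*w3"
  have y': "- y1 = a*(-\<xi>1) - b*\<xi>0 + c*\<xi>3 + d*(-\<xi>2)" "y0 = b*(-\<xi>1) + a*\<xi>0 + d*\<xi>3 - c*(-\<xi>2)"
    "y3 = c*(-\<xi>1) + d*\<xi>0 + a*\<xi>3 - b*(-\<xi>2)" "- y2 = d*(-\<xi>1) - c*\<xi>0 + b*\<xi>3 + a*(-\<xi>2)"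
    unfolding y by algebra+
  note rot = weighted_squares(1)[OF rotate[OF u_w y']]
  have Q: "?Q = m*(y1*w2 + y2*w1 - y0*w3 - y3*w0)^2
      + (r * s+s*t+r*t - m)*E3^2 - m*E2^2 + 2*\<omega>0*E1*E3 + 2*\<omega>0*\<omega>1*E2*E3"
    using rot unfolding r01 E1_def E2_def E3_def m_def by algebra
  have 1: "\<omega>0*E1 = \<nu>0*q2 - \<nu>1*q3 - m*(\<nu>2*p - \<nu>3*q1)"
    unfolding E1_def w_defs \<nu> sq[symmetric] by algebra
  have 2: "\<omega>0*\<omega>1*E2 = \<nu>0*q3 + n*\<nu>1*q2 - m*\<nu>2*q1 - m*n*\<nu>3*p"
    unfolding E2_def w_defs \<nu> sq[symmetric] by algebra
  have 3: "E3 = \<nu>0*p + \<nu>1*q1 - \<nu>2*q2 - \<nu>3*q3"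
    unfolding E3_def w_defs \<nu> by algebra
  have 4: "\<omega>0*\<omega>1*(y1*w2 + y2*w1 - y0*w3 - y3*w0) = n*\<nu>1*q2 + m*\<nu>2*q1 - \<nu>0*q3 - m*n*\<nu>3*p"
    unfolding w_defs \<nu> sq[symmetric] by algebra
  note A = value_at_0[folded m_def n_def]
  \<comment> \<open>The factor \<open>n = \<omega>1^2\<close> completes the roots: the squares with
    weight \<open>m = \<omega>0^2\<close> become squares of \<open>\<omega>0*\<omega>1\<close> times
    a form, and facts 1 to 4 express all such products without roots.\<close>
  have "n*?Q = (\<omega>0*\<omega>1*(y1*w2 + y2*w1 - y0*w3 - y3*w0))^2 - (\<omega>0*\<omega>1*E2)^2
      + n*((r * s+s*t+r*t - m)*E3^2 + 2*(\<omega>0*E1)*E3 + 2*(\<omega>0*\<omega>1*E2)*E3)"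
    unfolding Q sq[symmetric] by algebra
  \<comment> \<open>The first two squares factor as a difference of squares, and the Euler relation
    gives \<open>E3 = 2*(\<nu>0*p + \<nu>1*q1) = -2*(\<nu>2*q2 + \<nu>3*q3)\<close>. This is the
    origin of the factor \<open>4\<close>.\<close>
  also have "\<dots> = n*(4*?A)"
    unfolding 1 2 3 4 m_def[symmetric] A using tangent by algebra
  finally show ?thesis using n by (simp only: mult_cancel_left) simp
qed

lemma quadric_leading_value:
  "r*(\<xi>0*u0 - \<xi>1*u1 - \<xi>2*u2 + \<xi>3*u3)^2 - (\<xi>0*u1 - \<xi>1*u0 - \<xi>2*u3 + \<xi>3*u2)^2
    + s*(\<xi>0*u1 + \<xi>1*u0 - \<xi>2*u3 - \<xi>3*u2)^2 - t*(\<xi>0*u2 + \<xi>1*u3 - \<xi>2*u0 - \<xi>3*u1)^2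
   = 4*((cr*(R-r) + cs*(S-s) + ct*(T-t))*(cr*R*(1-R) + cs*S*(1-S) + ct*T*(1-T)))"
  (is "?Q = 4*?A")
proof -
  define m n where "m = r * s*t" and "n = (r-1)*(s-1)*(t-1)"
  have n: "n \<noteq> 0" using distinct by (auto simp: n_def)
  have sq: "\<omega>0^2 = m" "\<omega>1^2 = n" using roots by (simp_all add: m_def n_def)
  define E1 E2 E3 where "E1 = y0*w0 - y1*w1 - y2*w2 + y3*w3"
    and "E2 = y0*w1 + y1*w0 - y2*w3 - y3*w2" and "E3 = y0*w2 + y1*w3 - y2*w0 - y3*w1"
  have y': "y3 = a*\<xi>3 - b*(-\<xi>2) + c*(-\<xi>1) + d*\<xi>0" "- y2 = b*\<xi>3 + a*(-\<xi>2) + d*(-\<xi>1) - c*\<xi>0"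
    "- y1 = c*\<xi>3 + d*(-\<xi>2) + a*(-\<xi>1) - b*\<xi>0" "y0 = d*\<xi>3 - c*(-\<xi>2) + b*(-\<xi>1) + a*\<xi>0"
    unfolding y by algebra+
  note rot = weighted_squares(2)[OF rotate[OF u_w y']]
  have r: "\<xi>0*u1 - \<xi>1*u0 - \<xi>2*u3 + \<xi>3*u2 = y0*w1 - y1*w0 - y2*w3 + y3*w2"
    unfolding u_w y by algebra
  have Q: "?Q = (r+s+t-1)*E1^2 + E2^2 - 2*\<omega>1*E1*E2 + 2*\<omega>0*E1*E3
      - (y0*w1 - y1*w0 - y2*w3 + y3*w2)^2"
    using rot unfolding r E1_def E2_def E3_def m_def by algebra
  have 1: "E1 = \<nu>0*p - \<nu>1*q1 - \<nu>2*q2 + \<nu>3*q3"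
    unfolding E1_def w_defs \<nu> by algebra
  have 2: "\<omega>1*E2 = \<nu>0*q1 + n*\<nu>1*p - \<nu>2*q3 - n*\<nu>3*q2"
    unfolding E2_def w_defs \<nu> sq[symmetric] by algebra
  have 3: "\<omega>0*E3 = \<nu>0*q2 + \<nu>1*q3 - m*\<nu>2*p - m*\<nu>3*q1"
    unfolding E3_def w_defs \<nu> sq[symmetric] by algebra
  have 4: "\<omega>1*(y0*w1 - y1*w0 - y2*w3 + y3*w2) = \<nu>0*q1 - n*\<nu>1*p - \<nu>2*q3 + n*\<nu>3*q2"
    unfolding w_defs \<nu> sq[symmetric] by algebra
  note A = leading_value[folded m_def n_def]
  have "n*?Q = (\<omega>1*E2)^2 - (\<omega>1*(y0*w1 - y1*w0 - y2*w3 + y3*w2))^2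
      + n*((r+s+t-1)*E1^2 - 2*E1*(\<omega>1*E2) + 2*E1*(\<omega>0*E3))"
    unfolding Q sq[symmetric] by algebra
  \<comment> \<open>Now it is \<open>E1\<close> that the Euler relation doubles:
    \<open>E1 = 2*(\<nu>0*p + \<nu>3*q3) = -2*(\<nu>1*q1 + \<nu>2*q2)\<close>.\<close>
  also have "\<dots> = n*(4*?A)"
    unfolding 1 2 3 4 m_def[symmetric] A using tangent by algebra
  finally show ?thesis using n by (simp only: mult_cancel_left) simp
qed

lemma quadric_value_at_1:
  "(r-1)*(s-1)*(t-1)*(\<xi>1*u2 + \<xi>2*u1 - \<xi>0*u3 - \<xi>3*u0)^2
    - (s-1)*(t-1)*(\<xi>0*u1 + \<xi>1*u0 + \<xi>2*u3 + \<xi>3*u2)^2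
    - (r-1)*(t-1)*(\<xi>0*u0 - \<xi>1*u1 + \<xi>2*u2 - \<xi>3*u3)^2
    + (r-1)*(s-1)*(\<xi>0*u3 - \<xi>1*u2 + \<xi>2*u1 - \<xi>3*u0)^2
   = 4*(- (cr*R + cs*S + ct*T) * ((r-1)*(s-1)*(t-1)*(cr*(1-R) + cs*(1-S) + ct*(1-T))
        + cr*(1-R)^2*(s-1)*(t-1) + cs*(1-S)^2*(r-1)*(t-1) + ct*(1-T)^2*(r-1)*(s-1)))"
  (is "?Q = 4*?A")
proof -
  define m n where "m = r * s*t" and "n = (r-1)*(s-1)*(t-1)"
  have m: "m \<noteq> 0" using distinct by (auto simp: m_def)
  have sq: "\<omega>0^2 = m" "\<omega>1^2 = n" using roots by (simp_all add: m_def n_def)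
  define E1 E2 E3 where "E1 = y0*w1 + y1*w0 + y2*w3 + y3*w2"
    and "E2 = - (y0*w0 - y1*w1 + y2*w2 - y3*w3)" and "E3 = - (y0*w3 - y1*w2 + y2*w1 - y3*w0)"
  have y': "y2 = a*\<xi>2 - b*\<xi>3 + c*\<xi>0 + d*\<xi>1" "y3 = b*\<xi>2 + a*\<xi>3 + d*\<xi>0 - c*\<xi>1"
    "y0 = c*\<xi>2 + d*\<xi>3 + a*\<xi>0 - b*\<xi>1" "y1 = d*\<xi>2 - c*\<xi>3 + b*\<xi>0 + a*\<xi>1"
    unfolding y by algebra+
  note rot = weighted_squares(3)[OF rotate[OF u_w y']]
  have Q: "?Q = n*(y1*w2 + y2*w1 - y0*w3 - y3*w0)^2
      + (r+s+t-2-m)*E2^2 - n*E3^2 + 2*\<omega>1*E1*E2 + 2*\<omega>0*\<omega>1*E2*E3"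
    using rot unfolding r01 E1_def E2_def E3_def m_def n_def by algebra
  have 1: "\<omega>1*E1 = \<nu>0*q1 + n*\<nu>1*p + \<nu>2*q3 + n*\<nu>3*q2"
    unfolding E1_def w_defs \<nu> sq[symmetric] by algebra
  have 2: "E2 = - (\<nu>0*p - \<nu>1*q1 + \<nu>2*q2 - \<nu>3*q3)"
    unfolding E2_def w_defs \<nu> by algebra
  have 3: "\<omega>0*\<omega>1*E3 = - (\<nu>0*q3 - n*\<nu>1*q2 + m*\<nu>2*q1 - m*n*\<nu>3*p)"
    unfolding E3_def w_defs \<nu> sq[symmetric] by algebra
  have 4: "\<omega>0*\<omega>1*(y1*w2 + y2*w1 - y0*w3 - y3*w0) = n*\<nu>1*q2 + m*\<nu>2*q1 - \<nu>0*q3 - m*n*\<nu>3*p"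
    unfolding w_defs \<nu> sq[symmetric] by algebra
  note A = value_at_1[folded m_def n_def]
  \<comment> \<open>Here the fixed square and \<open>E3^2\<close> already carry the weight
    \<open>n = \<omega>1^2\<close>, so the missing factor is \<open>m = \<omega>0^2\<close>.\<close>
  have "m*?Q = (\<omega>0*\<omega>1*(y1*w2 + y2*w1 - y0*w3 - y3*w0))^2 - (\<omega>0*\<omega>1*E3)^2
      + m*((r+s+t-2-m)*E2^2 + 2*(\<omega>1*E1)*E2 + 2*E2*(\<omega>0*\<omega>1*E3))"
    unfolding Q sq[symmetric] by algebra
  also have "\<dots> = m*(4*?A)"
    unfolding 1 2 3 4 n_def[symmetric] A using tangent by algebra
  finally show ?thesis using m by (simp only: mult_cancel_left) simp
qed

end

text \<open>Since \<open>d(u0/u3) = du0/u3 - u0*du3/u3^2\<close>, the affine covector lifts to the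
  covector \<open>\<xi>\<close> on the homogeneous coordinates that has first entries
  \<open>\<eta>/u3\<close> and vanishes on \<open>u\<close>. In terms of \<open>\<xi>\<close> every
  bracket of the Hitchin formulas is a power of \<open>u3\<close> times a generator, which turns the
  unsymmetric affine expressions into the quadrics compared above.\<close>

lemma homogeneous_forms:
  fixes r s t u0 u1 u2 u3 \<xi>0 \<xi>1 \<xi>2 \<xi>3 \<eta>0 \<eta>1 \<eta>2 :: complex
  assumes \<eta>: "\<eta>0 = \<xi>0*u3" "\<eta>1 = \<xi>1*u3" "\<eta>2 = \<xi>2*u3"
    and tangent: "\<xi>0*u0 + \<xi>1*u1 + \<xi>2*u2 + \<xi>3*u3 = 0"
  defines "Q0 \<equiv> r * s*t*(\<xi>1*u2 + \<xi>2*u1 - \<xi>0*u3 - \<xi>3*u0)^2 - s*t*(\<xi>0*u2 - \<xi>1*u3 - \<xi>2*u0 + \<xi>3*u1)^2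
      + r * s*(\<xi>0*u0 + \<xi>1*u1 - \<xi>2*u2 - \<xi>3*u3)^2 - r*t*(\<xi>0*u3 + \<xi>1*u2 - \<xi>2*u1 - \<xi>3*u0)^2"
    and "Q1 \<equiv> (r-1)*(s-1)*(t-1)*(\<xi>1*u2 + \<xi>2*u1 - \<xi>0*u3 - \<xi>3*u0)^2
      - (s-1)*(t-1)*(\<xi>0*u1 + \<xi>1*u0 + \<xi>2*u3 + \<xi>3*u2)^2
      - (r-1)*(t-1)*(\<xi>0*u0 - \<xi>1*u1 + \<xi>2*u2 - \<xi>3*u3)^2
      + (r-1)*(s-1)*(\<xi>0*u3 - \<xi>1*u2 + \<xi>2*u1 - \<xi>3*u0)^2"
    and "Q2 \<equiv> r*(\<xi>0*u0 - \<xi>1*u1 - \<xi>2*u2 + \<xi>3*u3)^2 - (\<xi>0*u1 - \<xi>1*u0 - \<xi>2*u3 + \<xi>3*u2)^2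
      + s*(\<xi>0*u1 + \<xi>1*u0 - \<xi>2*u3 - \<xi>3*u2)^2 - t*(\<xi>0*u2 + \<xi>1*u3 - \<xi>2*u0 - \<xi>3*u1)^2"
  shows "r * s * t * (\<eta>0*(u0^2 - u3^2) + \<eta>1*(u0*u1 + u2*u3) + \<eta>2*(u0*u2 + u1*u3))^2
          - s*t * (\<eta>0*(u0*u1 - u2*u3) + \<eta>1*(u1^2 + u3^2) + \<eta>2*(u0*u3 + u1*u2))^2
          + 4 * r * s * (\<eta>0*u0 + \<eta>1*u1)^2 * u3^2
          - r*t * (\<eta>0*(u0^2 + u3^2) + \<eta>1*(u0*u1 + u2*u3) + \<eta>2*(u0*u2 - u1*u3))^2 = u3^4 * Q0"
    and "t * (u0^2 + u1^2 + u2^2 + u3^2)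
              * ((\<eta>0^2 + \<eta>1^2 + \<eta>2^2) * u3^2 + (\<eta>0*u0 + \<eta>1*u1 + \<eta>2*u2)^2)
          + s*t * (u0^2 - u1^2 + u2^2 - u3^2)
              * ((\<eta>0^2 - \<eta>1^2 + \<eta>2^2) * u3^2 - (\<eta>0*u0 + \<eta>1*u1 + \<eta>2*u2)^2)
          + 4*r * (u0*u2 - u1*u3) * u3 * (\<eta>0*\<eta>2*u3 + (\<eta>0*u0 + \<eta>1*u1 + \<eta>2*u2) * \<eta>1)
          + 4 * r * s * (u0*u2 + u1*u3) * u3 * (\<eta>0*\<eta>2*u3 - (\<eta>0*u0 + \<eta>1*u1 + \<eta>2*u2) * \<eta>1)
          + 4 * s * (u0*u3 + u1*u2) * u3 * (\<eta>1*\<eta>2*u3 - (\<eta>0*u0 + \<eta>1*u1 + \<eta>2*u2) * \<eta>0)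
          + 4*r*t * (u0*u1 + u2*u3) * u3 * (\<eta>0*\<eta>1*u3 - (\<eta>0*u0 + \<eta>1*u1 + \<eta>2*u2) * \<eta>2)
        = u3^4 * (Q1 - Q0 - Q2)"
    and "s * (\<eta>0*(u0*u2 + u1*u3) + \<eta>1*(u0*u3 + u1*u2) + \<eta>2*(u2^2 - u3^2))^2
          - (\<eta>0*(u0*u2 - u1*u3) + \<eta>1*(u0*u3 + u1*u2) + \<eta>2*(u2^2 + u3^2))^2
          - t * (\<eta>0*(u0*u1 + u2*u3) + \<eta>1*(u1^2 + u3^2) - \<eta>2*(u0*u3 - u1*u2))^2
          + 4*r * (\<eta>1*u1 + \<eta>2*u2)^2 * u3^2 = u3^4 * Q2"
proof -
  have dot: "\<eta>0*u0 + \<eta>1*u1 + \<eta>2*u2 = - (\<xi>3*u3^2)"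
    using tangent unfolding \<eta> by algebra
  have brackets:
    \<comment> \<open>The Euler relation eliminates \<open>\<xi>3\<close>. Two of the eight forms
      are only half a generator, which matches the coefficient \<open>4\<close> of their squares in
      the formulas.\<close>
    "\<eta>0*(u0^2 - u3^2) + \<eta>1*(u0*u1 + u2*u3) + \<eta>2*(u0*u2 + u1*u3) = u3^2 * (\<xi>1*u2 + \<xi>2*u1 - \<xi>0*u3 - \<xi>3*u0)"
    "\<eta>0*(u0*u1 - u2*u3) + \<eta>1*(u1^2 + u3^2) + \<eta>2*(u0*u3 + u1*u2) = - (u3^2 * (\<xi>0*u2 - \<xi>1*u3 - \<xi>2*u0 + \<xi>3*u1))"
    "2 * (\<eta>0*u0 + \<eta>1*u1) = u3 * (\<xi>0*u0 + \<xi>1*u1 - \<xi>2*u2 - \<xi>3*u3)"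
    "\<eta>0*(u0^2 + u3^2) + \<eta>1*(u0*u1 + u2*u3) + \<eta>2*(u0*u2 - u1*u3) = u3^2 * (\<xi>0*u3 + \<xi>1*u2 - \<xi>2*u1 - \<xi>3*u0)"
    "\<eta>0*(u0*u2 + u1*u3) + \<eta>1*(u0*u3 + u1*u2) + \<eta>2*(u2^2 - u3^2) = u3^2 * (\<xi>0*u1 + \<xi>1*u0 - \<xi>2*u3 - \<xi>3*u2)"
    "\<eta>0*(u0*u2 - u1*u3) + \<eta>1*(u0*u3 + u1*u2) + \<eta>2*(u2^2 + u3^2) = - (u3^2 * (\<xi>0*u1 - \<xi>1*u0 - \<xi>2*u3 + \<xi>3*u2))"
    "\<eta>0*(u0*u1 + u2*u3) + \<eta>1*(u1^2 + u3^2) - \<eta>2*(u0*u3 - u1*u2) = u3^2 * (\<xi>0*u2 + \<xi>1*u3 - \<xi>2*u0 - \<xi>3*u1)"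
    "2 * (\<eta>1*u1 + \<eta>2*u2) = - u3 * (\<xi>0*u0 - \<xi>1*u1 - \<xi>2*u2 + \<xi>3*u3)"
    using tangent unfolding \<eta> by algebra+
  show "r * s * t * (\<eta>0*(u0^2 - u3^2) + \<eta>1*(u0*u1 + u2*u3) + \<eta>2*(u0*u2 + u1*u3))^2
          - s*t * (\<eta>0*(u0*u1 - u2*u3) + \<eta>1*(u1^2 + u3^2) + \<eta>2*(u0*u3 + u1*u2))^2
          + 4 * r * s * (\<eta>0*u0 + \<eta>1*u1)^2 * u3^2
          - r*t * (\<eta>0*(u0^2 + u3^2) + \<eta>1*(u0*u1 + u2*u3) + \<eta>2*(u0*u2 - u1*u3))^2 = u3^4 * Q0"
    unfolding brackets(1,2,4) Q0_def using brackets(3) by algebra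
  show "s * (\<eta>0*(u0*u2 + u1*u3) + \<eta>1*(u0*u3 + u1*u2) + \<eta>2*(u2^2 - u3^2))^2
          - (\<eta>0*(u0*u2 - u1*u3) + \<eta>1*(u0*u3 + u1*u2) + \<eta>2*(u2^2 + u3^2))^2
          - t * (\<eta>0*(u0*u1 + u2*u3) + \<eta>1*(u1^2 + u3^2) - \<eta>2*(u0*u3 - u1*u2))^2
          + 4*r * (\<eta>1*u1 + \<eta>2*u2)^2 * u3^2 = u3^4 * Q2"
    unfolding brackets(5-7) Q2_def using brackets(8) by algebra
  \<comment> \<open>The linear coefficient of the quadratic with value \<open>Q0\<close> at
    \<open>0\<close>, value \<open>Q1\<close> at \<open>1\<close> and leading coefficient
    \<open>Q2\<close>.\<close>
  have "Q1 - Q0 - Q2 = t * (u0^2 + u1^2 + u2^2 + u3^2) * (\<xi>0^2 + \<xi>1^2 + \<xi>2^2 + \<xi>3^2)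
      + s*t * (u0^2 - u1^2 + u2^2 - u3^2) * (\<xi>0^2 - \<xi>1^2 + \<xi>2^2 - \<xi>3^2)
      + 4*r * (u0*u2 - u1*u3) * (\<xi>0*\<xi>2 - \<xi>3*\<xi>1) + 4*r * s * (u0*u2 + u1*u3) * (\<xi>0*\<xi>2 + \<xi>3*\<xi>1)
      + 4 * s * (u0*u3 + u1*u2) * (\<xi>1*\<xi>2 + \<xi>3*\<xi>0) + 4*r*t * (u0*u1 + u2*u3) * (\<xi>0*\<xi>1 + \<xi>3*\<xi>2)"
    using tangent unfolding Q0_def Q1_def Q2_def by algebra
  then show "t * (u0^2 + u1^2 + u2^2 + u3^2)
              * ((\<eta>0^2 + \<eta>1^2 + \<eta>2^2) * u3^2 + (\<eta>0*u0 + \<eta>1*u1 + \<eta>2*u2)^2)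
          + s*t * (u0^2 - u1^2 + u2^2 - u3^2)
              * ((\<eta>0^2 - \<eta>1^2 + \<eta>2^2) * u3^2 - (\<eta>0*u0 + \<eta>1*u1 + \<eta>2*u2)^2)
          + 4*r * (u0*u2 - u1*u3) * u3 * (\<eta>0*\<eta>2*u3 + (\<eta>0*u0 + \<eta>1*u1 + \<eta>2*u2) * \<eta>1)
          + 4 * r * s * (u0*u2 + u1*u3) * u3 * (\<eta>0*\<eta>2*u3 - (\<eta>0*u0 + \<eta>1*u1 + \<eta>2*u2) * \<eta>1)
          + 4 * s * (u0*u3 + u1*u2) * u3 * (\<eta>1*\<eta>2*u3 - (\<eta>0*u0 + \<eta>1*u1 + \<eta>2*u2) * \<eta>0)
          + 4*r*t * (u0*u1 + u2*u3) * u3 * (\<eta>0*\<eta>1*u3 - (\<eta>0*u0 + \<eta>1*u1 + \<eta>2*u2) * \<eta>2)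
        = u3^4 * (Q1 - Q0 - Q2)"
    unfolding dot unfolding \<eta> by algebra
qed

section \<open>The coordinates of the moduli space\<close>

lemma vector_4:
  "(vector [w, x, y, z] :: 'a::zero^4) $ 1 = w" "(vector [w, x, y, z] :: 'a^4) $ 2 = x"
  "(vector [w, x, y, z] :: 'a^4) $ 3 = y" "(vector [w, x, y, z] :: 'a^4) $ 4 = z"
  unfolding vector_def by simp_all

definition q_coords :: "complex \<Rightarrow> complex \<Rightarrow> complex \<Rightarrow> complex^3 \<Rightarrow> complex^4" where
  "q_coords r s t p =
     (let R = p $ 1; S = p $ 2; T = p $ 3 in
      vector
       [(s-t)*R + (t-r)*S + (r-s)*T,
        (s-t)*(r-1)*(R+S*T) + (t-r)*(s-1)*(S+R*T) + (r-s)*(t-1)*(T+R*S),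
        r*(s-t)*S*T + s*(t-r)*R*T + t*(r-s)*R*S,
        (s-t)*(r-1)*(s*t*R+r*S*T) + (t-r)*(s-1)*(r*t*S+s*R*T) + (r-s)*(t-1)*(r * s*T+t*R*S)])"

definition q_partial :: "complex \<Rightarrow> complex \<Rightarrow> complex \<Rightarrow> complex^3 \<Rightarrow> 3 \<Rightarrow> complex^4" where
  "q_partial r s t p j =
     (let R = p $ 1; S = p $ 2; T = p $ 3 in
      if j = 1 then vector
       [s-t, (s-t)*(r-1) + (t-r)*(s-1)*T + (r-s)*(t-1)*S, s*(t-r)*T + t*(r-s)*S,
        (s-t)*(r-1) * s*t + (t-r)*(s-1) * s*T + (r-s)*(t-1)*t*S]
      else if j = 2 then vector
       [t-r, (s-t)*(r-1)*T + (t-r)*(s-1) + (r-s)*(t-1)*R, r*(s-t)*T + t*(r-s)*R,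
        (s-t)*(r-1)*r*T + (t-r)*(s-1)*r*t + (r-s)*(t-1)*t*R]
      else vector
       [r-s, (s-t)*(r-1)*S + (t-r)*(s-1)*R + (r-s)*(t-1), r*(s-t)*S + s*(t-r)*R,
        (s-t)*(r-1)*r*S + (t-r)*(s-1) * s*R + (r-s)*(t-1)*r * s])"

lemma q_partial_simps:
  "q_partial r s t p 1 = (let R = p $ 1; S = p $ 2; T = p $ 3 in vector
       [s-t, (s-t)*(r-1) + (t-r)*(s-1)*T + (r-s)*(t-1)*S, s*(t-r)*T + t*(r-s)*S,
        (s-t)*(r-1) * s*t + (t-r)*(s-1) * s*T + (r-s)*(t-1)*t*S])"
  "q_partial r s t p 2 = (let R = p $ 1; S = p $ 2; T = p $ 3 in vector
       [t-r, (s-t)*(r-1)*T + (t-r)*(s-1) + (r-s)*(t-1)*R, r*(s-t)*T + t*(r-s)*R,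
        (s-t)*(r-1)*r*T + (t-r)*(s-1)*r*t + (r-s)*(t-1)*t*R])"
  "q_partial r s t p 3 = (let R = p $ 1; S = p $ 2; T = p $ 3 in vector
       [r-s, (s-t)*(r-1)*S + (t-r)*(s-1)*R + (r-s)*(t-1), r*(s-t)*S + s*(t-r)*R,
        (s-t)*(r-1)*r*S + (t-r)*(s-1) * s*R + (r-s)*(t-1)*r * s])"
  by (simp_all add: q_partial_def)

text \<open>There is no remainder because each coordinate is of degree at most one in each of
  \<open>R\<close>, \<open>S\<close>, \<open>T\<close> separately.\<close>

lemma q_coords_axis: "q_coords r s t (p + axis j z) = q_coords r s t p + z *s q_partial r s t p j"
  using exhaust_3[of j]
  by (auto simp: vec_eq_iff forall_4 vector_4 q_coords_def q_partial_def Let_def axis_def algebra_simps)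

definition quaternion_matrix :: "complex \<Rightarrow> complex \<Rightarrow> complex \<Rightarrow> complex \<Rightarrow> complex^4^4" where
  "quaternion_matrix a b c d =
     vector [vector [ a,  b,  c,  d],
             vector [-b,  a,  d, -c],
             vector [ c,  d,  a,  b],
             vector [ d, -c, -b,  a]]"

lemma quaternion_matrix_mult:
  "quaternion_matrix a b c d *v w = vector
     [a * w $ 1 + b * w $ 2 + c * w $ 3 + d * w $ 4, a * w $ 2 - b * w $ 1 + d * w $ 3 - c * w $ 4,
      c * w $ 1 + d * w $ 2 + a * w $ 3 + b * w $ 4, d * w $ 1 - c * w $ 2 - b * w $ 3 + a * w $ 4]"
  by (simp add: vec_eq_iff forall_4 vector_4 matrix_vector_mult_def sum_4 quaternion_matrix_def)

lemma deriv_quintic: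
  "deriv (quintic r s t) 0 = r * s*t" "deriv (quintic r s t) 1 = (1-r)*(1-s)*(1-t)"
  "deriv (quintic r s t) r = r*(r-1)*(r-s)*(r-t)" "deriv (quintic r s t) s = s*(s-1)*(s-r)*(s-t)"
  "deriv (quintic r s t) t = t*(t-1)*(t-r)*(t-s)"
proof -
  have *: "(quintic r s t has_field_derivative
      (x-1)*(x-r)*(x-s)*(x-t) + x*(x-r)*(x-s)*(x-t) + x*(x-1)*(x-s)*(x-t)
      + x*(x-1)*(x-r)*(x-t) + x*(x-1)*(x-r)*(x-s)) (at x)" for x
    unfolding quintic_def by (rule derivative_eq_intros refl | simp)+ (simp add: algebra_simps)
  show "deriv (quintic r s t) 0 = r * s*t" "deriv (quintic r s t) 1 = (1-r)*(1-s)*(1-t)"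
    "deriv (quintic r s t) r = r*(r-1)*(r-s)*(r-t)" "deriv (quintic r s t) s = s*(s-1)*(s-r)*(s-t)"
    "deriv (quintic r s t) t = t*(t-1)*(t-r)*(t-s)"
    using DERIV_imp_deriv[OF *] by simp_all
qed

section \<open>The classifying map under the hypotheses on the square roots\<close>

locale u_chart =
  fixes r s t \<omega>0 \<omega>1 \<omega>r \<omega>s :: complex
  assumes r: "r \<notin> {0, 1}" and s: "s \<notin> {0, 1}" and t: "t \<notin> {0, 1}"
    and rs: "r \<noteq> s" and rt: "r \<noteq> t" and st: "s \<noteq> t"
    and \<omega>0: "\<omega>0\<^sup>2 = deriv (quintic r s t) 0"
    and \<omega>1: "\<omega>1\<^sup>2 = - deriv (quintic r s t) 1"
    and \<omega>r: "\<omega>r\<^sup>2 = deriv (quintic r s t) r"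
    and \<omega>s: "\<omega>s\<^sup>2 = deriv (quintic r s t) s"
begin

definition "a = r * s*t*(r-s)*\<omega>1 + t*\<omega>r*\<omega>s - r*t*(r-1)*\<omega>s - s*t*\<omega>1*\<omega>r"
definition "b = - s*t*(s-1)*\<omega>r + r*t*\<omega>1*\<omega>s"
definition "c = t*(r-s)*\<omega>0*\<omega>1 - t*(r-1)*\<omega>0*\<omega>s"
definition "d = - t*(r-1)*(s-1)*(r-s)*\<omega>0 + t*(s-1)*\<omega>0*\<omega>r"

abbreviation "u \<equiv> u_coords r s t \<omega>0 \<omega>1 \<omega>r \<omega>s"
abbreviation "phi \<equiv> phi_chart r s t \<omega>0 \<omega>1 \<omega>r \<omega>s"
abbreviation "K \<equiv> quaternion_matrix a b c d"

definition scale :: "complex^4 \<Rightarrow> complex^4" where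
  "scale w = vector [(\<omega>0*\<omega>1)^2 * w $ 1, \<omega>0^2*\<omega>1 * w $ 2, \<omega>0*\<omega>1^2 * w $ 3, \<omega>0*\<omega>1 * w $ 4]"

sublocale root_choice r s t \<omega>0 \<omega>1 \<omega>r \<omega>s a b c d
proof
  show "\<omega>1^2 = (r-1)*(s-1)*(t-1)"
    unfolding \<omega>1 deriv_quintic by algebra
qed (use r s t rs rt st in \<open>auto simp: \<omega>0 \<omega>r \<omega>s deriv_quintic a_def b_def c_def d_def\<close>)

lemma \<omega>0_nz: "\<omega>0 \<noteq> 0" and \<omega>1_nz: "\<omega>1 \<noteq> 0"
  using roots(1,2) distinct by auto

definition u_matrix_factor :: "complex^4^4" where
  "u_matrix_factor =
    vector [vector [1, 1, 0, -(r * s + s*t + r*t)], vector [0, \<omega>1, 0, 0],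
            vector [0, \<omega>0, \<omega>0, \<omega>0], vector [0, 0, 0, \<omega>0*\<omega>1]]"

lemma u_matrix_eq: "u_matrix r s t \<omega>0 \<omega>1 \<omega>r \<omega>s = K ** u_matrix_factor"
  unfolding u_matrix_def u_matrix_factor_def quaternion_matrix_def a_def b_def c_def d_def Let_def by simp

text \<open>The triangular factor of the matrix does nothing but expose common factors:
  \<open>v0 + v1 - (r*s + s*t + r*t)*v3\<close> is \<open>r*s*t*(r-1)*(s-1)*(t-1)\<close> times the
  first coordinate, \<open>v1\<close> is \<open>r*s*t\<close> times the second,
  \<open>v1 + v2 + v3\<close> is \<open>(r-1)*(s-1)*(t-1)\<close> times the third, and
  \<open>v3\<close> is the fourth. These factors are \<open>\<omega>0^2\<close> and
  \<open>\<omega>1^2\<close>.\<close>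

lemma u_eq: "u p = K *v scale (q_coords r s t p)"
proof -
  have "u_matrix_factor *v v_coords r s t p = scale (q_coords r s t p)"
    unfolding vec_eq_iff forall_4
    unfolding matrix_vector_mult_def sum_4 vec_lambda_beta vector_4 v_coords_def q_coords_def scale_def Let_def
      u_matrix_factor_def
    unfolding power_mult_distrib roots(1,2)
    by (intro conjI; algebra)
  then show ?thesis
    unfolding u_coords_def u_matrix_eq matrix_vector_mul_assoc[symmetric] by simp
qed

lemma scale_add: "scale (v + w) = scale v + scale w" and scale_smult: "scale (k *s w) = k *s scale w"
  by (simp_all add: scale_def vec_eq_iff forall_4 vector_4 algebra_simps)

definition "u_partial p j = K *v scale (q_partial r s t p j)"

lemma u_axis: "u (p + axis j z) = u p + z *s u_partial p j"
  by (simp add: u_eq u_partial_def q_coords_axis scale_add scale_smult matrix_vector_right_distrib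
      vector_scalar_commute)

lemma phi_eq: "phi p = vector [u p $ 1 / u p $ 4, u p $ 2 / u p $ 4, u p $ 3 / u p $ 4]"
  by (simp add: phi_chart_def Let_def)

lemma quotient_along_axis:
  assumes "u p $ 4 \<noteq> 0"
  shows "deriv (\<lambda>z. u (p + axis j z) $ i / u (p + axis j z) $ 4) 0
    = (u_partial p j $ i * u p $ 4 - u p $ i * u_partial p j $ 4) / (u p $ 4)^2"
  by (rule DERIV_imp_deriv, unfold u_axis) (auto intro!: derivative_eq_intros simp: assms power2_eq_square)

text \<open>The quotient rule, sorted by the partial derivatives of \<open>u\<close>: the four
  coefficients form the homogeneous lift of the covector.\<close>

lemma pullback_covector_phi:
  assumes "u p $ 4 \<noteq> 0"
  shows "pullback_covector phi p (vector [\<eta>0, \<eta>1, \<eta>2]) $ j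
    = \<eta>0 / u p $ 4 * u_partial p j $ 1 + \<eta>1 / u p $ 4 * u_partial p j $ 2 + \<eta>2 / u p $ 4 * u_partial p j $ 3
      - (\<eta>0 * u p $ 1 + \<eta>1 * u p $ 2 + \<eta>2 * u p $ 3) / (u p $ 4)^2 * u_partial p j $ 4"
  using assms by (simp add: pullback_covector_def sum_3 phi_eq quotient_along_axis field_simps power2_eq_square)

text \<open>The abstract variables of \<open>cotangent_chart\<close> are replaced by the actual
  polynomials in \<open>R, S, T\<close>, so that the covector coefficients are those of the
  pull-back by \<open>phi\<close>.\<close>

lemma hitchin_values:
  fixes p :: "complex^3" and \<eta>0 \<eta>1 \<eta>2 :: complex
  defines "R \<equiv> p $ 1" and "S \<equiv> p $ 2" and "T \<equiv> p $ 3"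
    and "u0 \<equiv> u p $ 1" and "u1 \<equiv> u p $ 2" and "u2 \<equiv> u p $ 3" and "u3 \<equiv> u p $ 4"
  defines "C \<equiv> pullback_covector phi p (vector [\<eta>0, \<eta>1, \<eta>2])"
  defines "cr \<equiv> C $ 1" and "cs \<equiv> C $ 2" and "ct \<equiv> C $ 3"
  defines "\<xi>0 \<equiv> \<eta>0 / u3" and "\<xi>1 \<equiv> \<eta>1 / u3" and "\<xi>2 \<equiv> \<eta>2 / u3"
    and "\<xi>3 \<equiv> - ((\<eta>0*u0 + \<eta>1*u1 + \<eta>2*u2) / u3^2)"
  assumes u3_nz: "u3 \<noteq> 0"
  shows "r * s*t*(\<xi>1*u2 + \<xi>2*u1 - \<xi>0*u3 - \<xi>3*u0)^2 - s*t*(\<xi>0*u2 - \<xi>1*u3 - \<xi>2*u0 + \<xi>3*u1)^2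
    + r * s*(\<xi>0*u0 + \<xi>1*u1 - \<xi>2*u2 - \<xi>3*u3)^2 - r*t*(\<xi>0*u3 + \<xi>1*u2 - \<xi>2*u1 - \<xi>3*u0)^2
   = 4*((cr*(1-R) + cs*(1-S) + ct*(1-T))
      * (s*t*cr*R^2 + r*t*cs*S^2 + r * s*ct*T^2 - r * s*t*(cr*R + cs*S + ct*T)))"
   and "(r-1)*(s-1)*(t-1)*(\<xi>1*u2 + \<xi>2*u1 - \<xi>0*u3 - \<xi>3*u0)^2
    - (s-1)*(t-1)*(\<xi>0*u1 + \<xi>1*u0 + \<xi>2*u3 + \<xi>3*u2)^2
    - (r-1)*(t-1)*(\<xi>0*u0 - \<xi>1*u1 + \<xi>2*u2 - \<xi>3*u3)^2
    + (r-1)*(s-1)*(\<xi>0*u3 - \<xi>1*u2 + \<xi>2*u1 - \<xi>3*u0)^2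
   = 4*(- (cr*R + cs*S + ct*T) * ((r-1)*(s-1)*(t-1)*(cr*(1-R) + cs*(1-S) + ct*(1-T))
        + cr*(1-R)^2*(s-1)*(t-1) + cs*(1-S)^2*(r-1)*(t-1) + ct*(1-T)^2*(r-1)*(s-1)))"
   and "r*(\<xi>0*u0 - \<xi>1*u1 - \<xi>2*u2 + \<xi>3*u3)^2 - (\<xi>0*u1 - \<xi>1*u0 - \<xi>2*u3 + \<xi>3*u2)^2
    + s*(\<xi>0*u1 + \<xi>1*u0 - \<xi>2*u3 - \<xi>3*u2)^2 - t*(\<xi>0*u2 + \<xi>1*u3 - \<xi>2*u0 - \<xi>3*u1)^2
   = 4*((cr*(R-r) + cs*(S-s) + ct*(T-t))*(cr*R*(1-R) + cs*S*(1-S) + ct*T*(1-T)))"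
   and "\<xi>0*u0 + \<xi>1*u1 + \<xi>2*u2 + \<xi>3*u3 = 0"
proof -
  note u_defs = u0_def u1_def u2_def u3_def
  have C: "C $ j = \<xi>0 * u_partial p j $ 1 + \<xi>1 * u_partial p j $ 2 + \<xi>2 * u_partial p j $ 3 + \<xi>3 * u_partial p j $ 4" for j
    unfolding C_def \<xi>0_def \<xi>1_def \<xi>2_def \<xi>3_def u_defs pullback_covector_phi[OF u3_nz[unfolded u3_def]]
    by simp
  show tangent: "\<xi>0*u0 + \<xi>1*u1 + \<xi>2*u2 + \<xi>3*u3 = 0"
    using u3_nz by (simp add: \<xi>0_def \<xi>1_def \<xi>2_def \<xi>3_def field_simps power2_eq_square)
  define y0 y1 y2 y3 where "y0 = a*\<xi>0 - b*\<xi>1 + c*\<xi>2 + d*\<xi>3" and "y1 = b*\<xi>0 + a*\<xi>1 + d*\<xi>2 - c*\<xi>3"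
    and "y2 = c*\<xi>0 + d*\<xi>1 + a*\<xi>2 - b*\<xi>3" and "y3 = d*\<xi>0 - c*\<xi>1 + b*\<xi>2 + a*\<xi>3"
  note y_defs = y0_def y1_def y2_def y3_def
  interpret cotangent_chart r s t \<omega>0 \<omega>1 \<omega>r \<omega>s a b c d R S T \<xi>0 \<xi>1 \<xi>2 \<xi>3
    "(s-t)*R + (t-r)*S + (r-s)*T"
    "(s-t)*(r-1)*(R+S*T) + (t-r)*(s-1)*(S+R*T) + (r-s)*(t-1)*(T+R*S)"
    "r*(s-t)*S*T + s*(t-r)*R*T + t*(r-s)*R*S"
    "(s-t)*(r-1)*(s*t*R+r*S*T) + (t-r)*(s-1)*(r*t*S+s*R*T) + (r-s)*(t-1)*(r * s*T+t*R*S)"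
    u0 u1 u2 u3 cr cs ct y0 y1 y2 y3
    "(\<omega>0*\<omega>1)^2*y0" "\<omega>0^2*\<omega>1*y1" "\<omega>0*\<omega>1^2*y2" "\<omega>0*\<omega>1*y3"
  proof
    show "u0 = \<omega>0*\<omega>1*(a*(\<omega>0*\<omega>1*((s-t)*R + (t-r)*S + (r-s)*T))
        + b*(\<omega>0*((s-t)*(r-1)*(R+S*T) + (t-r)*(s-1)*(S+R*T) + (r-s)*(t-1)*(T+R*S)))
        + c*(\<omega>1*(r*(s-t)*S*T + s*(t-r)*R*T + t*(r-s)*R*S))
        + d*((s-t)*(r-1)*(s*t*R+r*S*T) + (t-r)*(s-1)*(r*t*S+s*R*T) + (r-s)*(t-1)*(r * s*T+t*R*S)))"
      unfolding u_defs u_eq quaternion_matrix_mult scale_def q_coords_def Let_def vector_4 R_def S_def T_def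
      by algebra
    show "u1 = \<omega>0*\<omega>1*(a*(\<omega>0*((s-t)*(r-1)*(R+S*T) + (t-r)*(s-1)*(S+R*T) + (r-s)*(t-1)*(T+R*S)))
        - b*(\<omega>0*\<omega>1*((s-t)*R + (t-r)*S + (r-s)*T))
        + d*(\<omega>1*(r*(s-t)*S*T + s*(t-r)*R*T + t*(r-s)*R*S))
        - c*((s-t)*(r-1)*(s*t*R+r*S*T) + (t-r)*(s-1)*(r*t*S+s*R*T) + (r-s)*(t-1)*(r * s*T+t*R*S)))"
      unfolding u_defs u_eq quaternion_matrix_mult scale_def q_coords_def Let_def vector_4 R_def S_def T_def
      by algebra
    show "u2 = \<omega>0*\<omega>1*(c*(\<omega>0*\<omega>1*((s-t)*R + (t-r)*S + (r-s)*T))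
        + d*(\<omega>0*((s-t)*(r-1)*(R+S*T) + (t-r)*(s-1)*(S+R*T) + (r-s)*(t-1)*(T+R*S)))
        + a*(\<omega>1*(r*(s-t)*S*T + s*(t-r)*R*T + t*(r-s)*R*S))
        + b*((s-t)*(r-1)*(s*t*R+r*S*T) + (t-r)*(s-1)*(r*t*S+s*R*T) + (r-s)*(t-1)*(r * s*T+t*R*S)))"
      unfolding u_defs u_eq quaternion_matrix_mult scale_def q_coords_def Let_def vector_4 R_def S_def T_def
      by algebra
    show "u3 = \<omega>0*\<omega>1*(d*(\<omega>0*\<omega>1*((s-t)*R + (t-r)*S + (r-s)*T))
        - c*(\<omega>0*((s-t)*(r-1)*(R+S*T) + (t-r)*(s-1)*(S+R*T) + (r-s)*(t-1)*(T+R*S)))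
        - b*(\<omega>1*(r*(s-t)*S*T + s*(t-r)*R*T + t*(r-s)*R*S))
        + a*((s-t)*(r-1)*(s*t*R+r*S*T) + (t-r)*(s-1)*(r*t*S+s*R*T) + (r-s)*(t-1)*(r * s*T+t*R*S)))"
      unfolding u_defs u_eq quaternion_matrix_mult scale_def q_coords_def Let_def vector_4 R_def S_def T_def
      by algebra
    note C_simps = C u_partial_def quaternion_matrix_mult scale_def q_partial_simps Let_def vector_4 y_defs R_def S_def T_def
    show "cr = (\<omega>0*\<omega>1)^2*y0*(s-t) + \<omega>0^2*\<omega>1*y1*((s-t)*(r-1) + (t-r)*(s-1)*T + (r-s)*(t-1)*S)
                  + \<omega>0*\<omega>1^2*y2*(s*(t-r)*T + t*(r-s)*S)
                  + \<omega>0*\<omega>1*y3*((s-t)*(r-1) * s*t + (t-r)*(s-1) * s*T + (r-s)*(t-1)*t*S)"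
      unfolding cr_def C_simps by algebra
    show "cs = (\<omega>0*\<omega>1)^2*y0*(t-r) + \<omega>0^2*\<omega>1*y1*((s-t)*(r-1)*T + (t-r)*(s-1) + (r-s)*(t-1)*R)
                  + \<omega>0*\<omega>1^2*y2*(r*(s-t)*T + t*(r-s)*R)
                  + \<omega>0*\<omega>1*y3*((s-t)*(r-1)*r*T + (t-r)*(s-1)*r*t + (r-s)*(t-1)*t*R)"
      unfolding cs_def C_simps by algebra
    show "ct = (\<omega>0*\<omega>1)^2*y0*(r-s) + \<omega>0^2*\<omega>1*y1*((s-t)*(r-1)*S + (t-r)*(s-1)*R + (r-s)*(t-1))
                  + \<omega>0*\<omega>1^2*y2*(r*(s-t)*S + s*(t-r)*R)
                  + \<omega>0*\<omega>1*y3*((s-t)*(r-1)*r*S + (t-r)*(s-1) * s*R + (r-s)*(t-1)*r * s)"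
      unfolding ct_def C_simps by algebra
  qed (simp_all add: tangent y_defs)
  from quadric_value_at_0 quadric_value_at_1 quadric_leading_value
  show "r * s*t*(\<xi>1*u2 + \<xi>2*u1 - \<xi>0*u3 - \<xi>3*u0)^2 - s*t*(\<xi>0*u2 - \<xi>1*u3 - \<xi>2*u0 + \<xi>3*u1)^2
    + r * s*(\<xi>0*u0 + \<xi>1*u1 - \<xi>2*u2 - \<xi>3*u3)^2 - r*t*(\<xi>0*u3 + \<xi>1*u2 - \<xi>2*u1 - \<xi>3*u0)^2
   = 4*((cr*(1-R) + cs*(1-S) + ct*(1-T))
      * (s*t*cr*R^2 + r*t*cs*S^2 + r * s*ct*T^2 - r * s*t*(cr*R + cs*S + ct*T)))"
   and "(r-1)*(s-1)*(t-1)*(\<xi>1*u2 + \<xi>2*u1 - \<xi>0*u3 - \<xi>3*u0)^2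
    - (s-1)*(t-1)*(\<xi>0*u1 + \<xi>1*u0 + \<xi>2*u3 + \<xi>3*u2)^2
    - (r-1)*(t-1)*(\<xi>0*u0 - \<xi>1*u1 + \<xi>2*u2 - \<xi>3*u3)^2
    + (r-1)*(s-1)*(\<xi>0*u3 - \<xi>1*u2 + \<xi>2*u1 - \<xi>3*u0)^2
   = 4*(- (cr*R + cs*S + ct*T) * ((r-1)*(s-1)*(t-1)*(cr*(1-R) + cs*(1-S) + ct*(1-T))
        + cr*(1-R)^2*(s-1)*(t-1) + cs*(1-S)^2*(r-1)*(t-1) + ct*(1-T)^2*(r-1)*(s-1)))"
   and "r*(\<xi>0*u0 - \<xi>1*u1 - \<xi>2*u2 + \<xi>3*u3)^2 - (\<xi>0*u1 - \<xi>1*u0 - \<xi>2*u3 + \<xi>3*u2)^2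
    + s*(\<xi>0*u1 + \<xi>1*u0 - \<xi>2*u3 - \<xi>3*u2)^2 - t*(\<xi>0*u2 + \<xi>1*u3 - \<xi>2*u0 - \<xi>3*u1)^2
   = 4*((cr*(R-r) + cs*(S-s) + ct*(T-t))*(cr*R*(1-R) + cs*S*(1-S) + ct*T*(1-T)))"
    by this
qed

end

section \<open>Generic local biholomorphy\<close>

lemma bounded_linear_axis: "bounded_linear (axis i :: complex \<Rightarrow> complex^'n)"
proof (rule bounded_linear_intro[where K = 1])
  show "axis i (x + y) = (axis i x + axis i y :: complex^'n)" for x y
    by (simp add: vec_eq_iff axis_def)
  show "axis i (k *\<^sub>R x) = k *\<^sub>R (axis i x :: complex^'n)" for k x
    by (simp add: vec_eq_iff axis_def)
  show "norm (axis i x :: complex^'n) \<le> norm x * 1" for x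
    by (simp add: norm_vec_def L2_set_def axis_def if_distrib[of norm] if_distrib[of "\<lambda>x. x^2"] cong: if_cong)
qed

lemma has_derivative_vecI:
  fixes f :: "'a::real_normed_vector \<Rightarrow> complex^'n"
  assumes "\<And>i. ((\<lambda>x. f x $ i) has_derivative (\<lambda>h. f' h $ i)) F"
  shows "(f has_derivative f') F"
proof -
  have expand: "v = (\<Sum>i\<in>UNIV. axis i (v $ i))" for v :: "complex^'n"
    by (simp add: vec_eq_iff axis_def)
  have "((\<lambda>x. \<Sum>i\<in>UNIV. axis i (f x $ i)) has_derivative (\<lambda>h. \<Sum>i\<in>UNIV. axis i (f' h $ i))) F"
    by (intro has_derivative_sum bounded_linear.has_derivative[OF bounded_linear_axis] assms)
  then show ?thesis by (simp flip: expand)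
qed

lemma bounded_linear_matrix_vector_mult: "bounded_linear (\<lambda>h. J *v h)" for J :: "complex^'n^'m"
proof -
  have "linear (\<lambda>h. J *v h)"
    by (rule linearI) (simp_all add: matrix_vector_right_distrib vec_eq_iff matrix_vector_mult_def scaleR_sum_right
        distrib_left sum.distrib)
  then show ?thesis by (simp add: linear_conv_bounded_linear)
qed

lemma locally_biholomorphic_atI:
  fixes f :: "complex^3 \<Rightarrow> complex^3" and J :: "complex^3 \<Rightarrow> complex^3^3"
  assumes U: "open U" "p \<in> U"
    and der: "\<And>x. x \<in> U \<Longrightarrow> (f has_derivative (\<lambda>h. J x *v h)) (at x)"
    and cont: "\<And>i j. continuous_on U (\<lambda>x. J x $ i $ j)"
    and inj: "\<And>x h. x \<in> U \<Longrightarrow> J x *v h = 0 \<Longrightarrow> h = 0"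
  shows "locally_biholomorphic_at f p"
proof -
  have inverse: "\<exists>B. (\<forall>h. B *v (J x *v h) = h) \<and> (\<forall>h. J x *v (B *v h) = h)" if x: "x \<in> U" for x
  proof -
    obtain B where B: "B ** J x = mat 1"
      using matrix_left_invertible_ker[of "J x"] inj[OF x] by blast
    then have "J x ** B = mat 1"
      using matrix_left_right_inverse by blast
    with B show ?thesis
      by (intro exI[of _ B]) (simp add: matrix_vector_mul_assoc)
  qed
  define f' where "f' x = Blinfun (\<lambda>h. J x *v h)" for x
  have f'_apply: "blinfun_apply (f' x) = (\<lambda>h. J x *v h)" for x
    unfolding f'_def by (rule bounded_linear_Blinfun_apply[OF bounded_linear_matrix_vector_mult])
  have cont': "continuous_on U f'"
  proof (rule continuous_on_blinfun_componentwise)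
    fix v :: "complex^3"
    show "continuous_on U (\<lambda>x. blinfun_apply (f' x) v)"
      unfolding f'_apply matrix_vector_mult_def
      by (intro continuous_on_vec_lambda continuous_on_sum continuous_on_mult cont continuous_on_const)
  qed
  obtain B where B: "\<And>h. B *v (J p *v h) = h"
    using inverse[OF U(2)] by blast
  have left_inverse: "Blinfun (\<lambda>h. B *v h) o\<^sub>L f' p = id_blinfun"
    by (rule blinfun_eqI) (simp add: f'_apply bounded_linear_Blinfun_apply[OF bounded_linear_matrix_vector_mult] B)
  have der': "\<And>x. x \<in> U \<Longrightarrow> (f has_derivative blinfun_apply (f' x)) (at x)"
    using der by (simp add: f'_apply)
  obtain U' V g g' where U': "open U'" "U' \<subseteq> U" "p \<in> U'" "open V" "f p \<in> V" "homeomorphism U' V f g"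
    and g: "\<And>y. y \<in> V \<Longrightarrow> (g has_derivative (g' y)) (at y)"
    and g': "\<And>y. y \<in> V \<Longrightarrow> g' y = inv (blinfun_apply (f' (g y)))"
    and "\<And>y. y \<in> V \<Longrightarrow> bij (blinfun_apply (f' (g y)))"
    by (rule inverse_function_theorem[OF U(1) der' cont' U(2) left_inverse]) blast+
  have "\<exists>J. (g has_derivative (\<lambda>h. J *v h)) (at y)" if y: "y \<in> V" for y
  proof -
    have "g y \<in> U" using U'(2,6) y by (auto simp: homeomorphism_def)
    from inverse[OF this] obtain B where B: "\<And>h. B *v (J (g y) *v h) = h" "\<And>h. J (g y) *v (B *v h) = h"
      by blast
    have "g' y = (\<lambda>h. B *v h)"
      unfolding g'[OF y] f'_apply by (rule inv_equality) (simp_all add: B)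
    with g[OF y] show ?thesis by auto
  qed
  moreover have "\<exists>J. (f has_derivative (\<lambda>h. J *v h)) (at x)" if "x \<in> U'" for x
    using der that U'(2) by blast
  ultimately show ?thesis
    unfolding locally_biholomorphic_at_def using U'(1,3,4,6) by blast
qed

section \<open>Polynomial functions and Zariski genericity\<close>

definition polynomial3 :: "(complex^3 \<Rightarrow> complex) \<Rightarrow> bool" where
  "polynomial3 f \<longleftrightarrow> (\<exists>G :: complex poly poly poly. \<forall>p. poly (poly (poly G [:[:p $ 1:]:]) [:p $ 2:]) (p $ 3) = f p)"

lemma polynomial3_const: "polynomial3 (\<lambda>p. k)"
  unfolding polynomial3_def by (intro exI[of _ "[:[:[:k:]:]:]"]) simp

lemma polynomial3_component: "polynomial3 (\<lambda>p. p $ i)"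
proof -
  have "polynomial3 (\<lambda>p. p $ 1)"
    \<comment> \<open>The outermost variable of the nested polynomial stands for the first
      component, the innermost for the third.\<close>
    unfolding polynomial3_def by (intro exI[of _ "[:0, 1:]"]) simp
  moreover have "polynomial3 (\<lambda>p. p $ 2)"
    unfolding polynomial3_def by (intro exI[of _ "[:[:0, 1:]:]"]) simp
  moreover have "polynomial3 (\<lambda>p. p $ 3)"
    unfolding polynomial3_def by (intro exI[of _ "[:[:[:0, 1:]:]:]"]) simp
  ultimately show ?thesis using exhaust_3[of i] by auto
qed

lemma polynomial3_add: "polynomial3 f \<Longrightarrow> polynomial3 g \<Longrightarrow> polynomial3 (\<lambda>p. f p + g p)"
  unfolding polynomial3_def
proof (elim exE)
  fix G H :: "complex poly poly poly"
  assume "\<forall>p. poly (poly (poly G [:[:p $ 1:]:]) [:p $ 2:]) (p $ 3) = f p"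
    and "\<forall>p. poly (poly (poly H [:[:p $ 1:]:]) [:p $ 2:]) (p $ 3) = g p"
  then show "\<exists>G :: complex poly poly poly. \<forall>p. poly (poly (poly G [:[:p $ 1:]:]) [:p $ 2:]) (p $ 3) = f p + g p"
    by (intro exI[of _ "G + H"]) simp
qed

lemma polynomial3_diff: "polynomial3 f \<Longrightarrow> polynomial3 g \<Longrightarrow> polynomial3 (\<lambda>p. f p - g p)"
  unfolding polynomial3_def
proof (elim exE)
  fix G H :: "complex poly poly poly"
  assume "\<forall>p. poly (poly (poly G [:[:p $ 1:]:]) [:p $ 2:]) (p $ 3) = f p"
    and "\<forall>p. poly (poly (poly H [:[:p $ 1:]:]) [:p $ 2:]) (p $ 3) = g p"
  then show "\<exists>G :: complex poly poly poly. \<forall>p. poly (poly (poly G [:[:p $ 1:]:]) [:p $ 2:]) (p $ 3) = f p - g p"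
    by (intro exI[of _ "G - H"]) simp
qed

lemma polynomial3_mult: "polynomial3 f \<Longrightarrow> polynomial3 g \<Longrightarrow> polynomial3 (\<lambda>p. f p * g p)"
  unfolding polynomial3_def
proof (elim exE)
  fix G H :: "complex poly poly poly"
  assume "\<forall>p. poly (poly (poly G [:[:p $ 1:]:]) [:p $ 2:]) (p $ 3) = f p"
    and "\<forall>p. poly (poly (poly H [:[:p $ 1:]:]) [:p $ 2:]) (p $ 3) = g p"
  then show "\<exists>G :: complex poly poly poly. \<forall>p. poly (poly (poly G [:[:p $ 1:]:]) [:p $ 2:]) (p $ 3) = f p * g p"
    by (intro exI[of _ "G * H"]) simp
qed

lemmas polynomial3_intros =
  polynomial3_const polynomial3_component polynomial3_add polynomial3_diff polynomial3_mult

text \<open>A polynomial with a nonzero value is nonzero, and the nested polynomial ring is an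
  integral domain. Hence two open conditions may be witnessed at different points and still hold
  together generically.\<close>

lemma zariski_genericI:
  assumes "polynomial3 f" "f a \<noteq> 0" "polynomial3 g" "g b \<noteq> 0"
    and Q: "\<And>p. f p \<noteq> 0 \<Longrightarrow> g p \<noteq> 0 \<Longrightarrow> Q p"
  shows "zariski_generic Q"
proof -
  obtain G H :: "complex poly poly poly" where
    G: "\<And>p. poly (poly (poly G [:[:p $ 1:]:]) [:p $ 2:]) (p $ 3) = f p" and
    H: "\<And>p. poly (poly (poly H [:[:p $ 1:]:]) [:p $ 2:]) (p $ 3) = g p"
    using assms(1,3) unfolding polynomial3_def by blast
  have "G \<noteq> 0" "H \<noteq> 0"
    using G[of a] H[of b] assms(2,4) by auto
  then show ?thesis
    unfolding zariski_generic_def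
    by (intro exI[of _ "G * H"]) (auto simp: G H intro: Q)
qed

definition det4 :: "complex^4 \<Rightarrow> complex^4 \<Rightarrow> complex^4 \<Rightarrow> complex^4 \<Rightarrow> complex" where
  "det4 x y z w =
     x $ 1 * (y $ 2 * (z $ 3 * w $ 4 - z $ 4 * w $ 3) - y $ 3 * (z $ 2 * w $ 4 - z $ 4 * w $ 2) + y $ 4 * (z $ 2 * w $ 3 - z $ 3 * w $ 2))
   - x $ 2 * (y $ 1 * (z $ 3 * w $ 4 - z $ 4 * w $ 3) - y $ 3 * (z $ 1 * w $ 4 - z $ 4 * w $ 1) + y $ 4 * (z $ 1 * w $ 3 - z $ 3 * w $ 1))
   + x $ 3 * (y $ 1 * (z $ 2 * w $ 4 - z $ 4 * w $ 2) - y $ 2 * (z $ 1 * w $ 4 - z $ 4 * w $ 1) + y $ 4 * (z $ 1 * w $ 2 - z $ 2 * w $ 1))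
   - x $ 4 * (y $ 1 * (z $ 2 * w $ 3 - z $ 3 * w $ 2) - y $ 2 * (z $ 1 * w $ 3 - z $ 3 * w $ 1) + y $ 3 * (z $ 1 * w $ 2 - z $ 2 * w $ 1))"

lemma det4_combination:
  "det4 x (k *s x + ky *s y + kz *s z + kw *s w) z w = ky * det4 x y z w"
  "det4 x y (k *s x + ky *s y + kz *s z + kw *s w) w = kz * det4 x y z w"
  "det4 x y z (k *s x + ky *s y + kz *s z + kw *s w) = kw * det4 x y z w"
  unfolding det4_def vector_add_component vector_smult_component by algebra+

text \<open>Cramer's rule: putting the vanishing combination in place of one argument multiplies the
  determinant by the coefficient of that argument. In the application \<open>x\<close> is the point
  in homogeneous coordinates and the other three are tangent directions, whose coefficients are the
  ones wanted.\<close>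

lemma det4_kernel:
  assumes "det4 x y z w \<noteq> 0" and "k *s x + ky *s y + kz *s z + kw *s w = 0"
  shows "ky = 0 \<and> kz = 0 \<and> kw = 0"
proof -
  have "det4 x 0 z w = 0" "det4 x y 0 w = 0" "det4 x y z 0 = 0"
    by (simp_all add: det4_def)
  then show ?thesis
    using det4_combination[where x = x and y = y and z = z and w = w and k = k and ky = ky and kz = kz and kw = kw] assms by simp
qed

context u_chart
begin

text \<open>The Jacobian of a map to projective space in homogeneous form: it vanishes exactly where
  the point and its three partial derivatives are linearly dependent.\<close>

definition "q_jacobian p = det4 (q_coords r s t p) (q_partial r s t p 1) (q_partial r s t p 2) (q_partial r s t p 3)"

lemma q_jacobian_nonzero: "\<exists>p. q_jacobian p \<noteq> 0"
proof -
  \<comment> \<open>At this point the determinant splits into \<open>t\<close> and differences of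
    \<open>r, s, t\<close>, so it is visibly nonzero.\<close>
  have "q_jacobian (vector [-1, -1, 0]) = 2*t*(r-s)^3*(r-t)^2*(s-t)^2"
    unfolding q_jacobian_def det4_def q_coords_def q_partial_simps Let_def vector_4 vector_3 by algebra
  then show ?thesis using distinct by (intro exI[of _ "vector [-1, -1, 0]"]) simp
qed

lemma q_jacobian_polynomial: "polynomial3 q_jacobian"
  unfolding q_jacobian_def[abs_def] det4_def q_coords_def q_partial_simps Let_def vector_4
  by (intro polynomial3_intros)

lemma u_polynomial: "polynomial3 (\<lambda>p. u p $ i)"
proof -
  have "polynomial3 (\<lambda>p. u p $ 1)" "polynomial3 (\<lambda>p. u p $ 2)" "polynomial3 (\<lambda>p. u p $ 3)" "polynomial3 (\<lambda>p. u p $ 4)"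
    unfolding u_eq quaternion_matrix_mult scale_def q_coords_def Let_def vector_4
    by (intro polynomial3_intros)+
  then show ?thesis using exhaust_4[of i] by auto
qed

text \<open>The last coordinate of \<open>u\<close> is a linear combination of the four polynomials
  in \<open>q_coords\<close>, with coefficients \<open>a, b, c, d\<close> up to sign and nonzero
  factors. The four polynomials are linearly independent, and the four coefficients cannot all
  vanish when \<open>K\<close> is injective.\<close>

lemma u4_nonzero:
  assumes K: "\<And>w. K *v w = 0 \<Longrightarrow> w = 0"
  shows "\<exists>p. u p $ 4 \<noteq> 0"
proof (rule ccontr)
  assume "\<not> ?thesis"
  then have u4: "u p $ 4 = 0" for p by blast
  define c1 c2 c3 c4 where "c1 = d*(\<omega>0*\<omega>1)^2" and "c2 = - (c*(\<omega>0^2*\<omega>1))"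
    and "c3 = - (b*(\<omega>0*\<omega>1^2))" and "c4 = a*(\<omega>0*\<omega>1)"
  note c_defs = c1_def c2_def c3_def c4_def
  define L where "L p = c1 * q_coords r s t p $ 1 + c2 * q_coords r s t p $ 2 + c3 * q_coords r s t p $ 3
      + c4 * q_coords r s t p $ 4" for p
  have L: "L p = 0" for p
  proof -
    have "L p = u p $ 4"
      unfolding L_def u_eq quaternion_matrix_mult scale_def vector_4 c_defs by algebra
    then show ?thesis by (simp add: u4)
  qed
  note L_vector = L_def q_coords_def Let_def vector_4 vector_3
  \<comment> \<open>Since \<open>L\<close> has no constant term, the unit vectors give the
    coefficients of \<open>R, S, T\<close>, and the sums of two unit vectors then give those of
    \<open>S*T, R*T, R*S\<close>.\<close>
  have L1: "L (vector [1, 0, 0]) = (s-t) * (c1 + c2*(r-1) + c4*((r-1) * s*t))"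
    "L (vector [0, 1, 0]) = (t-r) * (c1 + c2*(s-1) + c4*((s-1)*r*t))"
    "L (vector [0, 0, 1]) = (r-s) * (c1 + c2*(t-1) + c4*((t-1)*r * s))"
    unfolding L_vector by algebra+
  have L2: "L (vector [0, 1, 1]) = L (vector [0, 1, 0]) + L (vector [0, 0, 1]) + (s-t) * (c4*r^2 + (c2+c3-c4)*r - c2)"
    "L (vector [1, 0, 1]) = L (vector [1, 0, 0]) + L (vector [0, 0, 1]) + (t-r) * (c4 * s^2 + (c2+c3-c4) * s - c2)"
    "L (vector [1, 1, 0]) = L (vector [1, 0, 0]) + L (vector [0, 1, 0]) + (r-s) * (c4*t^2 + (c2+c3-c4)*t - c2)"
    unfolding L_vector by algebra+
  have quad: "c4*r^2 + (c2+c3-c4)*r - c2 = 0" "c4 * s^2 + (c2+c3-c4) * s - c2 = 0" "c4*t^2 + (c2+c3-c4)*t - c2 = 0"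
    using L2 distinct unfolding L by simp_all
  have single: "c1 + c2*(r-1) + c4*((r-1) * s*t) = 0"
    using L1(1) distinct unfolding L by simp
  \<comment> \<open>One quadratic polynomial vanishes at the three distinct points
    \<open>r, s, t\<close>; its second divided difference isolates the leading coefficient.\<close>
  have "(r-s)*(r-t)*(s-t)*c4 = (s-t)*(c4*r^2 + (c2+c3-c4)*r - c2) - (r-t)*(c4 * s^2 + (c2+c3-c4) * s - c2)
      + (r-s)*(c4*t^2 + (c2+c3-c4)*t - c2)"
    by algebra
  also have "\<dots> = 0" by (simp only: quad mult_zero_right) simp
  finally have "(r-s)*(r-t)*(s-t)*c4 = 0" .
  then have c4: "c4 = 0" using distinct by simp
  have "(r-s)*(c2+c3) = 0" using quad(1,2) unfolding c4 by algebra
  then have c23: "c2 + c3 = 0" using distinct by simp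
  then have c2: "c2 = 0" using quad c4 by simp
  then have c3: "c3 = 0" using c23 by simp
  have c1: "c1 = 0" using single(1) c4 c2 distinct by simp
  have "a = 0" "b = 0" "c = 0" "d = 0"
    using c1 c2 c3 c4 \<omega>0_nz \<omega>1_nz by (auto simp: c_defs)
  then have "K *v vector [1, 0, 0, 0] = 0"
    by (simp add: quaternion_matrix_mult vec_eq_iff forall_4 vector_4)
  then have "(vector [1, 0, 0, 0] :: complex^4) $ 1 = 0" using K by force
  then show False by (simp add: vector_4)
qed

lemma scale_eq_0: "scale w = 0 \<Longrightarrow> w = 0"
  using \<omega>0_nz \<omega>1_nz by (simp add: vec_eq_iff forall_4 scale_def vector_4)

lemma u_partial_combination:
  "k *s u p + x1 *s u_partial p 1 + x2 *s u_partial p 2 + x3 *s u_partial p 3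
    = K *v scale (k *s q_coords r s t p + x1 *s q_partial r s t p 1 + x2 *s q_partial r s t p 2 + x3 *s q_partial r s t p 3)"
  by (simp add: u_eq u_partial_def scale_add scale_smult matrix_vector_right_distrib vector_scalar_commute)

lemma q_coords_has_derivative:
  "((\<lambda>p. q_coords r s t p $ i) has_derivative
     (\<lambda>h. h $ 1 * q_partial r s t p 1 $ i + h $ 2 * q_partial r s t p 2 $ i + h $ 3 * q_partial r s t p 3 $ i)) (at p)"
proof -
  note nth = bounded_linear_imp_has_derivative[OF bounded_linear_vec_nth]
  have "\<forall>i. ((\<lambda>p. q_coords r s t p $ i) has_derivative
     (\<lambda>h. h $ 1 * q_partial r s t p 1 $ i + h $ 2 * q_partial r s t p 2 $ i + h $ 3 * q_partial r s t p 3 $ i)) (at p)"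
    unfolding forall_4 q_coords_def q_partial_simps Let_def vector_4
    by (intro conjI; (rule derivative_eq_intros nth refl)+; simp add: fun_eq_iff algebra_simps)
  then show ?thesis by blast
qed

lemma u_has_derivative:
  "((\<lambda>p. u p $ i) has_derivative
     (\<lambda>h. h $ 1 * u_partial p 1 $ i + h $ 2 * u_partial p 2 $ i + h $ 3 * u_partial p 3 $ i)) (at p)"
proof -
  have "\<forall>i. ((\<lambda>p. u p $ i) has_derivative
     (\<lambda>h. h $ 1 * u_partial p 1 $ i + h $ 2 * u_partial p 2 $ i + h $ 3 * u_partial p 3 $ i)) (at p)"
    unfolding forall_4 u_eq u_partial_def quaternion_matrix_mult scale_def vector_4
    by (intro conjI; (rule derivative_eq_intros q_coords_has_derivative refl)+; simp add: fun_eq_iff algebra_simps)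
  then show ?thesis by blast
qed

definition homogeneous_index :: "3 \<Rightarrow> 4" where
  "homogeneous_index i = (if i = 1 then 1 else if i = 2 then 2 else 3)"

definition phi_derivative :: "complex^3 \<Rightarrow> complex^3^3" where
  "phi_derivative p = (\<chi> i j. (u_partial p j $ homogeneous_index i * u p $ 4
      - u p $ homogeneous_index i * u_partial p j $ 4) / (u p $ 4)^2)"

lemma phi_component: "phi p $ i = u p $ homogeneous_index i / u p $ 4"
  using exhaust_3[of i] by (auto simp: phi_eq homogeneous_index_def)

lemma phi_has_derivative:
  assumes "u p $ 4 \<noteq> 0"
  shows "(phi has_derivative (\<lambda>h. phi_derivative p *v h)) (at p)"
proof (rule has_derivative_vecI)
  fix i
  show "((\<lambda>p. phi p $ i) has_derivative (\<lambda>h. (phi_derivative p *v h) $ i)) (at p)"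
    unfolding phi_component
  proof (rule has_derivative_eq_rhs[OF has_derivative_divide'[OF u_has_derivative u_has_derivative assms]])
    have quotient: "((h1*a1 + h2*a2 + h3*a3)*w - v * (h1*b1 + h2*b2 + h3*b3)) / (w*w)
        = (a1*w - v * b1)/w^2*h1 + (a2*w - v * b2)/w^2*h2 + (a3*w - v * b3)/w^2*h3"
      for h1 h2 h3 a1 a2 a3 b1 b2 b3 v w :: complex
      unfolding power2_eq_square times_divide_eq_left add_divide_distrib[symmetric] by (rule arg_cong[where f = "\<lambda>x. x / (w*w)"]) algebra
    show "(\<lambda>h. ((h $ 1 * u_partial p 1 $ homogeneous_index i + h $ 2 * u_partial p 2 $ homogeneous_index i
            + h $ 3 * u_partial p 3 $ homogeneous_index i) * u p $ 4
          - u p $ homogeneous_index i * (h $ 1 * u_partial p 1 $ 4 + h $ 2 * u_partial p 2 $ 4 + h $ 3 * u_partial p 3 $ 4))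
          / (u p $ 4 * u p $ 4))
        = (\<lambda>h. (phi_derivative p *v h) $ i)"
      unfolding phi_derivative_def matrix_vector_mult_def vec_lambda_beta sum_3 quotient ..
  qed
qed

text \<open>A vector in the kernel moves \<open>u\<close> only along its own line, that is,
  \<open>W\<close> is proportional to \<open>u\<close>. Stripping off the injective maps
  \<open>K\<close> and \<open>scale\<close> leaves a linear relation between \<open>q_coords\<close>
  and its partial derivatives, which the Jacobian forbids.\<close>

lemma phi_derivative_injective:
  assumes K: "\<And>w. K *v w = 0 \<Longrightarrow> w = 0" and u4: "u p $ 4 \<noteq> 0" and jac: "q_jacobian p \<noteq> 0"
    and h: "phi_derivative p *v h = 0"
  shows "h = 0"
proof -
  define W where "W = h $ 1 *s u_partial p 1 + h $ 2 *s u_partial p 2 + h $ 3 *s u_partial p 3"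
  have W: "W $ homogeneous_index i * u p $ 4 - u p $ homogeneous_index i * W $ 4 = 0" for i
  proof -
    have "(phi_derivative p *v h) $ i * (u p $ 4)^2 = W $ homogeneous_index i * u p $ 4 - u p $ homogeneous_index i * W $ 4"
    proof -
      have quotient: "(x1/w^2*h1 + x2/w^2*h2 + x3/w^2*h3)*w^2 = x1*h1 + x2*h2 + x3*h3"
        if "w \<noteq> 0" for x1 x2 x3 h1 h2 h3 w :: complex
        using that by (simp add: distrib_right)
      show ?thesis
        unfolding phi_derivative_def matrix_vector_mult_def vec_lambda_beta sum_3 quotient[OF u4] W_def
          vector_add_component vector_smult_component by algebra
    qed
    then show ?thesis using h by simp
  qed
  have "\<forall>k::4. u p $ 4 * W $ k - W $ 4 * u p $ k = 0"
    using W[of 1] W[of 2] W[of 3] unfolding forall_4 by (simp add: homogeneous_index_def algebra_simps)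
  then have dependent: "u p $ 4 *s W - W $ 4 *s u p = 0"
    by (simp add: vec_eq_iff)
  have combination: "k *s (h1 *s A + h2 *s B + h3 *s C) - l *s v
      = (- l) *s v + (k * h1) *s A + (k * h2) *s B + (k * h3) *s C"
    for k l h1 h2 h3 :: complex and A B C v :: "complex^4"
    by (simp add: vec_eq_iff algebra_simps)
  have "(- W $ 4) *s u p + (u p $ 4 * h $ 1) *s u_partial p 1 + (u p $ 4 * h $ 2) *s u_partial p 2
      + (u p $ 4 * h $ 3) *s u_partial p 3 = 0"
    unfolding combination[symmetric] W_def[symmetric] by (rule dependent)
  then have "(- W $ 4) *s q_coords r s t p + (u p $ 4 * h $ 1) *s q_partial r s t p 1
      + (u p $ 4 * h $ 2) *s q_partial r s t p 2 + (u p $ 4 * h $ 3) *s q_partial r s t p 3 = 0"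
    unfolding u_partial_combination by (rule scale_eq_0[OF K])
  from det4_kernel[OF jac[unfolded q_jacobian_def] this] show ?thesis
    using u4 by (simp add: vec_eq_iff forall_3)
qed

lemma continuous_on_u: "continuous_on A (\<lambda>p. u p $ i)"
  by (intro continuous_at_imp_continuous_on ballI has_derivative_continuous[OF u_has_derivative])

lemma continuous_on_u_partial: "continuous_on A (\<lambda>p. u_partial p j $ i)"
proof -
  have "\<forall>i j. continuous_on A (\<lambda>p. u_partial p j $ i)"
    unfolding forall_4 forall_3 u_partial_def quaternion_matrix_mult scale_def vector_4 q_partial_simps Let_def
    by (intro conjI continuous_intros)
  then show ?thesis by blast
qed

lemma continuous_on_q_jacobian: "continuous_on A q_jacobian"
  unfolding q_jacobian_def[abs_def] det4_def q_coords_def q_partial_simps Let_def vector_4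
  by (intro continuous_intros)

lemma phi_locally_biholomorphic:
  assumes K: "\<And>w. K *v w = 0 \<Longrightarrow> w = 0" and u4: "u p $ 4 \<noteq> 0" and jac: "q_jacobian p \<noteq> 0"
  shows "locally_biholomorphic_at phi p"
proof (rule locally_biholomorphic_atI[where U = "{x. u x $ 4 \<noteq> 0} \<inter> {x. q_jacobian x \<noteq> 0}"])
  show "open ({x. u x $ 4 \<noteq> 0} \<inter> {x. q_jacobian x \<noteq> 0})"
    by (intro open_Int open_Collect_neq continuous_on_u continuous_on_q_jacobian continuous_on_const)
  show "continuous_on ({x. u x $ 4 \<noteq> 0} \<inter> {x. q_jacobian x \<noteq> 0}) (\<lambda>x. phi_derivative x $ i $ j)" for i j
    unfolding phi_derivative_def vec_lambda_beta
    by (intro continuous_intros continuous_on_u continuous_on_u_partial) auto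
qed (use u4 jac in \<open>auto intro: phi_has_derivative phi_derivative_injective[OF K]\<close>)

lemma phi_generic:
  assumes "invertible (u_matrix r s t \<omega>0 \<omega>1 \<omega>r \<omega>s)"
  shows "zariski_generic (\<lambda>p. locally_biholomorphic_at phi p \<and> u p $ 4 \<noteq> 0)"
proof -
  have K: "w = 0" if "K *v w = 0" for w
  proof -
    obtain B where "K ** u_matrix_factor ** B = mat 1"
      using assms unfolding invertible_def u_matrix_eq by blast
    then have "(u_matrix_factor ** B) ** K = mat 1"
      using matrix_left_right_inverse[of K "u_matrix_factor ** B"] by (simp add: matrix_mul_assoc)
    then have "(u_matrix_factor ** B) *v (K *v w) = w"
      by (simp only: matrix_vector_mul_assoc matrix_vector_mul_lid)
    then show ?thesis using that by simp
  qed
  obtain p p' where "q_jacobian p \<noteq> 0" "u p' $ 4 \<noteq> 0"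
    using q_jacobian_nonzero u4_nonzero[OF K] by blast
  then show ?thesis
    using phi_locally_biholomorphic[OF K]
    by (intro zariski_genericI[OF q_jacobian_polynomial _ u_polynomial]) auto
qed

end

section \<open>The determinant of the Higgs field\<close>

text \<open>The Higgs field sorted by poles instead of by \<open>R, S, T\<close>. Each matrix is the
  column \<open>(Z, 1)\<close> times the row \<open>(1, -Z)\<close>, with \<open>Z = 0\<close> at
  the pole \<open>0\<close> and \<open>Z = 1\<close> at the pole \<open>1\<close>.\<close>

lemma theta_entries:
  fixes p c :: "complex^3"
  defines "k0 \<equiv> c $ 1 * (1 - p $ 1) + c $ 2 * (1 - p $ 2) + c $ 3 * (1 - p $ 3)"
    and "k1 \<equiv> c $ 1 * p $ 1 + c $ 2 * p $ 2 + c $ 3 * p $ 3"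
  shows "theta r s t p c q = scale_mat (k0 / fst q) (mat2 0 0 1 0) + scale_mat (k1 / (fst q - 1)) (mat2 1 (-1) 1 (-1))
    + scale_mat (- c $ 1 / (fst q - r)) (mat2 (p $ 1) (- ((p $ 1)^2)) 1 (- p $ 1))
    + scale_mat (- c $ 2 / (fst q - s)) (mat2 (p $ 2) (- ((p $ 2)^2)) 1 (- p $ 2))
    + scale_mat (- c $ 3 / (fst q - t)) (mat2 (p $ 3) (- ((p $ 3)^2)) 1 (- p $ 3))"
  by (simp add: vec_eq_iff forall_2 theta_def theta_basis_def scale_mat_def mat2_def k0_def k1_def
      diff_divide_distrib add_divide_distrib algebra_simps)

text \<open>After clearing denominators a cubic would be expected. Its cubic coefficient is the
  determinant of the sum of the residues, and that sum is strictly upper triangular, so a quadratic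
  remains.\<close>

lemma det_theta:
  fixes x y :: complex and p c :: "complex^3"
  assumes "x \<notin> {0, 1, r, s, t}"
  defines "R \<equiv> p $ 1" and "S \<equiv> p $ 2" and "T \<equiv> p $ 3"
    and "cr \<equiv> c $ 1" and "cs \<equiv> c $ 2" and "ct \<equiv> c $ 3"
  defines "A0 \<equiv> (cr*(1-R) + cs*(1-S) + ct*(1-T))
      * (s*t*cr*R^2 + r*t*cs*S^2 + r * s*ct*T^2 - r * s*t*(cr*R + cs*S + ct*T))"
    and "A1 \<equiv> - (cr*R + cs*S + ct*T) * ((r-1)*(s-1)*(t-1)*(cr*(1-R) + cs*(1-S) + ct*(1-T))
        + cr*(1-R)^2*(s-1)*(t-1) + cs*(1-S)^2*(r-1)*(t-1) + ct*(1-T)^2*(r-1)*(s-1))"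
    and "A2 \<equiv> (cr*(R-r) + cs*(S-s) + ct*(T-t))*(cr*R*(1-R) + cs*S*(1-S) + ct*T*(1-T))"
  shows "det (theta r s t p c (x, y))
    = (A2 * x^2 + (A1 - A0 - A2) * x + A0) / (x * (x - 1) * (x - r) * (x - s) * (x - t))"
proof -
  define k0 k1 where "k0 = cr*(1-R) + cs*(1-S) + ct*(1-T)" and "k1 = cr*R + cs*S + ct*T"
  define j0 j1 jr js jt where "j0 = 1/x" and "j1 = 1/(x-1)" and "jr = 1/(x-r)" and "js = 1/(x-s)" and "jt = 1/(x-t)"
  have nz: "x \<noteq> 0" "x - 1 \<noteq> 0" "x - r \<noteq> 0" "x - s \<noteq> 0" "x - t \<noteq> 0"
    using assms(1) by auto
  have i: "x*j0 = 1" "(x-1)*j1 = 1" "(x-r)*jr = 1" "(x-s)*js = 1" "(x-t)*jt = 1"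
    using nz by (simp_all add: j0_def j1_def jr_def js_def jt_def)
  define X where "X = x * (x - 1) * (x - r) * (x - s) * (x - t)"
  have X: "X \<noteq> 0" using nz by (simp add: X_def)
  have pairs: "X*(j0*j1) = (x-r)*(x-s)*(x-t)" "X*(j0*jr) = (x-1)*(x-s)*(x-t)" "X*(j0*js) = (x-1)*(x-r)*(x-t)"
    "X*(j0*jt) = (x-1)*(x-r)*(x-s)" "X*(j1*jr) = x*(x-s)*(x-t)" "X*(j1*js) = x*(x-r)*(x-t)"
    "X*(j1*jt) = x*(x-r)*(x-s)" "X*(jr*js) = x*(x-1)*(x-t)" "X*(jr*jt) = x*(x-1)*(x-s)"
    "X*(js*jt) = x*(x-1)*(x-r)"
    using nz by (simp_all add: X_def j0_def j1_def jr_def js_def jt_def)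
  have "theta r s t p c (x, y) $ 1 $ 1 = k1*j1 - cr*jr*R - cs*js*S - ct*jt*T"
    "theta r s t p c (x, y) $ 2 $ 2 = - (k1*j1) + cr*jr*R + cs*js*S + ct*jt*T"
    "theta r s t p c (x, y) $ 1 $ 2 = - (k1*j1) + cr*jr*R^2 + cs*js*S^2 + ct*jt*T^2"
    "theta r s t p c (x, y) $ 2 $ 1 = k0*j0 + k1*j1 - cr*jr - cs*js - ct*jt"
    by (simp_all add: theta_entries scale_mat_def mat2_def k0_def k1_def cr_def cs_def ct_def R_def S_def T_def
       j0_def j1_def jr_def js_def jt_def add_divide_distrib diff_divide_distrib)
  then have "det (theta r s t p c (x, y)) =
     (k1*j1 - cr*jr*R - cs*js*S - ct*jt*T) * (- (k1*j1) + cr*jr*R + cs*js*S + ct*jt*T)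
     - (- (k1*j1) + cr*jr*R^2 + cs*js*S^2 + ct*jt*T^2) * (k0*j0 + k1*j1 - cr*jr - cs*js - ct*jt)"
    by (simp add: det_2)
  \<comment> \<open>The reciprocals are treated as independent variables. Their squares cancel
    because each residue is nilpotent and \<open>det\<close> is a quadratic form.\<close>
  also have "\<dots> = k0*k1*(j0*j1) - k0*cr*R^2*(j0*jr) - k0*cs*S^2*(j0*js) - k0*ct*T^2*(j0*jt)
     - k1*cr*(1-R)^2*(j1*jr) - k1*cs*(1-S)^2*(j1*js) - k1*ct*(1-T)^2*(j1*jt)
     + cr*cs*(R-S)^2*(jr*js) + cr*ct*(R-T)^2*(jr*jt) + cs*ct*(S-T)^2*(js*jt)"
    by algebra
  finally have "X * det (theta r s t p c (x, y))
     = k0*k1*(X*(j0*j1)) - k0*cr*R^2*(X*(j0*jr)) - k0*cs*S^2*(X*(j0*js)) - k0*ct*T^2*(X*(j0*jt))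
     - k1*cr*(1-R)^2*(X*(j1*jr)) - k1*cs*(1-S)^2*(X*(j1*js)) - k1*ct*(1-T)^2*(X*(j1*jt))
     + cr*cs*(R-S)^2*(X*(jr*js)) + cr*ct*(R-T)^2*(X*(jr*jt)) + cs*ct*(S-T)^2*(X*(js*jt))"
    by algebra
  also have "\<dots> = A2 * x^2 + (A1 - A0 - A2) * x + A0"
    unfolding pairs A0_def A1_def A2_def k0_def k1_def by algebra
  finally show ?thesis
    using X unfolding X_def[symmetric] by (simp add: nonzero_eq_divide_eq mult.commute)
qed

section \<open>Germs on the curve\<close>

lemma holomorphic_at_analytic:
  assumes "g analytic_on {fst q}"
  shows "holomorphic_at r s t (\<lambda>q. g (fst q)) q"
  unfolding holomorphic_at_def using assms by (intro exI[of _ g]) simp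

text \<open>Holomorphy is a property of the germ on the curve, so functions may be rewritten by
  means of \<open>y^2 = F(x)\<close>.\<close>

lemma holomorphic_at_cong:
  assumes "holomorphic_at r s t f q"
    and "\<forall>\<^sub>F q' in inf (nhds q) (principal (affine_curve r s t)). f' q' = f q'"
  shows "holomorphic_at r s t f' q"
proof -
  obtain g where g: "g analytic_on {fst q}"
      "\<forall>\<^sub>F q' in inf (nhds q) (principal (affine_curve r s t)). f q' = g (fst q')"
    using assms(1) unfolding holomorphic_at_def by blast
  have "\<forall>\<^sub>F q' in inf (nhds q) (principal (affine_curve r s t)). f' q' = g (fst q')"
    using assms(2) g(2) by eventually_elim simp
  with g(1) show ?thesis unfolding holomorphic_at_def by blast
qed

lemma holomorphic_at_add:
  assumes "holomorphic_at r s t f q" and "holomorphic_at r s t f' q"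
  shows "holomorphic_at r s t (\<lambda>q. f q + f' q) q"
proof -
  obtain g g' where g: "g analytic_on {fst q}" "g' analytic_on {fst q}"
      "\<forall>\<^sub>F q' in inf (nhds q) (principal (affine_curve r s t)). f q' = g (fst q')"
      "\<forall>\<^sub>F q' in inf (nhds q) (principal (affine_curve r s t)). f' q' = g' (fst q')"
    using assms unfolding holomorphic_at_def by blast
  have "\<forall>\<^sub>F q' in inf (nhds q) (principal (affine_curve r s t)). f q' + f' q' = g (fst q') + g' (fst q')"
    using g(3,4) by eventually_elim simp
  with analytic_on_add[OF g(1,2)] show ?thesis
    unfolding holomorphic_at_def by (intro exI[of _ "\<lambda>x. g x + g' x"]) simp
qed

lemma holomorphic_at_mult:
  assumes "holomorphic_at r s t f q" and "holomorphic_at r s t f' q"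
  shows "holomorphic_at r s t (\<lambda>q. f q * f' q) q"
proof -
  obtain g g' where g: "g analytic_on {fst q}" "g' analytic_on {fst q}"
      "\<forall>\<^sub>F q' in inf (nhds q) (principal (affine_curve r s t)). f q' = g (fst q')"
      "\<forall>\<^sub>F q' in inf (nhds q) (principal (affine_curve r s t)). f' q' = g' (fst q')"
    using assms unfolding holomorphic_at_def by blast
  have "\<forall>\<^sub>F q' in inf (nhds q) (principal (affine_curve r s t)). f q' * f' q' = g (fst q') * g' (fst q')"
    using g(3,4) by eventually_elim simp
  with analytic_on_mult[OF g(1,2)] show ?thesis
    unfolding holomorphic_at_def by (intro exI[of _ "\<lambda>x. g x * g' x"]) simp
qed

lemma quintic_analytic: "quintic r s t analytic_on A"
  unfolding quintic_def[abs_def] by (intro analytic_intros)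

text \<open>Near \<open>(x\<^sub>0, y\<^sub>0)\<close> with \<open>y\<^sub>0 \<noteq> 0\<close> the function \<open>y\<close> is the branch \<open>y\<^sub>0 \<surd>(F(x)/F(x\<^sub>0))\<close> of the root of \<open>F\<close>.\<close>

lemma holomorphic_at_snd:
  assumes q: "q \<in> affine_curve r s t" and "snd q \<noteq> 0"
  shows "holomorphic_at r s t snd q"
proof -
  obtain x0 y0 where q_eq: "q = (x0, y0)" by (cases q)
  have F0: "y0^2 = quintic r s t x0" and y0: "y0 \<noteq> 0"
    using assms by (auto simp: q_eq affine_curve_def)
  define g where "g x = y0 * csqrt (quintic r s t x / y0^2)" for x
  \<comment> \<open>At \<open>x0\<close> the argument of the root equals \<open>1\<close>, away from
    the branch cut.\<close>
  have "(\<lambda>x. csqrt (quintic r s t x / y0^2)) analytic_on {x0}"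
    unfolding quintic_def using y0 F0[symmetric]
    by (intro analytic_intros) (auto simp: quintic_def complex_nonpos_Reals_iff)
  then have "g analytic_on {fst q}"
    unfolding g_def q_eq fst_conv by (intro analytic_on_mult analytic_on_const)
  moreover have "\<forall>\<^sub>F q' in inf (nhds q) (principal (affine_curve r s t)). snd q' = g (fst q')"
  proof -
    have "((\<lambda>q'. snd q') \<longlongrightarrow> snd q) (nhds q)"
      by (rule tendsto_snd) (rule filterlim_ident)
    then have "((\<lambda>q'. Re (snd q' / y0)) \<longlongrightarrow> Re (y0 / y0)) (nhds q)"
      using y0 unfolding q_eq by (intro tendsto_Re tendsto_divide tendsto_const) auto
    \<comment> \<open>A number with positive real part is the principal root of its square; this
      selects the right sheet near \<open>q\<close>.\<close>
    then have "\<forall>\<^sub>F q' in nhds q. Re (snd q' / y0) > 0"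
      using y0 by (intro order_tendstoD) auto
    then show ?thesis
      unfolding eventually_inf_principal
    proof eventually_elim
      case (elim q')
      show ?case
      proof
        assume "q' \<in> affine_curve r s t"
        then have "(snd q')^2 = quintic r s t (fst q')"
          by (auto simp: affine_curve_def)
        then have "quintic r s t (fst q') / y0^2 = (snd q' / y0)^2"
          by (simp add: power_divide)
        with elim have "csqrt (quintic r s t (fst q') / y0^2) = snd q' / y0"
          by (simp only:) (rule csqrt_square, simp)
        then show "snd q' = g (fst q')"
          using y0 by (simp add: g_def)
      qed
    qed
  qed
  ultimately show ?thesis unfolding holomorphic_at_def by blast
qed

text \<open>On the curve \<open>1/y = y/F(x)\<close>, which reduces the claim to the previous
  lemma.\<close>

lemma holomorphic_at_inverse_snd:
  assumes q: "q \<in> affine_curve r s t" and nz: "snd q \<noteq> 0"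
  shows "holomorphic_at r s t (\<lambda>q. inverse (snd q)) q"
proof -
  have F: "quintic r s t (fst q) \<noteq> 0"
    using assms by (auto simp: affine_curve_def)
  have "(\<lambda>x. inverse (quintic r s t x)) analytic_on {fst q}"
    using F unfolding quintic_def by (intro analytic_intros) auto
  then have 1: "holomorphic_at r s t (\<lambda>q. inverse (quintic r s t (fst q)) * snd q) q"
    by (intro holomorphic_at_mult holomorphic_at_snd assms holomorphic_at_analytic)
  show ?thesis
  proof (rule holomorphic_at_cong[OF 1])
    show "\<forall>\<^sub>F q' in inf (nhds q) (principal (affine_curve r s t)).
        inverse (snd q') = inverse (quintic r s t (fst q')) * snd q'"
      unfolding eventually_inf_principal
    proof (intro always_eventually allI impI)
      fix q' assume "q' \<in> affine_curve r s t"
      then have "quintic r s t (fst q') = snd q' * snd q'"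
        by (auto simp: affine_curve_def power2_eq_square)
      then show "inverse (snd q') = inverse (quintic r s t (fst q')) * snd q'"
        by (cases "snd q' = 0") auto
    qed
  qed
qed

definition local_parametrization ::
    "complex \<Rightarrow> complex \<Rightarrow> complex \<Rightarrow> (complex \<times> complex) option \<Rightarrow> (complex \<Rightarrow> complex \<times> complex) \<Rightarrow> bool" where
  "local_parametrization r s t P \<gamma> \<longleftrightarrow>
     filterlim \<gamma> (punctured_nhds r s t P) (at 0) \<and>
     (\<forall>\<^sub>F \<tau> in at 0. \<gamma> \<tau> \<in> affine_curve r s t \<and> isCont \<gamma> \<tau> \<and> (\<lambda>\<tau>. fst (\<gamma> \<tau>)) analytic_on {\<tau>}
        \<and> local_coord P (\<gamma> \<tau>) = \<tau>) \<and>
     filterlim (local_coord P) (at 0) (punctured_nhds r s t P) \<and>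
     (\<forall>\<^sub>F q in punctured_nhds r s t P. \<gamma> (local_coord P q) = q)"

lemma analytic_compose_parametrization:
  assumes "holomorphic_at r s t f (\<gamma> \<tau>)" and "isCont \<gamma> \<tau>" and "(\<lambda>\<tau>. fst (\<gamma> \<tau>)) analytic_on {\<tau>}"
    and "\<forall>\<^sub>F \<tau>' in nhds \<tau>. \<gamma> \<tau>' \<in> affine_curve r s t"
  shows "(\<lambda>\<tau>. f (\<gamma> \<tau>)) analytic_on {\<tau>}"
proof -
  obtain g where g: "g analytic_on {fst (\<gamma> \<tau>)}"
      "\<forall>\<^sub>F q in inf (nhds (\<gamma> \<tau>)) (principal (affine_curve r s t)). f q = g (fst q)"
    using assms(1) unfolding holomorphic_at_def by blast
  have "filterlim \<gamma> (inf (nhds (\<gamma> \<tau>)) (principal (affine_curve r s t))) (nhds \<tau>)"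
    using assms(2,4) by (simp add: filterlim_inf filterlim_principal isCont_def tendsto_at_iff_tendsto_nhds)
  then have "\<forall>\<^sub>F \<tau>' in nhds \<tau>. f (\<gamma> \<tau>') = g (fst (\<gamma> \<tau>'))"
    using g(2) unfolding filterlim_iff by blast
  then obtain U where U: "open U" "\<tau> \<in> U" "\<And>\<tau>'. \<tau>' \<in> U \<Longrightarrow> f (\<gamma> \<tau>') = g (fst (\<gamma> \<tau>'))"
    unfolding eventually_nhds by blast
  have "(g \<circ> (\<lambda>\<tau>. fst (\<gamma> \<tau>))) analytic_on {\<tau>}"
    using assms(3) g(1) by (intro analytic_on_compose) auto
  then obtain V where V: "open V" "\<tau> \<in> V" "(\<lambda>\<tau>. g (fst (\<gamma> \<tau>))) holomorphic_on V"
    unfolding analytic_at o_def by blast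
  have "(\<lambda>\<tau>. f (\<gamma> \<tau>)) holomorphic_on U \<inter> V"
    by (rule holomorphic_transform[OF holomorphic_on_subset[OF V(3)]]) (use U(3) in auto)
  with U V show ?thesis
    unfolding analytic_at by (intro exI[of _ "U \<inter> V"]) auto
qed

text \<open>Riemann's extension theorem in the coordinate of the parametrization. It upgrades a
  vanishing polar part to the existence of a limit.\<close>

lemma removable_singularity_weierstrass:
  assumes par: "local_parametrization r s t P \<gamma>"
    and hol: "\<forall>\<^sub>F q in punctured_nhds r s t P. holomorphic_at r s t f q"
    and lim: "((\<lambda>q. local_coord P q * f q) \<longlongrightarrow> 0) (punctured_nhds r s t P)"
  shows "\<exists>l. (f \<longlongrightarrow> l) (punctured_nhds r s t P)"
proof -
  note par = par[unfolded local_parametrization_def]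
  have fl: "filterlim \<gamma> (punctured_nhds r s t P) (at 0)" using par by blast
  have ev: "\<forall>\<^sub>F \<tau> in at 0. \<gamma> \<tau> \<in> affine_curve r s t \<and> isCont \<gamma> \<tau> \<and> (\<lambda>\<tau>. fst (\<gamma> \<tau>)) analytic_on {\<tau>}
        \<and> local_coord P (\<gamma> \<tau>) = \<tau>" using par by blast
  have "\<forall>\<^sub>F \<tau> in at 0. holomorphic_at r s t f (\<gamma> \<tau>)"
    using fl hol unfolding filterlim_iff by blast
  with ev have "\<forall>\<^sub>F \<tau> in at 0. \<gamma> \<tau> \<in> affine_curve r s t \<and> isCont \<gamma> \<tau> \<and> (\<lambda>\<tau>. fst (\<gamma> \<tau>)) analytic_on {\<tau>}
        \<and> local_coord P (\<gamma> \<tau>) = \<tau> \<and> holomorphic_at r s t f (\<gamma> \<tau>)"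
    by eventually_elim simp
  then obtain e where e: "e > 0" and ball: "\<And>\<tau>. \<tau> \<in> ball 0 e - {0} \<Longrightarrow>
      \<gamma> \<tau> \<in> affine_curve r s t \<and> isCont \<gamma> \<tau> \<and> (\<lambda>\<tau>. fst (\<gamma> \<tau>)) analytic_on {\<tau>}
        \<and> local_coord P (\<gamma> \<tau>) = \<tau> \<and> holomorphic_at r s t f (\<gamma> \<tau>)"
    unfolding eventually_at by (auto simp: dist_commute)
  have an: "(\<lambda>\<tau>. f (\<gamma> \<tau>)) analytic_on {\<tau>}" if \<tau>: "\<tau> \<in> ball 0 e - {0}" for \<tau>
  proof (rule analytic_compose_parametrization)
    have "\<forall>\<^sub>F \<tau>' in nhds \<tau>. \<tau>' \<in> ball 0 e - {0}"
      using \<tau> by (intro eventually_nhds_in_open) auto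
    then show "\<forall>\<^sub>F \<tau>' in nhds \<tau>. \<gamma> \<tau>' \<in> affine_curve r s t"
      by eventually_elim (use ball in auto)
  qed (use ball[OF \<tau>] in auto)
  have "(\<lambda>\<tau>. f (\<gamma> \<tau>)) analytic_on ball 0 e - {0}"
    using an analytic_on_analytic_at by blast
  then have "(\<lambda>\<tau>. f (\<gamma> \<tau>)) holomorphic_on ball 0 e - {0}"
    by (rule analytic_imp_holomorphic)
  moreover have "((\<lambda>\<tau>. (\<tau> - 0) * f (\<gamma> \<tau>)) \<longlongrightarrow> 0) (at 0)"
    by (rule Lim_transform_eventually[OF filterlim_compose[OF lim fl]])
      (use ev in \<open>eventually_elim, simp\<close>)
  moreover have "0 \<in> interior (ball 0 e)"
    using e by simp
  ultimately obtain H where H: "H holomorphic_on ball 0 e" "\<And>\<tau>. \<tau> \<in> ball 0 e - {0} \<Longrightarrow> H \<tau> = f (\<gamma> \<tau>)"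
    using holomorphic_on_extend_lim[of "\<lambda>\<tau>. f (\<gamma> \<tau>)" "ball 0 e" 0] by blast
  have "isCont H 0"
    using H(1) e by (meson analytic_at analytic_at_imp_isCont centre_in_ball open_ball)
  then have "(H \<longlongrightarrow> H 0) (at 0)"
    by (simp add: isCont_def)
  moreover have "\<forall>\<^sub>F \<tau> in at 0. H \<tau> = f (\<gamma> \<tau>)"
    using H(2) e unfolding eventually_at by (intro exI[of _ e]) (auto simp: dist_commute)
  ultimately have "((\<lambda>\<tau>. f (\<gamma> \<tau>)) \<longlongrightarrow> H 0) (at 0)"
    by (rule Lim_transform_eventually)
  then have "((\<lambda>q. f (\<gamma> (local_coord P q))) \<longlongrightarrow> H 0) (punctured_nhds r s t P)"
    using par by (auto intro: filterlim_compose)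
  then have "(f \<longlongrightarrow> H 0) (punctured_nhds r s t P)"
    by (rule Lim_transform_eventually) (use par in \<open>auto elim: eventually_mono\<close>)
  then show ?thesis by blast
qed

lemma local_inverse:
  fixes F :: "complex \<Rightarrow> complex"
  assumes "F holomorphic_on S" and "open S" and "e \<in> S" and "deriv F e \<noteq> 0"
  obtains g \<rho> \<delta> where "\<rho> > 0" "\<delta> > 0" "ball e \<rho> \<subseteq> S" "g holomorphic_on ball (F e) \<delta>"
    "\<And>v. v \<in> ball (F e) \<delta> \<Longrightarrow> F (g v) = v \<and> g v \<in> ball e \<rho>" "\<And>x. x \<in> ball e \<rho> \<Longrightarrow> g (F x) = x"
proof -
  obtain \<rho> where \<rho>: "\<rho> > 0" "ball e \<rho> \<subseteq> S" "open (F ` ball e \<rho>)" "inj_on F (ball e \<rho>)"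
    using has_complex_derivative_locally_invertible[OF assms(1,3,2,4)] by blast
  have "F holomorphic_on ball e \<rho>"
    using assms(1) \<rho>(2) by (rule holomorphic_on_subset)
  from holomorphic_has_inverse[OF this open_ball \<rho>(4)] obtain g where
    g: "g holomorphic_on F ` ball e \<rho>" "\<And>z. z \<in> ball e \<rho> \<Longrightarrow> g (F z) = z" by metis
  obtain \<delta> where \<delta>: "\<delta> > 0" "ball (F e) \<delta> \<subseteq> F ` ball e \<rho>"
    using \<rho>(1,3) by (metis centre_in_ball image_eqI openE)
  show thesis
  proof (rule that[OF \<rho>(1) \<delta>(1) \<rho>(2)])
    show "g holomorphic_on ball (F e) \<delta>"
      using g(1) \<delta>(2) by (rule holomorphic_on_subset)
    show "F (g v) = v \<and> g v \<in> ball e \<rho>" if v: "v \<in> ball (F e) \<delta>" for v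
    proof -
      obtain x where "x \<in> ball e \<rho>" "v = F x" using v \<delta>(2) by blast
      then show ?thesis using g(2) by simp
    qed
  qed (fact g(2))
qed

text \<open>Near a simple root \<open>e\<close> the polynomial \<open>F\<close> has a local inverse
  \<open>g\<close>, so \<open>y^2 = F(x)\<close> is solved by \<open>x = g(y^2)\<close> and
  \<open>y\<close> is the parameter.\<close>

lemma local_parametrization_finite:
  assumes e: "quintic r s t e = 0" and d: "deriv (quintic r s t) e \<noteq> 0"
  shows "\<exists>\<gamma>. local_parametrization r s t (Some (e, 0)) \<gamma>"
proof -
  let ?F = "quintic r s t"
  have "?F holomorphic_on UNIV"
    using quintic_analytic by (rule analytic_imp_holomorphic)
  from local_inverse[OF this open_UNIV UNIV_I d] obtain g \<rho> \<delta> where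
    pos: "\<rho> > 0" "\<delta> > 0" and hol: "g holomorphic_on ball 0 \<delta>"
    and Fg: "\<And>v. v \<in> ball 0 \<delta> \<Longrightarrow> ?F (g v) = v \<and> g v \<in> ball e \<rho>"
    and gF: "\<And>x. x \<in> ball e \<rho> \<Longrightarrow> g (?F x) = x"
    unfolding e by metis
  have g0: "g 0 = e" using gF[of e] e pos by simp
  define \<gamma> where "\<gamma> \<tau> = (g (\<tau>^2), \<tau>)" for \<tau> :: complex
  have an: "g analytic_on ball 0 \<delta>" using hol by (simp add: analytic_on_open)
  have small: "\<forall>\<^sub>F \<tau>::complex in nhds 0. \<tau>^2 \<in> ball 0 \<delta>"
    by (rule topological_tendstoD[OF tendsto_power[OF filterlim_ident]]) (use pos in auto)
  have ginan: "(\<lambda>\<tau>. g (\<tau>^2)) analytic_on {\<tau>}" if "\<tau>^2 \<in> ball 0 \<delta>" for \<tau>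
  proof -
    have "(g \<circ> (\<lambda>\<tau>. \<tau>^2)) analytic_on {\<tau>}"
      using that by (intro analytic_on_compose analytic_intros) (auto intro: analytic_on_subset[OF an])
    then show ?thesis by (simp add: o_def)
  qed
  have cont: "isCont \<gamma> \<tau>" if "\<tau>^2 \<in> ball 0 \<delta>" for \<tau>
    unfolding \<gamma>_def
    by (intro continuous_intros analytic_at_imp_isCont ginan that)
  have curve: "\<gamma> \<tau> \<in> affine_curve r s t" if "\<tau>^2 \<in> ball 0 \<delta>" for \<tau>
    using Fg[OF that] by (simp add: \<gamma>_def affine_curve_def)
  have near: "\<forall>\<^sub>F q in at (e, 0) within affine_curve r s t. fst q \<in> ball e \<rho> \<and> q \<noteq> (e, 0) \<and> q \<in> affine_curve r s t"
  proof -
    have "\<forall>\<^sub>F q in nhds (e, 0::complex). fst q \<in> ball e \<rho>"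
      by (rule topological_tendstoD[of _ e]) (use pos tendsto_fst[OF filterlim_ident, of "(e, 0::complex)"] in auto)
    then show ?thesis
      unfolding eventually_at_filter by eventually_elim simp
  qed
  have "local_parametrization r s t (Some (e, 0)) \<gamma>"
    unfolding local_parametrization_def
  proof (intro conjI)
    have "\<forall>\<^sub>F \<tau> in at 0. \<gamma> \<tau> \<in> affine_curve r s t - {(e, 0)}"
      using small unfolding eventually_at_filter by eventually_elim (use curve in \<open>auto simp: \<gamma>_def\<close>)
    moreover have "(\<gamma> \<longlongrightarrow> (e, 0)) (at 0)"
      using cont[of 0] pos by (simp add: isCont_def \<gamma>_def g0)
    ultimately show "filterlim \<gamma> (punctured_nhds r s t (Some (e, 0))) (at 0)"
      unfolding punctured_nhds_def option.case by (auto simp: filterlim_at elim: eventually_mono)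
    show "\<forall>\<^sub>F \<tau> in at 0. \<gamma> \<tau> \<in> affine_curve r s t \<and> isCont \<gamma> \<tau> \<and> (\<lambda>\<tau>. fst (\<gamma> \<tau>)) analytic_on {\<tau>}
        \<and> local_coord (Some (e, 0)) (\<gamma> \<tau>) = \<tau>"
      using small unfolding eventually_at_filter
      by eventually_elim (use curve cont ginan in \<open>auto simp: \<gamma>_def\<close>)
    have coord: "local_coord (Some (e, 0)) = snd"
      by (rule ext) (metis local_coord.simps(2) prod.collapse)
    show "filterlim (local_coord (Some (e, 0))) (at 0) (punctured_nhds r s t (Some (e, 0)))"
      unfolding coord punctured_nhds_def option.case
    proof (rule filterlim_atI)
      show "(snd \<longlongrightarrow> 0) (at (e, 0) within affine_curve r s t)"
        using tendsto_snd[OF tendsto_ident_at, of "(e, 0::complex)" "affine_curve r s t"] by simp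
      show "\<forall>\<^sub>F q in at (e, 0) within affine_curve r s t. snd q \<noteq> 0"
        using near
      proof eventually_elim
        case (elim q)
        show ?case
        proof
          assume "snd q = 0"
          then have "?F (fst q) = 0" using elim by (auto simp: affine_curve_def)
          then have "fst q = e" using gF[of "fst q"] elim g0 by simp
          with \<open>snd q = 0\<close> elim show False by (cases q) auto
        qed
      qed
    qed
    show "\<forall>\<^sub>F q in punctured_nhds r s t (Some (e, 0)). \<gamma> (local_coord (Some (e, 0)) q) = q"
      unfolding coord punctured_nhds_def option.case using near
    proof eventually_elim
      case (elim q)
      then have "(snd q)^2 = ?F (fst q)" by (auto simp: affine_curve_def)
      then show ?case using gF[of "fst q"] elim by (simp add: \<gamma>_def)
    qed
  qed
  then show ?thesis by blast
qed

text \<open>For bounded \<open>x\<close> the value \<open>y^2 = F(x)\<close> is bounded by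
  compactness, so a point of the curve cannot escape through \<open>y\<close> alone.\<close>

lemma filterlim_fst_at_infinity_curve:
  "filterlim fst at_infinity (inf at_infinity (principal (affine_curve r s t)))"
  unfolding filterlim_at_infinity[OF order_refl] eventually_inf_principal
proof (intro allI impI)
  fix B :: real assume "B > 0"
  have "continuous_on (cball 0 B) (quintic r s t)"
    using quintic_analytic analytic_imp_holomorphic holomorphic_on_imp_continuous_on by blast
  then have "bounded (quintic r s t ` cball 0 B)"
    using compact_cball compact_continuous_image compact_imp_bounded by blast
  then obtain C where "\<forall>y\<in>quintic r s t ` cball 0 B. norm y \<le> C"
    unfolding bounded_iff by blast
  then have C: "norm (quintic r s t x) \<le> C" if "norm x \<le> B" for x
    using that by simp
  show "\<forall>\<^sub>F q in at_infinity. q \<in> affine_curve r s t \<longrightarrow> B \<le> norm (fst q)"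
    unfolding eventually_at_infinity
  \<comment> \<open>If the norm of \<open>x\<close> is at most \<open>B\<close> and that of
    \<open>F(x)\<close> at most \<open>C\<close>, then the norm of \<open>y\<close> is at most
    \<open>C + 1\<close>, and the point has norm at most \<open>B + C + 1\<close>.\<close>
  proof (intro exI[of _ "B + C + 2"] allI impI)
    fix q :: "complex \<times> complex"
    assume big: "B + C + 2 \<le> norm q" and q: "q \<in> affine_curve r s t"
    show "B \<le> norm (fst q)"
    proof (rule ccontr)
      assume "\<not> ?thesis"
      then have B: "norm (fst q) \<le> B" by simp
      have "(norm (snd q))^2 = norm (quintic r s t (fst q))"
        using q by (auto simp: affine_curve_def norm_power[symmetric])
      also have "\<dots> \<le> C" by (rule C[OF B])
      finally have sq: "(norm (snd q))^2 \<le> C" .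
      have "0 \<le> (norm (snd q) - 1/2)^2" by simp
      then have "norm (snd q) \<le> (norm (snd q))^2 + 1"
        by (simp add: power2_eq_square algebra_simps)
      with sq have "norm (snd q) \<le> C + 1" by simp
      moreover have "norm q \<le> norm (fst q) + norm (snd q)"
        by (metis norm_Pair_le prod.collapse)
      ultimately show False using big B by simp
    qed
  qed
qed

text \<open>With \<open>w = 1/x\<close>, the square of \<open>\<tau> = x\<^sup>2/y\<close> is \<open>w / ((1-w) (1-rw) (1-sw) (1-tw))\<close>, which is invertible near \<open>w = 0\<close>.\<close>

lemma local_parametrization_infinity: "\<exists>\<gamma>. local_parametrization r s t None \<gamma>"
proof -
  define D where "D w = (1-w)*(1-r*w)*(1-s * w)*(1-t*w)" for w
  define F where "F w = w / D w" for w
  define S where "S = {w. D w \<noteq> 0}"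
  have S: "open S"
    unfolding S_def D_def by (intro open_Collect_neq continuous_intros)
  have D: "D analytic_on A" for A
    unfolding D_def[abs_def] by (intro analytic_intros)
  have "F holomorphic_on S"
    unfolding F_def[abs_def] S_def by (intro holomorphic_intros analytic_imp_holomorphic D) auto
  moreover have "(F has_field_derivative 1) (at 0)"
    unfolding F_def[abs_def] D_def[abs_def] by (rule derivative_eq_intros refl | simp)+
  then have "deriv F 0 \<noteq> 0" using DERIV_imp_deriv by fastforce
  moreover have "0 \<in> S" by (simp add: S_def D_def)
  ultimately obtain g \<rho> \<delta> where
    pos: "\<rho> > 0" "\<delta> > 0" and sub: "ball 0 \<rho> \<subseteq> S" and hol: "g holomorphic_on ball (F 0) \<delta>"
    and Fg': "\<And>v. v \<in> ball (F 0) \<delta> \<Longrightarrow> F (g v) = v \<and> g v \<in> ball 0 \<rho>"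
    and gF: "\<And>x. x \<in> ball 0 \<rho> \<Longrightarrow> g (F x) = x"
    using local_inverse[OF _ S] by metis
  have F0: "F 0 = 0" by (simp add: F_def)
  note Fg = Fg'[unfolded F0]
  have quintic_F: "F w * quintic r s t (inverse w) = (inverse w)^4" if "w \<in> S" "w \<noteq> 0" for w
  proof -
    have "inverse w - e = (1 - e * w) * inverse w" for e
      using that(2) by (simp add: field_simps)
    from this[of 1] this[of r] this[of s] this[of t]
    have "quintic r s t (inverse w) = D w * (inverse w)^5"
      unfolding quintic_def D_def by (simp add: power_numeral_reduce)
    then show ?thesis
      using that by (simp add: F_def S_def power_numeral_reduce)
  qed
  have g0: "g 0 = 0" using gF[of 0] F0 pos by simp
  have gnz: "g v \<noteq> 0" if "v \<in> ball 0 \<delta>" "v \<noteq> 0" for v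
    using Fg[OF that(1)] that(2) F0 by auto
  define \<gamma> where "\<gamma> \<tau> = (inverse (g (\<tau>^2)), (inverse (g (\<tau>^2)))^2 / \<tau>)" for \<tau> :: complex
  have an: "g analytic_on ball 0 \<delta>" using hol by (simp add: analytic_on_open F0)
  have small: "\<forall>\<^sub>F \<tau>::complex in nhds 0. \<tau>^2 \<in> ball 0 \<delta>"
    by (rule topological_tendstoD[OF tendsto_power[OF filterlim_ident]]) (use pos in auto)
  have ginan: "(\<lambda>\<tau>. g (\<tau>^2)) analytic_on {\<tau>}" if "\<tau>^2 \<in> ball 0 \<delta>" for \<tau>
  proof -
    have "(g \<circ> (\<lambda>\<tau>. \<tau>^2)) analytic_on {\<tau>}"
      using that by (intro analytic_on_compose analytic_intros) (auto intro: analytic_on_subset[OF an])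
    then show ?thesis by (simp add: o_def)
  qed
  have ginan': "(\<lambda>\<tau>. inverse (g (\<tau>^2))) analytic_on {\<tau>}" if "\<tau>^2 \<in> ball 0 \<delta>" "\<tau> \<noteq> 0" for \<tau>
    using gnz[of "\<tau>^2"] that by (intro analytic_on_inverse ginan) auto
  have cont: "isCont \<gamma> \<tau>" if "\<tau>^2 \<in> ball 0 \<delta>" "\<tau> \<noteq> 0" for \<tau>
    unfolding \<gamma>_def
    by (intro continuous_intros analytic_at_imp_isCont ginan' that)
  have curve: "\<gamma> \<tau> \<in> affine_curve r s t" if \<tau>: "\<tau>^2 \<in> ball 0 \<delta>" "\<tau> \<noteq> 0" for \<tau>
  proof -
    have "\<tau>^2 * quintic r s t (inverse (g (\<tau>^2))) = (inverse (g (\<tau>^2)))^4"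
      using quintic_F[of "g (\<tau>^2)"] Fg[OF \<tau>(1)] gnz[OF \<tau>(1)] \<tau>(2) sub by auto
    then show ?thesis
      using \<tau>(2) by (simp add: \<gamma>_def affine_curve_def power_divide nonzero_divide_eq_eq mult.commute flip: power_mult)
  qed
  have x_inf: "filterlim fst at_infinity (punctured_nhds r s t None)"
    unfolding punctured_nhds_def option.case by (rule filterlim_fst_at_infinity_curve)
  have on_curve: "\<forall>\<^sub>F q in punctured_nhds r s t None. q \<in> affine_curve r s t"
    unfolding punctured_nhds_def option.case by (simp add: eventually_inf_principal)
  have near: "\<forall>\<^sub>F q in punctured_nhds r s t None. inverse (fst q) \<in> ball 0 \<rho> \<and> fst q \<noteq> 0 \<and> q \<in> affine_curve r s t"
  proof -
    have "((\<lambda>q. inverse (fst q)) \<longlongrightarrow> 0) (punctured_nhds r s t None)"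
      using x_inf tendsto_inverse_0 filterlim_compose by blast
    then have "\<forall>\<^sub>F q in punctured_nhds r s t None. inverse (fst q) \<in> ball 0 \<rho>"
      by (rule topological_tendstoD) (use pos in auto)
    moreover have "\<forall>\<^sub>F q in punctured_nhds r s t None. fst q \<noteq> 0"
      using x_inf by (rule filterlim_at_infinity_imp_eventually_ne)
    ultimately show ?thesis using on_curve by eventually_elim simp
  qed
  have coord: "local_coord None q = (fst q)^2 / snd q" for q
    by (cases q) simp
  have sq: "snd q \<noteq> 0 \<and> (local_coord None q)^2 = F (inverse (fst q))"
    if q: "inverse (fst q) \<in> ball 0 \<rho>" "fst q \<noteq> 0" "q \<in> affine_curve r s t" for q
  proof -
    have "F (inverse (fst q)) * (snd q)^2 = (fst q)^4"
      using quintic_F[of "inverse (fst q)"] q sub by (auto simp: affine_curve_def)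
    then show ?thesis using q(2)
      by (auto simp: coord power_divide divide_eq_eq simp flip: power_mult)
  qed
  have "local_parametrization r s t None \<gamma>"
    unfolding local_parametrization_def
  proof (intro conjI)
    show "filterlim \<gamma> (punctured_nhds r s t None) (at 0)"
      unfolding punctured_nhds_def option.case filterlim_inf filterlim_principal
    proof
      show "\<forall>\<^sub>F \<tau> in at 0. \<gamma> \<tau> \<in> affine_curve r s t"
        using small unfolding eventually_at_filter by eventually_elim (use curve in auto)
      have "filterlim (\<lambda>\<tau>. g (\<tau>^2)) (at 0) (at 0)"
      proof (rule filterlim_atI)
        show "((\<lambda>\<tau>. g (\<tau>^2)) \<longlongrightarrow> 0) (at 0)"
          using analytic_at_imp_isCont[OF ginan[of 0]] pos g0 by (simp add: isCont_def)
        show "\<forall>\<^sub>F \<tau> in at 0. g (\<tau>^2) \<noteq> 0"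
          using small unfolding eventually_at_filter by eventually_elim (use gnz in auto)
      qed
      then have "filterlim (\<lambda>\<tau>. inverse (g (\<tau>^2))) at_infinity (at 0)"
        by (rule filterlim_compose[OF filterlim_inverse_at_infinity])
      then have "filterlim (\<lambda>\<tau>. norm (inverse (g (\<tau>^2)))) at_top (at 0)"
        by (rule filterlim_compose[OF filterlim_norm_at_top])
      then have "filterlim (\<lambda>\<tau>. norm (\<gamma> \<tau>)) at_top (at 0)"
        by (rule filterlim_at_top_mono) (auto simp: \<gamma>_def norm_fst_le intro!: always_eventually order_trans[OF _ norm_fst_le])
      then show "filterlim \<gamma> at_infinity (at 0)"
        by (rule filterlim_norm_at_top_imp_at_infinity)
    qed
    show "\<forall>\<^sub>F \<tau> in at 0. \<gamma> \<tau> \<in> affine_curve r s t \<and> isCont \<gamma> \<tau> \<and> (\<lambda>\<tau>. fst (\<gamma> \<tau>)) analytic_on {\<tau>}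
        \<and> local_coord None (\<gamma> \<tau>) = \<tau>"
      using small unfolding eventually_at_filter
    proof eventually_elim
      case (elim \<tau>)
      then show ?case
        using curve cont ginan'[of \<tau>] gnz[of "\<tau>^2"] by (auto simp: coord \<gamma>_def)
    qed
    show "filterlim (local_coord None) (at 0) (punctured_nhds r s t None)"
    proof (rule filterlim_atI)
      have "(F \<longlongrightarrow> F 0) (at 0)"
        using \<open>(F has_field_derivative 1) (at 0)\<close> DERIV_isCont isCont_def by blast
      then have "(F \<longlongrightarrow> 0) (nhds 0)"
        using tendsto_at_iff_tendsto_nhds[of F 0] F0 by simp
      then have "((\<lambda>q. F (inverse (fst q))) \<longlongrightarrow> 0) (punctured_nhds r s t None)"
        using x_inf tendsto_inverse_0 filterlim_compose by blast
      then have "((\<lambda>q. (local_coord None q)^2) \<longlongrightarrow> 0) (punctured_nhds r s t None)"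
        by (rule Lim_transform_eventually) (use near sq in \<open>auto elim!: eventually_mono\<close>)
      \<comment> \<open>Only the square of the coordinate is a function of \<open>x\<close>, so its
        convergence to \<open>0\<close> is passed on through the norm.\<close>
      then have "((\<lambda>q. sqrt (norm ((local_coord None q)^2))) \<longlongrightarrow> sqrt (norm (0::complex))) (punctured_nhds r s t None)"
        by (intro tendsto_intros)
      then show "(local_coord None \<longlongrightarrow> 0) (punctured_nhds r s t None)"
        by (simp add: norm_power tendsto_norm_zero_iff)
      show "\<forall>\<^sub>F q in punctured_nhds r s t None. local_coord None q \<noteq> 0"
        using near by eventually_elim (use sq in \<open>auto simp: coord\<close>)
    qed
    show "\<forall>\<^sub>F q in punctured_nhds r s t None. \<gamma> (local_coord None q) = q"
      using near
    proof eventually_elim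
      case (elim q)
      then have "g ((local_coord None q)^2) = inverse (fst q)" "snd q \<noteq> 0"
        using sq gF by auto
      then show ?case
        using elim by (cases q) (simp add: \<gamma>_def)
    qed
  qed
  then show ?thesis by blast
qed

section \<open>Holomorphy of the Higgs field\<close>

lemma theta_entry_analytic:
  assumes "x \<notin> {0, 1, r, s, t}"
  shows "(\<lambda>x. theta r s t p c (x, y) $ i $ j) analytic_on {x}"
  unfolding theta_def theta_basis_def scale_mat_def vector_add_component vec_lambda_beta fst_conv
  using assms by (intro analytic_intros) auto

lemma holomorphic_at_theta_mult:
  assumes "fst q \<notin> {0, 1, r, s, t}" and "\<forall>i. holomorphic_at r s t (\<lambda>q. z q $ i) q"
  shows "holomorphic_at r s t (\<lambda>q. (theta r s t p c q *v z q) $ i) q"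
proof -
  have "holomorphic_at r s t (\<lambda>q. theta r s t p c q $ i $ j) q" for j
    using holomorphic_at_analytic[OF theta_entry_analytic[OF assms(1), of p c 0 i j]]
    by (simp add: theta_def)
  then show ?thesis
    unfolding matrix_vector_mult_def vec_lambda_beta sum_2
    by (intro holomorphic_at_add holomorphic_at_mult) (use assms(2) in auto)
qed

lemma off_branch_points:
  assumes "q \<in> affine_curve r s t" and "snd q \<noteq> 0"
  shows "fst q \<notin> {0, 1, r, s, t}"
  using assms by (auto simp: affine_curve_def quintic_def)

text \<open>
  \<open>y\<^sup>2/(x - e)\<close> tends to \<open>F'(e)\<close>, and \<open>h z\<close> has a limit because \<open>h\<close> annihilates the polar part of \<open>z\<close>.
\<close>

lemma pole_limit_finite:
  fixes z :: "complex \<times> complex \<Rightarrow> complex^2" and h :: "complex^2 \<Rightarrow> complex"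
  assumes e: "quintic r s t e = 0" and d: "deriv (quintic r s t) e \<noteq> 0"
    and A: "\<And>q. A q = scale_mat (k / (fst q - e)) N + B (fst q)"
    and B: "\<And>i j. isCont (\<lambda>x. B x $ i $ j) e"
    and N: "\<And>v. N *v v = h v *s l" and h: "\<And>v. h v = \<mu> * v $ 1 + \<nu> * v $ 2" and hl: "h l = 0"
    and hol: "\<forall>\<^sub>F q in punctured_nhds r s t (Some (e, 0)). \<forall>i. holomorphic_at r s t (\<lambda>q. z q $ i) q"
    and lim: "((\<lambda>q. snd q *s z q) \<longlongrightarrow> \<kappa> *s l) (punctured_nhds r s t (Some (e, 0)))"
  shows "\<exists>\<kappa>'. ((\<lambda>q. snd q *s (snd q *s (A q *v z q))) \<longlongrightarrow> \<kappa>' *s l) (punctured_nhds r s t (Some (e, 0)))"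
proof -
  define \<F> where "\<F> = punctured_nhds r s t (Some (e, 0))"
  note [folded \<F>_def] = hol lim
  note hol = this(1) and lim = this(2)
  obtain \<gamma> where par: "local_parametrization r s t (Some (e, 0)) \<gamma>"
    using local_parametrization_finite[OF e d] by blast
  have coord: "local_coord (Some (e, 0)) = snd"
    by (rule ext) (metis local_coord.simps(2) prod.collapse)
  have snd0: "(snd \<longlongrightarrow> 0) \<F>"
    using par unfolding local_parametrization_def \<F>_def coord filterlim_at by simp
  have fst_e: "(fst \<longlongrightarrow> e) \<F>"
    using tendsto_fst[OF tendsto_ident_at, of "(e, 0::complex)" "affine_curve r s t"]
    by (simp add: \<F>_def punctured_nhds_def)
  have curve: "\<forall>\<^sub>F q in \<F>. q \<in> affine_curve r s t \<and> q \<noteq> (e, 0)"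
    unfolding \<F>_def punctured_nhds_def by (simp add: eventually_at_filter)
  have comp: "((\<lambda>q. snd q * z q $ i) \<longlongrightarrow> \<kappa> * l $ i) \<F>" for i
    using tendsto_vec_nth[OF lim, of i] by simp
  have "\<exists>m. ((\<lambda>q. h (z q)) \<longlongrightarrow> m) (punctured_nhds r s t (Some (e, 0)))"
  proof (rule removable_singularity_weierstrass[OF par])
    show "\<forall>\<^sub>F q in punctured_nhds r s t (Some (e, 0)). holomorphic_at r s t (\<lambda>q. h (z q)) q"
      unfolding \<F>_def[symmetric] h using hol
    proof eventually_elim
      case (elim q)
      have "holomorphic_at r s t (\<lambda>q. \<mu>) q" "holomorphic_at r s t (\<lambda>q. \<nu>) q"
        using holomorphic_at_analytic[of "\<lambda>_. _" q] by simp_all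
      with elim show ?case by (intro holomorphic_at_add holomorphic_at_mult) auto
    qed
    have "((\<lambda>q. \<mu> * (snd q * z q $ 1) + \<nu> * (snd q * z q $ 2)) \<longlongrightarrow> \<mu> * (\<kappa> * l $ 1) + \<nu> * (\<kappa> * l $ 2)) \<F>"
      by (intro tendsto_intros comp)
    moreover have "\<mu> * (\<kappa> * l $ 1) + \<nu> * (\<kappa> * l $ 2) = \<kappa> * h l"
      by (simp add: h algebra_simps)
    ultimately show "((\<lambda>q. local_coord (Some (e, 0)) q * h (z q)) \<longlongrightarrow> 0) (punctured_nhds r s t (Some (e, 0)))"
      unfolding coord \<F>_def[symmetric] h using hl[unfolded h] by (simp add: algebra_simps h)
  qed
  then obtain m where m: "((\<lambda>q. h (z q)) \<longlongrightarrow> m) \<F>"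
    unfolding \<F>_def by blast
  have "(quintic r s t has_field_derivative deriv (quintic r s t) e) (at e)"
    by (metis DERIV_deriv_iff_field_differentiable UNIV_I analytic_on_imp_differentiable_at quintic_analytic)
  then have "((\<lambda>x. quintic r s t x / (x - e)) \<longlongrightarrow> deriv (quintic r s t) e) (at e)"
    by (simp add: has_field_derivative_iff e)
  moreover have "filterlim fst (at e) \<F>"
  proof (rule filterlim_atI[OF fst_e])
    show "\<forall>\<^sub>F q in \<F>. fst q \<noteq> e"
      using curve by eventually_elim (use e in \<open>auto simp: affine_curve_def\<close>)
  qed
  ultimately have "((\<lambda>q. quintic r s t (fst q) / (fst q - e)) \<longlongrightarrow> deriv (quintic r s t) e) \<F>"
    by (rule filterlim_compose)
  then have ratio: "((\<lambda>q. (snd q)^2 / (fst q - e)) \<longlongrightarrow> deriv (quintic r s t) e) \<F>"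
    by (rule Lim_transform_eventually) (use curve in \<open>eventually_elim, auto simp: affine_curve_def\<close>)
  have B': "((\<lambda>q. B (fst q) $ i $ j) \<longlongrightarrow> B e $ i $ j) \<F>" for i j
    using B[of i j] fst_e by (rule isCont_tendsto_compose)
  have "((\<lambda>q. (snd q)^2 / (fst q - e) * k * h (z q) * l $ i
      + snd q * (B (fst q) $ i $ 1 * (snd q * z q $ 1) + B (fst q) $ i $ 2 * (snd q * z q $ 2)))
    \<longlongrightarrow> deriv (quintic r s t) e * k * m * l $ i
      + 0 * (B e $ i $ 1 * (\<kappa> * l $ 1) + B e $ i $ 2 * (\<kappa> * l $ 2))) \<F>" for i
    by (intro tendsto_intros ratio m snd0 B' comp)
  moreover have "(snd q *s (snd q *s (A q *v z q))) $ i = (snd q)^2 / (fst q - e) * k * h (z q) * l $ i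
      + snd q * (B (fst q) $ i $ 1 * (snd q * z q $ 1) + B (fst q) $ i $ 2 * (snd q * z q $ 2))" for q i
  proof -
    have "scale_mat (k / (fst q - e)) N *v z q = (k / (fst q - e)) *s (h (z q) *s l)"
      unfolding N[symmetric] by (simp add: vec_eq_iff matrix_vector_mult_def scale_mat_def sum_distrib_left mult.assoc)
    then have "A q *v z q = (k / (fst q - e)) *s (h (z q) *s l) + B (fst q) *v z q"
      by (simp add: A matrix_vector_mult_add_rdistrib)
    then show ?thesis
      by (simp add: matrix_vector_mult_def sum_2 power2_eq_square algebra_simps)
  qed
  ultimately have "((\<lambda>q. (snd q *s (snd q *s (A q *v z q))) $ i)
      \<longlongrightarrow> ((deriv (quintic r s t) e * k * m) *s l) $ i) \<F>" for i
    by simp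
  then have "((\<lambda>q. snd q *s (snd q *s (A q *v z q))) \<longlongrightarrow> (deriv (quintic r s t) e * k * m) *s l) \<F>"
    by (rule vec_tendstoI)
  then show ?thesis unfolding \<F>_def by blast
qed

lemma tendsto_ratio_at_infinity: "((\<lambda>x::complex. x / (x - e)) \<longlongrightarrow> 1) at_infinity"
proof -
  have "((\<lambda>x. 1 / (1 - e * inverse x)) \<longlongrightarrow> 1 / (1 - e * 0)) at_infinity"
    by (intro tendsto_intros tendsto_inverse_0) simp
  moreover have "\<forall>\<^sub>F x::complex in at_infinity. x \<noteq> 0"
    by (rule filterlim_at_infinity_imp_eventually_ne) (rule filterlim_ident)
  then have "\<forall>\<^sub>F x in at_infinity. 1 / (1 - e * inverse x) = x / (x - e)"
  proof eventually_elim
    case (elim x)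
    then have "x - e = (1 - e * inverse x) * x" by (simp add: left_diff_distrib)
    with elim show ?case by simp
  qed
  ultimately have "((\<lambda>x. x / (x - e)) \<longlongrightarrow> 1 / (1 - e * 0)) at_infinity"
    by (rule Lim_transform_eventually)
  then show ?thesis by simp
qed

text \<open>In this form the diagonal and lower left entries are combinations of differences of
  simple poles, hence of order \<open>x^-2\<close> at infinity, while the upper right entry is only
  of order \<open>1/x\<close>.\<close>

lemma theta_basis_entries:
  "theta_basis i Z x $ 1 $ 1 = Z * (1/(x-1) - 1/(x-i))"
  "theta_basis i Z x $ 1 $ 2 = - Z * (1/(x-1)) + Z^2 * (1/(x-i))"
  "theta_basis i Z x $ 2 $ 1 = (1-Z) * (1/(x-0) - 1/(x-i)) + Z * (1/(x-1) - 1/(x-i))"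
  "theta_basis i Z x $ 2 $ 2 = - (Z * (1/(x-1) - 1/(x-i)))"
  by (simp_all add: theta_basis_def scale_mat_def mat2_def right_diff_distrib left_diff_distrib diff_divide_distrib)

lemma theta_at_infinity:
  fixes r s t :: complex and p c :: "complex^3"
  defines "A \<equiv> \<lambda>x. theta r s t p c (x, 0)"
  shows "\<exists>\<alpha>. ((\<lambda>x. x^2 * A x $ 1 $ 1) \<longlongrightarrow> \<alpha>) at_infinity"
    and "\<exists>\<beta>. ((\<lambda>x. x * A x $ 1 $ 2) \<longlongrightarrow> \<beta>) at_infinity"
    and "\<exists>\<gamma>. ((\<lambda>x. x^2 * A x $ 2 $ 1) \<longlongrightarrow> \<gamma>) at_infinity"
    and "A x $ 2 $ 2 = - A x $ 1 $ 1"
proof -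
  define R S T where "R = p $ 1" and "S = p $ 2" and "T = p $ 3"
  define cr cs ct where "cr = c $ 1" and "cs = c $ 2" and "ct = c $ 3"
  note defs = R_def S_def T_def cr_def cs_def ct_def
  define \<rho> where "\<rho> e x = x / (x - e)" for e x :: complex
  have \<rho>: "(\<rho> e \<longlongrightarrow> 1) at_infinity" for e
    using tendsto_ratio_at_infinity by (simp add: \<rho>_def[abs_def])
  have "\<forall>\<^sub>F x::complex in at_infinity. norm x > Max (norm ` {0, 1, r, s, t})"
    by (rule filterlim_at_infinity_imp_norm_at_top[OF filterlim_ident, THEN filterlim_at_top_dense[THEN iffD1], rule_format])
  then have ev: "\<forall>\<^sub>F x in at_infinity. x \<notin> {0, 1, r, s, t}"
    by eventually_elim auto
  have diff: "x^2 * (1 / (x - e) - 1 / (x - e')) = (e - e') * \<rho> e x * \<rho> e' x"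
    if "x - e \<noteq> 0" "x - e' \<noteq> 0" for x e e'
    using that by (simp add: \<rho>_def field_simps power2_eq_square)
  have A: "A x $ i $ j = cr * theta_basis r R x $ i $ j + cs * theta_basis s S x $ i $ j + ct * theta_basis t T x $ i $ j" for x i j
    by (simp add: A_def theta_def scale_mat_def defs)
  show "A x $ 2 $ 2 = - A x $ 1 $ 1" unfolding A theta_basis_entries by simp
  have "((\<lambda>x. cr*(R*((1-r)*\<rho> 1 x*\<rho> r x)) + cs*(S*((1-s)*\<rho> 1 x*\<rho> s x)) + ct*(T*((1-t)*\<rho> 1 x*\<rho> t x)))
      \<longlongrightarrow> cr*(R*((1-r)*1*1)) + cs*(S*((1-s)*1*1)) + ct*(T*((1-t)*1*1))) at_infinity"
    by (intro tendsto_intros \<rho>)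
  moreover have "\<forall>\<^sub>F x in at_infinity. cr*(R*((1-r)*\<rho> 1 x*\<rho> r x)) + cs*(S*((1-s)*\<rho> 1 x*\<rho> s x))
      + ct*(T*((1-t)*\<rho> 1 x*\<rho> t x)) = x^2 * A x $ 1 $ 1"
    using ev
  proof eventually_elim
    case (elim x)
    then have nz: "x - 1 \<noteq> 0" "x - r \<noteq> 0" "x - s \<noteq> 0" "x - t \<noteq> 0" by auto
    show ?case unfolding A theta_basis_entries diff[OF nz(1,2), symmetric] diff[OF nz(1,3), symmetric] diff[OF nz(1,4), symmetric]
      by (simp only: distrib_left mult_ac)
  qed
  ultimately show "\<exists>\<alpha>. ((\<lambda>x. x^2 * A x $ 1 $ 1) \<longlongrightarrow> \<alpha>) at_infinity"
    by (intro exI) (rule Lim_transform_eventually)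
  have "((\<lambda>x. - (cr*R + cs*S + ct*T)*\<rho> 1 x + cr*R^2*\<rho> r x + cs*S^2*\<rho> s x + ct*T^2*\<rho> t x)
      \<longlongrightarrow> - (cr*R + cs*S + ct*T)*1 + cr*R^2*1 + cs*S^2*1 + ct*T^2*1) at_infinity"
    (is "(_ \<longlongrightarrow> ?\<beta>) _")
    by (intro tendsto_intros \<rho>)
  moreover have "x * A x $ 1 $ 2 = - (cr*R + cs*S + ct*T)*\<rho> 1 x + cr*R^2*\<rho> r x + cs*S^2*\<rho> s x + ct*T^2*\<rho> t x" for x
    unfolding A theta_basis_entries \<rho>_def by (simp add: algebra_simps)
  ultimately show "\<exists>\<beta>. ((\<lambda>x. x * A x $ 1 $ 2) \<longlongrightarrow> \<beta>) at_infinity"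
    by (intro exI[of _ ?\<beta>]) simp
  have "((\<lambda>x. cr*((1-R)*((0-r)*\<rho> 0 x*\<rho> r x) + R*((1-r)*\<rho> 1 x*\<rho> r x))
      + cs*((1-S)*((0-s)*\<rho> 0 x*\<rho> s x) + S*((1-s)*\<rho> 1 x*\<rho> s x))
      + ct*((1-T)*((0-t)*\<rho> 0 x*\<rho> t x) + T*((1-t)*\<rho> 1 x*\<rho> t x)))
     \<longlongrightarrow> cr*((1-R)*((0-r)*1*1) + R*((1-r)*1*1)) + cs*((1-S)*((0-s)*1*1) + S*((1-s)*1*1))
      + ct*((1-T)*((0-t)*1*1) + T*((1-t)*1*1))) at_infinity"
    by (intro tendsto_intros \<rho>)
  moreover have "\<forall>\<^sub>F x in at_infinity. cr*((1-R)*((0-r)*\<rho> 0 x*\<rho> r x) + R*((1-r)*\<rho> 1 x*\<rho> r x))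
      + cs*((1-S)*((0-s)*\<rho> 0 x*\<rho> s x) + S*((1-s)*\<rho> 1 x*\<rho> s x))
      + ct*((1-T)*((0-t)*\<rho> 0 x*\<rho> t x) + T*((1-t)*\<rho> 1 x*\<rho> t x)) = x^2 * A x $ 2 $ 1"
    using ev
  proof eventually_elim
    case (elim x)
    then have nz: "x - 0 \<noteq> 0" "x - 1 \<noteq> 0" "x - r \<noteq> 0" "x - s \<noteq> 0" "x - t \<noteq> 0" by auto
    show ?case unfolding A theta_basis_entries
        diff[OF nz(1,3), symmetric] diff[OF nz(1,4), symmetric] diff[OF nz(1,5), symmetric]
        diff[OF nz(2,3), symmetric] diff[OF nz(2,4), symmetric] diff[OF nz(2,5), symmetric]
      by (simp only: distrib_left mult_ac)
  qed
  ultimately show "\<exists>\<gamma>. ((\<lambda>x. x^2 * A x $ 2 $ 1) \<longlongrightarrow> \<gamma>) at_infinity"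
    by (intro exI) (rule Lim_transform_eventually)
qed

lemma eventually_punctured_nhds:
  assumes "local_parametrization r s t P \<gamma>"
  shows "\<forall>\<^sub>F q in punctured_nhds r s t P. q \<in> affine_curve r s t \<and> snd q \<noteq> 0"
proof -
  have curve: "\<forall>\<^sub>F q in punctured_nhds r s t P. q \<in> affine_curve r s t"
    by (cases P) (simp_all add: punctured_nhds_def eventually_inf_principal eventually_at_filter)
  have "\<forall>\<^sub>F q in punctured_nhds r s t P. local_coord P q \<noteq> 0"
    using assms unfolding local_parametrization_def filterlim_at by simp
  with curve show ?thesis
  proof eventually_elim
    case (elim q)
    then show ?case by (cases P; cases q) auto
  qed
qed

lemma local_coord_Some: "local_coord (Some w) q = snd q"
  by (cases q) simp

lemma frame_coords_Some: "frame_coords (Some w) q z = z"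
  by (cases q) simp

text \<open>One form for all five finite branch points, with \<open>h = 0, 1, R, S, T\<close>:
  \<open>N\<close> is the residue up to the factor \<open>k\<close>, \<open>l\<close> spans its
  image and its kernel, and \<open>B\<close> collects the other poles.\<close>

lemma E_Omega_germ_finite:
  assumes e: "quintic r s t e = 0" and d: "deriv (quintic r s t) e \<noteq> 0"
    and A: "\<And>q. theta r s t p c q = scale_mat (k / (fst q - e)) (N :: complex^2^2) + B (fst q)"
    and B: "\<And>i j. isCont (\<lambda>x. B x $ i $ j) e"
    and l: "parabolic r s t p (Some e) = l"
    and N: "\<And>v. N *v v = (v $ 1 - h * v $ 2) *s l" and hl: "l $ 1 = h * l $ 2"
    and z: "E_germ r s t p (Some (e, 0)) z"
  shows "E_Omega_germ r s t p (Some (e, 0)) (\<lambda>q. theta r s t p c q *v z q)"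
proof -
  let ?\<F> = "punctured_nhds r s t (Some (e, 0))"
  have dx: "dx_coeff (Some (e, 0)) q = snd q" for q :: "complex \<times> complex"
    by (cases q) simp
  obtain \<gamma> where par: "local_parametrization r s t (Some (e, 0)) \<gamma>"
    using local_parametrization_finite[OF e d] by blast
  from z obtain \<kappa> where hol: "\<forall>\<^sub>F q in ?\<F>. \<forall>i. holomorphic_at r s t (\<lambda>q. z q $ i) q"
    and lim: "((\<lambda>q. snd q *s z q) \<longlongrightarrow> \<kappa> *s l) ?\<F>"
    unfolding E_germ_def local_coord_Some frame_coords_Some by (simp add: l) blast
  have "\<forall>\<^sub>F q in ?\<F>. \<forall>i. holomorphic_at r s t (\<lambda>q. (snd q *s (theta r s t p c q *v z q)) $ i) q"
    using hol eventually_punctured_nhds[OF par]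
  proof eventually_elim
    case (elim q)
    then show ?case
      unfolding vector_smult_component
      using off_branch_points[of q r s t] by (intro allI holomorphic_at_mult holomorphic_at_snd holomorphic_at_theta_mult) blast+
  qed
  moreover have "\<exists>\<kappa>'. ((\<lambda>q. snd q *s (snd q *s (theta r s t p c q *v z q))) \<longlongrightarrow> \<kappa>' *s l) ?\<F>"
    by (rule pole_limit_finite[where A = "theta r s t p c" and B = B and N = N and k = k and l = l
          and h = "\<lambda>v. v $ 1 - h * v $ 2" and \<mu> = 1 and \<nu> = "- h" and e = e and z = z and \<kappa> = \<kappa>])
      (use e d A B N hol lim in \<open>simp_all add: hl\<close>)
  ultimately show ?thesis
    by (simp add: E_Omega_germ_def E_germ_def local_coord_Some frame_coords_Some l dx)
qed

text \<open>Passing to the frame at infinity multiplies the upper right entry by \<open>1/x\<close>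
  and the lower left one by \<open>x\<close>. All entries then have order \<open>x^-2\<close>, which
  is holomorphic against \<open>dx\<close>, except the lower left one of order \<open>1/x\<close>: a
  simple pole whose residue is nilpotent with image and kernel the parabolic line.\<close>

lemma E_Omega_germ_infinity:
  assumes z: "E_germ r s t p None z"
  shows "E_Omega_germ r s t p None (\<lambda>q. theta r s t p c q *v z q)"
proof -
  define \<F> where "\<F> = punctured_nhds r s t None"
  define A where "A x = theta r s t p c (x, 0)" for x
  have theta: "theta r s t p c q = A (fst q)" for q
    by (simp add: A_def theta_def)
  obtain \<alpha> \<beta> \<gamma>' where limA: "((\<lambda>x. x^2 * A x $ 1 $ 1) \<longlongrightarrow> \<alpha>) at_infinity"
      "((\<lambda>x. x * A x $ 1 $ 2) \<longlongrightarrow> \<beta>) at_infinity" "((\<lambda>x. x^2 * A x $ 2 $ 1) \<longlongrightarrow> \<gamma>') at_infinity"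
    and A22: "\<And>x. A x $ 2 $ 2 = - A x $ 1 $ 1"
    using theta_at_infinity[of r s t p c] unfolding A_def by blast
  define \<tau> where "\<tau> q = (fst q)^2 / snd q" for q :: "complex \<times> complex"
  have coord: "local_coord None q = \<tau> q" and dx: "dx_coeff None q = (fst q)^4 / snd q"
    and frame: "frame_coords None q v = vector [fst q * v $ 1, (fst q)^2 * v $ 2]" for q v
    by (cases q; simp add: \<tau>_def)+
  have par': "parabolic r s t p (map_option fst None) = vector [0, 1]"
    by (simp add: parabolic_def)
  obtain \<gamma> where par: "local_parametrization r s t None \<gamma>"
    using local_parametrization_infinity by blast
  have curve: "\<forall>\<^sub>F q in \<F>. q \<in> affine_curve r s t \<and> snd q \<noteq> 0"
    unfolding \<F>_def by (rule eventually_punctured_nhds[OF par])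
  have x: "filterlim fst at_infinity \<F>"
    unfolding \<F>_def punctured_nhds_def option.case by (rule filterlim_fst_at_infinity_curve)
  have \<tau>: "(\<tau> \<longlongrightarrow> 0) \<F>"
    using par unfolding local_parametrization_def filterlim_at \<F>_def coord[abs_def] by simp
  note limA = limA[THEN filterlim_compose, OF x]
  from z obtain \<kappa> where hol: "\<forall>\<^sub>F q in \<F>. \<forall>i. holomorphic_at r s t (\<lambda>q. z q $ i) q"
    and lim: "((\<lambda>q. \<tau> q *s (vector [fst q * z q $ 1, (fst q)^2 * z q $ 2] :: complex^2)) \<longlongrightarrow> \<kappa> *s vector [0, 1]) \<F>"
    unfolding E_germ_def coord frame par' \<F>_def by (simp only: weierstrass.simps if_True) blast
  have z1: "((\<lambda>q. \<tau> q * (fst q * z q $ 1)) \<longlongrightarrow> 0) \<F>" and z2: "((\<lambda>q. \<tau> q * ((fst q)^2 * z q $ 2)) \<longlongrightarrow> \<kappa>) \<F>"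
    using tendsto_vec_nth[OF lim, of 1] tendsto_vec_nth[OF lim, of 2] by simp_all
  have "\<exists>m. ((\<lambda>q. fst q * z q $ 1) \<longlongrightarrow> m) (punctured_nhds r s t None)"
  proof (rule removable_singularity_weierstrass[OF par])
    show "\<forall>\<^sub>F q in punctured_nhds r s t None. holomorphic_at r s t (\<lambda>q. fst q * z q $ 1) q"
      using hol unfolding \<F>_def
      by eventually_elim (intro holomorphic_at_mult holomorphic_at_analytic, auto)
  qed (use z1 in \<open>simp add: coord \<F>_def\<close>)
  then obtain m where m: "((\<lambda>q. fst q * z q $ 1) \<longlongrightarrow> m) \<F>"
    unfolding \<F>_def by blast
  \<comment> \<open>The product equals \<open>x^5/F(x)\<close>, which on the curve is
    \<open>x\<close> times the square of the local coordinate.\<close>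
  have "((\<lambda>x. (x / (x - 1)) * (x / (x - r)) * (x / (x - s)) * (x / (x - t))) \<longlongrightarrow> 1 * 1 * 1 * 1) at_infinity"
    by (intro tendsto_mult tendsto_ratio_at_infinity)
  then have "((\<lambda>q. (fst q / (fst q - 1)) * (fst q / (fst q - r)) * (fst q / (fst q - s)) * (fst q / (fst q - t))) \<longlongrightarrow> 1) \<F>"
    using filterlim_compose[OF _ x] by simp
  then have x\<tau>: "((\<lambda>q. fst q * (\<tau> q)^2) \<longlongrightarrow> 1) \<F>"
  proof (rule Lim_transform_eventually)
    show "\<forall>\<^sub>F q in \<F>. fst q / (fst q - 1) * (fst q / (fst q - r)) * (fst q / (fst q - s)) * (fst q / (fst q - t))
        = fst q * (\<tau> q)^2"
      using curve
    proof eventually_elim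
      case (elim q)
      then have "(\<tau> q)^2 = (fst q)^4 / quintic r s t (fst q)" "fst q \<noteq> 0"
        by (auto simp: \<tau>_def power_divide affine_curve_def quintic_def simp flip: power_mult)
      then show ?case by (simp add: quintic_def power4_eq_xxxx mult.assoc)
    qed
  qed
  let ?y = "\<lambda>q. ((fst q)^4 / snd q) *s (theta r s t p c q *v z q)"
  have power4: "(\<lambda>x::complex. x^4) analytic_on A" for A
    by (intro analytic_intros)
  have "\<forall>\<^sub>F q in \<F>. \<forall>i. holomorphic_at r s t (\<lambda>q. ?y q $ i) q"
    using hol curve
  proof eventually_elim
    case (elim q)
    then show ?case
      unfolding vector_smult_component divide_inverse
      using off_branch_points[of q r s t] holomorphic_at_analytic[OF power4]
      by (intro allI holomorphic_at_mult holomorphic_at_inverse_snd holomorphic_at_theta_mult) auto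
  qed
  moreover have "((\<lambda>q. \<tau> q *s (vector [fst q * ?y q $ 1, (fst q)^2 * ?y q $ 2] :: complex^2)) \<longlongrightarrow> (\<gamma>' * m) *s vector [0, 1]) \<F>"
  proof (rule vec_tendstoI)
    have *: "(fst q)^4 / snd q = (fst q)^2 * \<tau> q" for q
      by (simp add: \<tau>_def power4_eq_xxxx power2_eq_square)
    \<comment> \<open>Each power of \<open>x\<close> is matched with the entry or component whose
      growth it compensates; one factor \<open>\<tau>\<close> is left over and makes the first
      component vanish.\<close>
    have "((\<lambda>q. \<tau> q * ((fst q)^2 * A (fst q) $ 1 $ 1 * (\<tau> q * (fst q * z q $ 1))
        + fst q * A (fst q) $ 1 $ 2 * (\<tau> q * ((fst q)^2 * z q $ 2)))) \<longlongrightarrow> 0 * (\<alpha> * 0 + \<beta> * \<kappa>)) \<F>"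
      by (intro tendsto_mult tendsto_add \<tau> limA z1 z2)
    moreover have "\<tau> q * ((fst q)^2 * A (fst q) $ 1 $ 1 * (\<tau> q * (fst q * z q $ 1))
        + fst q * A (fst q) $ 1 $ 2 * (\<tau> q * ((fst q)^2 * z q $ 2)))
      = (\<tau> q *s (vector [fst q * ?y q $ 1, (fst q)^2 * ?y q $ 2] :: complex^2)) $ 1" for q
      by (simp add: * theta matrix_vector_mult_def sum_2 power2_eq_square algebra_simps)
    ultimately have 1: "((\<lambda>q. (\<tau> q *s (vector [fst q * ?y q $ 1, (fst q)^2 * ?y q $ 2] :: complex^2)) $ 1) \<longlongrightarrow> 0) \<F>"
      by simp
    \<comment> \<open>Here both factors \<open>\<tau>\<close> are needed to balance
      \<open>x\<close>, so \<open>fst q * z q $ 1\<close> itself must converge; this is where the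
      removable singularity enters.\<close>
    have "((\<lambda>q. (fst q)^2 * A (fst q) $ 2 $ 1 * (fst q * (\<tau> q)^2) * (fst q * z q $ 1)
        - (fst q)^2 * A (fst q) $ 1 $ 1 * \<tau> q * (\<tau> q * ((fst q)^2 * z q $ 2))) \<longlongrightarrow> \<gamma>' * 1 * m - \<alpha> * 0 * \<kappa>) \<F>"
      by (intro tendsto_mult tendsto_diff \<tau> limA z2 x\<tau> m)
    moreover have "(fst q)^2 * A (fst q) $ 2 $ 1 * (fst q * (\<tau> q)^2) * (fst q * z q $ 1)
        - (fst q)^2 * A (fst q) $ 1 $ 1 * \<tau> q * (\<tau> q * ((fst q)^2 * z q $ 2))
      = (\<tau> q *s (vector [fst q * ?y q $ 1, (fst q)^2 * ?y q $ 2] :: complex^2)) $ 2" for q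
      by (simp add: * theta matrix_vector_mult_def sum_2 A22 power2_eq_square algebra_simps)
    ultimately have 2: "((\<lambda>q. (\<tau> q *s (vector [fst q * ?y q $ 1, (fst q)^2 * ?y q $ 2] :: complex^2)) $ 2) \<longlongrightarrow> \<gamma>' * m) \<F>"
      by simp
    show "((\<lambda>q. (\<tau> q *s (vector [fst q * ?y q $ 1, (fst q)^2 * ?y q $ 2] :: complex^2)) $ i)
        \<longlongrightarrow> ((\<gamma>' * m) *s vector [0, 1] :: complex^2) $ i) \<F>" for i
      using exhaust_2[of i] 1 2 by auto
  qed
  ultimately show ?thesis
    unfolding E_Omega_germ_def E_germ_def coord frame dx par' \<F>_def
    by (simp only: weierstrass.simps if_True) blast
qed

lemma isCont_scale_mat_pole:
  assumes "e' \<noteq> e"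
  shows "isCont (\<lambda>x. scale_mat (k / (x - e')) N $ i $ j) e"
  unfolding scale_mat_def vec_lambda_beta using assms by (intro continuous_intros) auto

lemma higgs_field_theta:
  assumes distinct: "r \<notin> {0, 1}" "s \<notin> {0, 1}" "t \<notin> {0, 1}" "r \<noteq> s" "r \<noteq> t" "s \<noteq> t"
    and deriv: "\<And>e. e \<in> {0, 1, r, s, t} \<Longrightarrow> deriv (quintic r s t) e \<noteq> 0"
  shows "higgs_field r s t p (theta r s t p c)"
  unfolding higgs_field_def
proof (intro conjI ballI allI impI)
  show "case q of (x, y) \<Rightarrow> y \<noteq> 0 \<longrightarrow> trace (theta r s t p c (x, y)) = 0" for q
    by (cases q) (simp add: trace_def sum_2 theta_def scale_mat_def theta_basis_entries algebra_simps)
next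
  fix P z assume P: "P \<in> curve r s t" and z: "E_germ r s t p P z"
  show "E_Omega_germ r s t p P (\<lambda>q. theta r s t p c q *v z q)"
  proof (cases P)
    case None
    then show ?thesis using E_Omega_germ_infinity z by simp
  next
    case (Some w)
    obtain x y where w: "w = (x, y)" by (cases w)
    have xy: "(x, y) \<in> affine_curve r s t"
      using P Some w by (auto simp: curve_def)
    show ?thesis
    proof (cases "y = 0")
      case False
      have "dx_coeff (Some (x, y)) q = 1" for q
        using False by (cases q) simp
      moreover have "fst (x, y) \<notin> {0, 1, r, s, t}"
        using off_branch_points[OF xy] False by simp
      ultimately show ?thesis
        using z False holomorphic_at_theta_mult[of "(x, y)" r s t z p c]
        by (simp add: E_Omega_germ_def E_germ_def Some w)
    next
      case True
      have "x \<in> {0, 1, r, s, t}"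
        using xy True by (auto simp: affine_curve_def quintic_def)
      have e: "quintic r s t x = 0" using xy True by (simp add: affine_curve_def)
      note d = deriv[OF \<open>x \<in> _\<close>]
      define k0 k1 where "k0 = c $ 1 * (1 - p $ 1) + c $ 2 * (1 - p $ 2) + c $ 3 * (1 - p $ 3)"
        and "k1 = c $ 1 * p $ 1 + c $ 2 * p $ 2 + c $ 3 * p $ 3"
      \<comment> \<open>One summand per pole, so that at each branch point the singular summand
        splits off and the others are continuous.\<close>
      define T0 T1 Tr Ts Tt where "T0 u = scale_mat (k0 / (u - 0)) (mat2 0 0 1 0)"
        and "T1 u = scale_mat (k1 / (u - 1)) (mat2 1 (-1) 1 (-1))"
        and "Tr u = scale_mat (- c $ 1 / (u - r)) (mat2 (p $ 1) (- ((p $ 1)^2)) 1 (- p $ 1))"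
        and "Ts u = scale_mat (- c $ 2 / (u - s)) (mat2 (p $ 2) (- ((p $ 2)^2)) 1 (- p $ 2))"
        and "Tt u = scale_mat (- c $ 3 / (u - t)) (mat2 (p $ 3) (- ((p $ 3)^2)) 1 (- p $ 3))" for u
      note T_defs = T0_def T1_def Tr_def Ts_def Tt_def
      have th: "theta r s t p c q = T0 (fst q) + T1 (fst q) + Tr (fst q) + Ts (fst q) + Tt (fst q)" for q
        unfolding theta_entries T_defs k0_def k1_def by simp
      have N: "mat2 h (- (h^2)) 1 (- h) *v v = (v $ 1 - h * v $ 2) *s vector [h, 1]" for h v
        by (simp add: vec_eq_iff forall_2 matrix_vector_mult_def sum_2 mat2_def power2_eq_square algebra_simps)
      have N0: "mat2 0 0 1 0 *v v = (v $ 1 - 0 * v $ 2) *s vector [0, 1]" for v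
        by (simp add: vec_eq_iff forall_2 matrix_vector_mult_def sum_2 mat2_def)
      have N1: "mat2 1 (-1) 1 (-1) *v v = (v $ 1 - 1 * v $ 2) *s vector [1, 1]" for v
        by (simp add: vec_eq_iff forall_2 matrix_vector_mult_def sum_2 mat2_def)
      note zx = z[unfolded Some w True]
      have germ: "E_Omega_germ r s t p (Some (x, 0)) (\<lambda>q. theta r s t p c q *v z q)"
        using \<open>x \<in> _\<close>
      proof (elim insertE emptyE)
        assume x: "x = 0"
        show ?thesis
        proof (rule E_Omega_germ_finite[OF e d _ _ _ N0 _ zx])
          show "theta r s t p c q = scale_mat (k0 / (fst q - x)) (mat2 0 0 1 0) + (T1 (fst q) + Tr (fst q) + Ts (fst q) + Tt (fst q))" for q
            unfolding th x T0_def by (simp only: ac_simps)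
          show "isCont (\<lambda>u. (T1 u + Tr u + Ts u + Tt u) $ i $ j) x" for i j
            unfolding T_defs vector_add_component
            by (intro continuous_add isCont_scale_mat_pole) (use distinct x in auto)
          show "parabolic r s t p (Some x) = vector [0, 1]"
            using distinct by (auto simp: x parabolic_def)
        qed simp
      next
        assume x: "x = 1"
        show ?thesis
        proof (rule E_Omega_germ_finite[OF e d _ _ _ N1 _ zx])
          show "theta r s t p c q = scale_mat (k1 / (fst q - x)) (mat2 1 (-1) 1 (-1)) + (T0 (fst q) + Tr (fst q) + Ts (fst q) + Tt (fst q))" for q
            unfolding th x T1_def by (simp only: ac_simps)
          show "isCont (\<lambda>u. (T0 u + Tr u + Ts u + Tt u) $ i $ j) x" for i j
            unfolding T_defs vector_add_component
            by (intro continuous_add isCont_scale_mat_pole) (use distinct x in auto)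
          show "parabolic r s t p (Some x) = vector [1, 1]"
            using distinct by (auto simp: x parabolic_def)
        qed simp
      next
        assume x: "x = r"
        show ?thesis
        proof (rule E_Omega_germ_finite[OF e d _ _ _ N _ zx])
          show "theta r s t p c q = scale_mat (- c $ 1 / (fst q - x)) (mat2 (p $ 1) (- ((p $ 1)^2)) 1 (- p $ 1)) + (T0 (fst q) + T1 (fst q) + Ts (fst q) + Tt (fst q))" for q
            unfolding th x Tr_def by (simp only: ac_simps)
          show "isCont (\<lambda>u. (T0 u + T1 u + Ts u + Tt u) $ i $ j) x" for i j
            unfolding T_defs vector_add_component
            by (intro continuous_add isCont_scale_mat_pole) (use distinct x in auto)
          show "parabolic r s t p (Some x) = vector [p $ 1, 1]"
            using distinct by (auto simp: x parabolic_def)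
        qed simp
      next
        assume x: "x = s"
        show ?thesis
        proof (rule E_Omega_germ_finite[OF e d _ _ _ N _ zx])
          show "theta r s t p c q = scale_mat (- c $ 2 / (fst q - x)) (mat2 (p $ 2) (- ((p $ 2)^2)) 1 (- p $ 2)) + (T0 (fst q) + T1 (fst q) + Tr (fst q) + Tt (fst q))" for q
            unfolding th x Ts_def by (simp only: ac_simps)
          show "isCont (\<lambda>u. (T0 u + T1 u + Tr u + Tt u) $ i $ j) x" for i j
            unfolding T_defs vector_add_component
            by (intro continuous_add isCont_scale_mat_pole) (use distinct x in auto)
          show "parabolic r s t p (Some x) = vector [p $ 2, 1]"
            using distinct by (auto simp: x parabolic_def)
        qed simp
      next
        assume x: "x = t"
        show ?thesis
        proof (rule E_Omega_germ_finite[OF e d _ _ _ N _ zx])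
          show "theta r s t p c q = scale_mat (- c $ 3 / (fst q - x)) (mat2 (p $ 3) (- ((p $ 3)^2)) 1 (- p $ 3)) + (T0 (fst q) + T1 (fst q) + Tr (fst q) + Ts (fst q))" for q
            unfolding th x Tt_def by (simp only: ac_simps)
          show "isCont (\<lambda>u. (T0 u + T1 u + Tr u + Ts u) $ i $ j) x" for i j
            unfolding T_defs vector_add_component
            by (intro continuous_add isCont_scale_mat_pole) (use distinct x in auto)
          show "parabolic r s t p (Some x) = vector [p $ 3, 1]"
            using distinct by (auto simp: x parabolic_def)
        qed simp
      qed
      then show ?thesis by (simp add: Some w True)
    qed
  qed
qed

section \<open>The Hitchin map\<close>

theorem mainTheorem1:
  fixes r s t \<omega>0 \<omega>1 \<omega>r \<omega>s :: complex
  assumes "r \<notin> {0, 1}" and "s \<notin> {0, 1}" and "t \<notin> {0, 1}"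
    and "r \<noteq> s" and "r \<noteq> t" and "s \<noteq> t"
    and "\<omega>0\<^sup>2 = deriv (quintic r s t) 0"
    and "\<omega>1\<^sup>2 = - deriv (quintic r s t) 1"
    and "\<omega>r\<^sup>2 = deriv (quintic r s t) r"
    and "\<omega>s\<^sup>2 = deriv (quintic r s t) s"
    and "invertible (u_matrix r s t \<omega>0 \<omega>1 \<omega>r \<omega>s)"
  shows
    "zariski_generic (\<lambda>p. locally_biholomorphic_at (phi_chart r s t \<omega>0 \<omega>1 \<omega>r \<omega>s) p \<and>
                          u_coords r s t \<omega>0 \<omega>1 \<omega>r \<omega>s p $ 4 \<noteq> 0)
     \<and>
     (\<forall>p :: complex^3. \<forall>\<eta>0 \<eta>1 \<eta>2 u0 u1 u2 u3 h0 h1 h2 :: complex. \<forall>\<theta>E.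
        locally_biholomorphic_at (phi_chart r s t \<omega>0 \<omega>1 \<omega>r \<omega>s) p \<longrightarrow>
        u0 = u_coords r s t \<omega>0 \<omega>1 \<omega>r \<omega>s p $ 1 \<longrightarrow>
        u1 = u_coords r s t \<omega>0 \<omega>1 \<omega>r \<omega>s p $ 2 \<longrightarrow>
        u2 = u_coords r s t \<omega>0 \<omega>1 \<omega>r \<omega>s p $ 3 \<longrightarrow>
        u3 = u_coords r s t \<omega>0 \<omega>1 \<omega>r \<omega>s p $ 4 \<longrightarrow>
        u3 \<noteq> 0 \<longrightarrow>
        \<theta>E = theta r s t p
               (pullback_covector (phi_chart r s t \<omega>0 \<omega>1 \<omega>r \<omega>s) p (vector [\<eta>0, \<eta>1, \<eta>2])) \<longrightarrow>
        4 * u3^4 * h0 =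
            r * s * t * (\<eta>0*(u0^2 - u3^2) + \<eta>1*(u0*u1 + u2*u3) + \<eta>2*(u0*u2 + u1*u3))^2
          - s*t * (\<eta>0*(u0*u1 - u2*u3) + \<eta>1*(u1^2 + u3^2) + \<eta>2*(u0*u3 + u1*u2))^2
          + 4 * r * s * (\<eta>0*u0 + \<eta>1*u1)^2 * u3^2
          - r*t * (\<eta>0*(u0^2 + u3^2) + \<eta>1*(u0*u1 + u2*u3) + \<eta>2*(u0*u2 - u1*u3))^2 \<longrightarrow>
        4 * u3^4 * h1 =
            t * (u0^2 + u1^2 + u2^2 + u3^2)
              * ((\<eta>0^2 + \<eta>1^2 + \<eta>2^2) * u3^2 + (\<eta>0*u0 + \<eta>1*u1 + \<eta>2*u2)^2)
          + s*t * (u0^2 - u1^2 + u2^2 - u3^2)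
              * ((\<eta>0^2 - \<eta>1^2 + \<eta>2^2) * u3^2 - (\<eta>0*u0 + \<eta>1*u1 + \<eta>2*u2)^2)
          + 4*r * (u0*u2 - u1*u3) * u3 * (\<eta>0*\<eta>2*u3 + (\<eta>0*u0 + \<eta>1*u1 + \<eta>2*u2) * \<eta>1)
          + 4 * r * s * (u0*u2 + u1*u3) * u3 * (\<eta>0*\<eta>2*u3 - (\<eta>0*u0 + \<eta>1*u1 + \<eta>2*u2) * \<eta>1)
          + 4 * s * (u0*u3 + u1*u2) * u3 * (\<eta>1*\<eta>2*u3 - (\<eta>0*u0 + \<eta>1*u1 + \<eta>2*u2) * \<eta>0)
          + 4*r*t * (u0*u1 + u2*u3) * u3 * (\<eta>0*\<eta>1*u3 - (\<eta>0*u0 + \<eta>1*u1 + \<eta>2*u2) * \<eta>2) \<longrightarrow>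
        4 * u3^4 * h2 =
            s * (\<eta>0*(u0*u2 + u1*u3) + \<eta>1*(u0*u3 + u1*u2) + \<eta>2*(u2^2 - u3^2))^2
          - (\<eta>0*(u0*u2 - u1*u3) + \<eta>1*(u0*u3 + u1*u2) + \<eta>2*(u2^2 + u3^2))^2
          - t * (\<eta>0*(u0*u1 + u2*u3) + \<eta>1*(u1^2 + u3^2) - \<eta>2*(u0*u3 - u1*u2))^2
          + 4*r * (\<eta>1*u1 + \<eta>2*u2)^2 * u3^2 \<longrightarrow>
        higgs_field r s t p \<theta>E \<and>
        (\<forall>(x, y) \<in> affine_curve r s t. y \<noteq> 0 \<longrightarrow>
           det (\<theta>E (x, y)) = (h2 * x^2 + h1 * x + h0) / (x * (x - 1) * (x - r) * (x - s) * (x - t))))"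
proof -
  interpret u_chart r s t \<omega>0 \<omega>1 \<omega>r \<omega>s
    using assms by unfold_locales
  have branch: "deriv (quintic r s t) e \<noteq> 0" if "e \<in> {0, 1, r, s, t}" for e
    using that distinct by (auto simp: deriv_quintic)
  show ?thesis
  proof (intro conjI allI impI)
    show "zariski_generic (\<lambda>p. locally_biholomorphic_at (phi_chart r s t \<omega>0 \<omega>1 \<omega>r \<omega>s) p \<and>
        u_coords r s t \<omega>0 \<omega>1 \<omega>r \<omega>s p $ 4 \<noteq> 0)"
      using assms(11) by (rule phi_generic)
  next
    fix p :: "complex^3" and \<eta>0 \<eta>1 \<eta>2 u0 u1 u2 u3 h0 h1 h2 :: complex and \<theta>E
    assume \<theta>E: "\<theta>E = theta r s t p (pullback_covector (phi_chart r s t \<omega>0 \<omega>1 \<omega>r \<omega>s) p (vector [\<eta>0, \<eta>1, \<eta>2]))"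
    show "higgs_field r s t p \<theta>E"
      unfolding \<theta>E using assms(1-6) branch by (rule higgs_field_theta)
  next
    fix p :: "complex^3" and \<eta>0 \<eta>1 \<eta>2 u0 u1 u2 u3 h0 h1 h2 :: complex and \<theta>E
    assume u_eqs: "u0 = u_coords r s t \<omega>0 \<omega>1 \<omega>r \<omega>s p $ 1" "u1 = u_coords r s t \<omega>0 \<omega>1 \<omega>r \<omega>s p $ 2"
        "u2 = u_coords r s t \<omega>0 \<omega>1 \<omega>r \<omega>s p $ 3" "u3 = u_coords r s t \<omega>0 \<omega>1 \<omega>r \<omega>s p $ 4"
      and u3: "u3 \<noteq> 0"
      and \<theta>E: "\<theta>E = theta r s t p (pullback_covector (phi_chart r s t \<omega>0 \<omega>1 \<omega>r \<omega>s) p (vector [\<eta>0, \<eta>1, \<eta>2]))"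
      and h: "4 * u3^4 * h0 =
            r * s * t * (\<eta>0*(u0^2 - u3^2) + \<eta>1*(u0*u1 + u2*u3) + \<eta>2*(u0*u2 + u1*u3))^2
          - s*t * (\<eta>0*(u0*u1 - u2*u3) + \<eta>1*(u1^2 + u3^2) + \<eta>2*(u0*u3 + u1*u2))^2
          + 4 * r * s * (\<eta>0*u0 + \<eta>1*u1)^2 * u3^2
          - r*t * (\<eta>0*(u0^2 + u3^2) + \<eta>1*(u0*u1 + u2*u3) + \<eta>2*(u0*u2 - u1*u3))^2"
        "4 * u3^4 * h1 =
            t * (u0^2 + u1^2 + u2^2 + u3^2)
              * ((\<eta>0^2 + \<eta>1^2 + \<eta>2^2) * u3^2 + (\<eta>0*u0 + \<eta>1*u1 + \<eta>2*u2)^2)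
          + s*t * (u0^2 - u1^2 + u2^2 - u3^2)
              * ((\<eta>0^2 - \<eta>1^2 + \<eta>2^2) * u3^2 - (\<eta>0*u0 + \<eta>1*u1 + \<eta>2*u2)^2)
          + 4*r * (u0*u2 - u1*u3) * u3 * (\<eta>0*\<eta>2*u3 + (\<eta>0*u0 + \<eta>1*u1 + \<eta>2*u2) * \<eta>1)
          + 4 * r * s * (u0*u2 + u1*u3) * u3 * (\<eta>0*\<eta>2*u3 - (\<eta>0*u0 + \<eta>1*u1 + \<eta>2*u2) * \<eta>1)
          + 4 * s * (u0*u3 + u1*u2) * u3 * (\<eta>1*\<eta>2*u3 - (\<eta>0*u0 + \<eta>1*u1 + \<eta>2*u2) * \<eta>0)
          + 4*r*t * (u0*u1 + u2*u3) * u3 * (\<eta>0*\<eta>1*u3 - (\<eta>0*u0 + \<eta>1*u1 + \<eta>2*u2) * \<eta>2)"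
        "4 * u3^4 * h2 =
            s * (\<eta>0*(u0*u2 + u1*u3) + \<eta>1*(u0*u3 + u1*u2) + \<eta>2*(u2^2 - u3^2))^2
          - (\<eta>0*(u0*u2 - u1*u3) + \<eta>1*(u0*u3 + u1*u2) + \<eta>2*(u2^2 + u3^2))^2
          - t * (\<eta>0*(u0*u1 + u2*u3) + \<eta>1*(u1^2 + u3^2) - \<eta>2*(u0*u3 - u1*u2))^2
          + 4*r * (\<eta>1*u1 + \<eta>2*u2)^2 * u3^2"
    define \<xi>0 \<xi>1 \<xi>2 \<xi>3 where "\<xi>0 = \<eta>0 / u3" and "\<xi>1 = \<eta>1 / u3" and "\<xi>2 = \<eta>2 / u3"
      and "\<xi>3 = - ((\<eta>0*u0 + \<eta>1*u1 + \<eta>2*u2) / u3^2)"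
    note numerators = hitchin_values[where p = p and ?\<eta>0.0 = \<eta>0 and ?\<eta>1.0 = \<eta>1 and ?\<eta>2.0 = \<eta>2, folded u_eqs, OF u3, folded \<xi>0_def \<xi>1_def \<xi>2_def \<xi>3_def]
    have "\<eta>0 = \<xi>0*u3" "\<eta>1 = \<xi>1*u3" "\<eta>2 = \<xi>2*u3"
      using u3 by (simp_all add: \<xi>0_def \<xi>1_def \<xi>2_def)
    note forms = homogeneous_forms[OF this numerators(4)]
    have cancel: "A = h" if "4*A = B" "4 * u3^4 * h = u3^4 * B" for A B h
    proof -
      have "4*A = 4*h" using that u3 by simp
      then show ?thesis by simp
    qed
    \<comment> \<open>The linear coefficient on both sides is the value at \<open>1\<close> minus
      the value at \<open>0\<close> minus the leading coefficient.\<close>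
    have "4*(A1 - A0 - A2) = B1 - B0 - B2" if "4*A0 = B0" "4*A1 = B1" "4*A2 = B2" for A0 A1 A2 B0 B1 B2 :: complex
      unfolding that[symmetric] by (simp add: right_diff_distrib)
    note h1 = cancel[OF this[OF numerators(1-3)[symmetric]] trans[OF h(2) forms(2)]]
      and h0 = cancel[OF numerators(1)[symmetric] trans[OF h(1) forms(1)]]
      and h2 = cancel[OF numerators(3)[symmetric] trans[OF h(3) forms(3)]]
    show "\<forall>(x, y) \<in> affine_curve r s t. y \<noteq> 0 \<longrightarrow>
           det (\<theta>E (x, y)) = (h2 * x^2 + h1 * x + h0) / (x * (x - 1) * (x - r) * (x - s) * (x - t))"
    proof clarify
      fix x y assume xy: "(x, y) \<in> affine_curve r s t" "y \<noteq> 0"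
      then have "x \<notin> {0, 1, r, s, t}"
        using off_branch_points[OF xy(1)] by simp
      from det_theta[OF this]
      show "det (\<theta>E (x, y)) = (h2 * x^2 + h1 * x + h0) / (x * (x - 1) * (x - r) * (x - s) * (x - t))"
        unfolding \<theta>E h1[symmetric] h0[symmetric] h2[symmetric] .
    qed
  qed
qed

end
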